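(* Let $m>0$. Assume $Z_1(0), Z_1(1)\in \overline{\mathsf{Q}_i}$ and $Z_2(0), Z_2(1)\in \overline{\mathsf{Q}_j}$, where $\overline{\mathsf{Q}_i}$ and $\overline{\mathsf{Q}_j}$ are two adjacent closed quadrants. Let $Z=(Z_1,Z_2)\in H^1([0,1],\mathbb{C}^2)$ be a minimizer connecting the two fixed ends $Z(0)=(Z_1(0),Z_2(0))$ and $Z(1)=(Z_1(1),Z_2(1))$, that is, $$\mathcal{A}(Z)=\inf_{\widehat Z\in P(Z(0),Z(1))}\mathcal{A}(\widehat Z).$$ Then $Z_1(t)$ and $Z_2(t)$ stay in two adjacent closed quadrants for all $t\in[0,1]$ (i.e. there are two adjacent closed quadrants such that $Z_1(t)$ lies in one of them and $Z_2(t)$ lies in the other for all $t\in[0,1]$), and they satisfy one of the following three cases: (a) both $Z_1(t)$ and $Z_2(t)$ are away from the coordinate axes for all $t\in(0,1)$; (b) both $Z_1(t)$ and $Z_2(t)$ are on the coordinate axes for all $t\in[0,1]$ and they never touch the origin in $(0,1)$; (c) $Z=(Z_1,Z_2)$ is part of an Euler orbit with $Z_2(t)\equiv 0$ for all $t\in[0,1]$.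
   Context: Planar three-body problem with masses $(m_1,m_2,m_3)=(1,m,m)$, $m>0$, positions $q_1,q_2,q_3\in\mathbb{C}$ and center of mass at the origin ($q_1+mq_2+mq_3=0$). The Jacobi coordinates are $Z_1=q_3-q_2$, $Z_2=q_1-\frac{q_2+q_3}{2}=(1+\frac{1}{2m})q_1$; the map $q\mapsto Z=(Z_1,Z_2)\in\mathbb{C}^2$ is a linear bijection. The kinetic energy and potential are $$K=\frac m4|\dot Z_1|^2+\frac{m}{2m+1}|\dot Z_2|^2,\qquad U=\frac{m^2}{|Z_1|}+\frac{m}{|\frac12Z_1+Z_2|}+\frac{m}{|\frac12 Z_1-Z_2|},$$ the action is $\mathcal{A}(Z)=\int_0^1(K+U)\,dt$, and $P(Z(0),Z(1))=\{\widehat Z\in H^1([0,1],\mathbb{C}^2): \widehat Z(0)=Z(0),\ \widehat Z(1)=Z(1)\}$. The Newtonian equations in these coordinates are $$\ddot Z_1=\frac{Z_2-Z_1/2}{|Z_2-Z_1/2|^3}-\frac{Z_2+Z_1/2}{|Z_2+Z_1/2|^3}-\frac{2mZ_1}{|Z_1|^3},\qquad \ddot Z_2=-\frac{1+2m}{2}\left[\frac{Z_2-Z_1/2}{|Z_2-Z_1/2|^3}+\frac{Z_2+Z_1/2}{|Z_2+Z_1/2|^3}\right].$$ $\mathsf{Q}_i$ ($i=1,2,3,4$) is the $i$-th open quadrant of the Cartesian $xy$-plane $\mathbb{C}\cong\mathbb{R}^2$ and $\overline{\mathsf{Q}_i}$ its closure. Two closed quadrants are adjacent if they are distinct and share a half-axis.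 An Euler orbit here means a solution of the Newtonian equations in which body 1 stays at the origin, the midpoint of bodies 2 and 3, i.e. $Z_2\equiv0$. *)

theory Defs
  imports "HOL-Analysis.Analysis"
begin

text \<open>
  A pair \<open>(z1, z2)\<close> collects the two Jacobi coordinates.  Paths are total functions on the
  reals; only their values on \<open>{0..1}\<close> are ever used.
\<close>

definition kinetic :: "real \<Rightarrow> complex \<times> complex \<Rightarrow> real" where
  "kinetic m v = m / 4 * (cmod (fst v))\<^sup>2 + m / (2 * m + 1) * (cmod (snd v))\<^sup>2"

text \<open>
  The potential takes values in \<^typ>\<open>ennreal\<close>, where \<open>x / 0 = \<infinity>\<close> for \<open>x \<noteq> 0\<close>; hence it is
  infinite at collisions.  (With \<^typ>\<open>real\<close> division a collision would have cost zero.)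
\<close>

definition potential :: "real \<Rightarrow> complex \<times> complex \<Rightarrow> ennreal" where
  "potential m z =
     ennreal (m\<^sup>2) / ennreal (cmod (fst z))
   + ennreal m / ennreal (cmod (fst z / 2 + snd z))
   + ennreal m / ennreal (cmod (fst z / 2 - snd z))"

text \<open>
  The Sobolev space \<open>H\<^sup>1\<close> on \<open>[0,1]\<close>, its elements being represented by their absolutely
  continuous representatives: \<open>f\<close> is the indefinite integral of a square-integrable \<open>g\<close>.
  The function \<open>g\<close> is unique up to null sets, so the integral in \<open>action\<close>
  does not depend on the choice made in \<open>velocity\<close>.
\<close>

definition has_L2_derivative ::
    "(real \<Rightarrow> 'a::euclidean_space) \<Rightarrow> (real \<Rightarrow> 'a) \<Rightarrow> bool" where
  "has_L2_derivative f g \<longleftrightarrow>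
     set_borel_measurable lborel {0..1} g \<and>
     set_integrable lborel {0..1} (\<lambda>t. (norm (g t))\<^sup>2) \<and>
     (\<forall>t\<in>{0..1}. f t = f 0 + set_lebesgue_integral lborel {0..t} g)"

definition H1 :: "(real \<Rightarrow> 'a::euclidean_space) set" where
  "H1 = {f. \<exists>g. has_L2_derivative f g}"

definition velocity :: "(real \<Rightarrow> 'a::euclidean_space) \<Rightarrow> real \<Rightarrow> 'a" where
  "velocity f = (SOME g. has_L2_derivative f g)"

definition action :: "real \<Rightarrow> (real \<Rightarrow> complex \<times> complex) \<Rightarrow> ennreal" where
  "action m Z =
     (\<integral>\<^sup>+ t\<in>{0..1}. (ennreal (kinetic m (velocity Z t)) + potential m (Z t)) \<partial>lborel)"

definition fixed_end_paths ::
    "complex \<times> complex \<Rightarrow> complex \<times> complex \<Rightarrow> (real \<Rightarrow> complex \<times> complex) set" where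
  "fixed_end_paths a b = {W \<in> H1. W 0 = a \<and> W 1 = b}"

definition quadrant :: "nat \<Rightarrow> complex set" where
  "quadrant i =
     (if i = 1 then {z. Re z > 0 \<and> Im z > 0}
      else if i = 2 then {z. Re z < 0 \<and> Im z > 0}
      else if i = 3 then {z. Re z < 0 \<and> Im z < 0}
      else if i = 4 then {z. Re z > 0 \<and> Im z < 0}
      else {})"

definition half_axes :: "complex set set" where
  "half_axes = (\<lambda>d. {of_real r * d | r. r \<ge> 0}) ` {1, \<i>, -1, -\<i>}"

definition adjacent_quadrants :: "nat \<Rightarrow> nat \<Rightarrow> bool" where
  "adjacent_quadrants i j \<longleftrightarrow>
     i \<in> {1..4} \<and> j \<in> {1..4} \<and>
     closure (quadrant i) \<noteq> closure (quadrant j) \<and>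
     (\<exists>h\<in>half_axes. h \<subseteq> closure (quadrant i) \<inter> closure (quadrant j))"

definition coordinate_axes :: "complex set" where
  "coordinate_axes = {z. Re z = 0 \<or> Im z = 0}"

definition collision_free :: "complex \<times> complex \<Rightarrow> bool" where
  "collision_free z \<longleftrightarrow>
     fst z \<noteq> 0 \<and> snd z - fst z / 2 \<noteq> 0 \<and> snd z + fst z / 2 \<noteq> 0"

definition newton_force :: "real \<Rightarrow> complex \<times> complex \<Rightarrow> complex \<times> complex" where
  "newton_force m z =
     (let z1 = fst z; z2 = snd z;
          a = (z2 - z1 / 2) /\<^sub>R (cmod (z2 - z1 / 2)) ^ 3;
          b = (z2 + z1 / 2) /\<^sub>R (cmod (z2 + z1 / 2)) ^ 3
      in (a - b - (2 * m) *\<^sub>R (z1 /\<^sub>R (cmod z1) ^ 3),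
          - (((1 + 2 * m) / 2) *\<^sub>R (a + b))))"

text \<open>Derivatives are one-sided at those end points of the interval \<open>I\<close> that belong to \<open>I\<close>.\<close>

definition newton_solution ::
    "real \<Rightarrow> (real \<Rightarrow> complex \<times> complex) \<Rightarrow> real set \<Rightarrow> bool" where
  "newton_solution m Z I \<longleftrightarrow>
     (\<forall>t\<in>I. collision_free (Z t)) \<and>
     (\<exists>V. \<forall>t\<in>I. (Z has_vector_derivative V t) (at t within I) \<and>
                (V has_vector_derivative newton_force m (Z t)) (at t within I))"

definition euler_orbit ::
    "real \<Rightarrow> (real \<Rightarrow> complex \<times> complex) \<Rightarrow> real set \<Rightarrow> bool" where
  "euler_orbit m Z I \<longleftrightarrow> newton_solution m Z I \<and> (\<forall>t\<in>I. snd (Z t) = 0)"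

text \<open>
  The prescribed ends \<open>Z 0\<close>, \<open>Z 1\<close> may be collisions, where the Newtonian equations
  make no sense.  So the equations are required on the whole of \<open>{0..1}\<close> except at colliding ends;
  there must be no collision in between.
\<close>

definition part_of_euler_orbit :: "real \<Rightarrow> (real \<Rightarrow> complex \<times> complex) \<Rightarrow> bool" where
  "part_of_euler_orbit m Z \<longleftrightarrow>
     (\<forall>t\<in>{0<..<1}. collision_free (Z t)) \<and>
     euler_orbit m Z {t\<in>{0..1}. collision_free (Z t)}"

end

(* The potential depends on |Z1|, |Z2| and the inner product s of Z1 and Z2, and increases with |s|.
   Replacing the coordinates of Z by (|x1|, |y1|), (|x2|, -|y2|) keeps the kinetic energy and |Z1|, |Z2|
   but turns s = x1 x2 + y1 y2 into |x1 x2| - |y1 y2|.  For ends in adjacent quadrants the folded path is,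
   up to a reflection that preserves the action, a competitor with the same ends; hence it is a minimizer
   too, and x1 x2 y1 y2 <= 0 along Z.

   The folded path lives in a cone all of whose points can be pushed in one common direction that
   lengthens the three mutual distances; this rules out interior collisions without blow-up.  Being a
   solution of Newton's equations, a folded coordinate that vanishes at an interior time has zero velocity
   there, and the sign of its acceleration forces a second coordinate to vanish as well.  Uniqueness for a
   linear system then shows that it vanishes identically.  So each coordinate is either nowhere zero
   or identically zero, which gives the three cases. *)

theory Submission
  imports Defs
begin

section \<open>Paths with square-integrable derivative\<close>

text \<open>Only the ends of \<open>Z\<close> are known to lie in a pair of quadrants, so neither
  the cone nor the sign of an acceleration is available for \<open>Z\<close> itself. The folded path
  has both, and minimality makes up for the lost smoothness: a minimizer in the cone solves Newton's
  equations, so its coordinates cannot bounce off an axis with a kink. A zero of a coordinate of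
  \<open>Z\<close> thus becomes a minimum of a twice differentiable nonnegative function.

  The ends may be collisions. Then even finiteness of the minimum needs a special competitor, and
  the equations live on the open interval, with coefficients that may blow up at its ends.

  Where no coordinate vanishes, \<open>x1 x2 y1 y2 <= 0\<close> says that the two vectors lie in
  adjacent quadrants. A coordinate that vanishes identically may be given either sign, which saves
  adjacency in the degenerate cases. In case (c) the equations are needed for \<open>Z\<close> and
  not only for its folded image; where the product is nonpositive, folding keeps the three mutual
  distances up to order, so freedom from collisions carries back to \<open>Z\<close>.\<close>

abbreviation unit_lebesgue :: "real measure" where
  "unit_lebesgue \<equiv> restrict_space lborel {0..1}"

lemma space_unit_lebesgue [simp]: "space unit_lebesgue = {0..1}"
  by (simp add: space_restrict_space)

lemma sets_unit_lebesgue_iff: "A \<in> sets unit_lebesgue \<longleftrightarrow> A \<in> sets borel \<and> A \<subseteq> {0..1}"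
  by (subst sets_restrict_space_iff) auto

lemma emeasure_unit_lebesgue_space: "emeasure unit_lebesgue {0..1} = 1"
  by (simp add: emeasure_restrict_space)

lemma finite_measure_unit_lebesgue: "finite_measure unit_lebesgue"
  by (rule finite_measureI) (simp add: emeasure_unit_lebesgue_space)

lemma measure_unit_lebesgue_space [simp]: "measure unit_lebesgue {0..1} = 1"
  by (simp add: measure_def emeasure_unit_lebesgue_space)

lemma AE_unit_lebesgue: "(AE t in unit_lebesgue. P t) \<longleftrightarrow> (AE t in lborel. t \<in> {0..1} \<longrightarrow> P t)"
  by (subst AE_restrict_space_iff) auto

lemma continuous_on_imp_measurable_unit_lebesgue:
  fixes f :: "real \<Rightarrow> 'a::topological_space"
  assumes "continuous_on {0..1} f"
  shows "f \<in> borel_measurable unit_lebesgue"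
  using borel_measurable_continuous_on_restrict[OF assms]
  by (simp cong: measurable_cong_sets sets_restrict_space_cong)

lemma integral_unit_lebesgue_eq:
  fixes g :: "real \<Rightarrow> 'a::euclidean_space"
  assumes "S \<subseteq> {0..1}"
  shows "(LINT t:S|unit_lebesgue. g t) = (LINT t:S|lborel. g t)"
proof -
  have "(\<lambda>t. indicator {0..1} t *\<^sub>R indicat_real S t *\<^sub>R g t) = (\<lambda>t. indicat_real S t *\<^sub>R g t)"
    using assms by (auto simp: indicator_def fun_eq_iff)
  then show ?thesis
    by (simp add: set_lebesgue_integral_def integral_restrict_space)
qed

lemma set_integrable_unit_lebesgue_iff:
  fixes g :: "real \<Rightarrow> 'a::euclidean_space"
  shows "set_integrable lborel {0..1} g \<longleftrightarrow> integrable unit_lebesgue g"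
  by (simp add: integrable_restrict_space set_integrable_def)

lemma set_integrable_unit_lebesgue:
  fixes g :: "real \<Rightarrow> 'a::euclidean_space"
  assumes "integrable unit_lebesgue g" "S \<in> sets borel"
  shows "set_integrable unit_lebesgue S g"
proof -
  have "set_integrable unit_lebesgue (S \<inter> {0..1}) g"
    unfolding set_integrable_def
    by (rule integrable_mult_indicator) (use assms in \<open>auto simp: sets_unit_lebesgue_iff\<close>)
  then show ?thesis
    unfolding set_integrable_def
    by (subst (asm) Bochner_Integration.integrable_cong[OF refl, of _ _ "\<lambda>x. indicat_real S x *\<^sub>R g x"]) (auto simp: indicator_def)
qed

text \<open>Over the finite measure \<open>unit_lebesgue\<close> constants are integrable and the
  integration lemmas apply without indicator functions, so all later work is done in this
  form.\<close>

lemma has_L2_derivative_iff: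
  fixes f g :: "real \<Rightarrow> 'a::euclidean_space"
  shows "has_L2_derivative f g \<longleftrightarrow>
    g \<in> borel_measurable unit_lebesgue \<and> integrable unit_lebesgue (\<lambda>t. (norm (g t))\<^sup>2) \<and>
    (\<forall>t\<in>{0..1}. f t = f 0 + (LINT s:{0..t}|unit_lebesgue. g s))"
proof -
  have "set_borel_measurable lborel {0..1} g \<longleftrightarrow> g \<in> borel_measurable unit_lebesgue"
    unfolding set_borel_measurable_def
    by (subst borel_measurable_restrict_space_iff) auto
  then show ?thesis
    unfolding has_L2_derivative_def
    by (simp add: set_integrable_unit_lebesgue_iff integral_unit_lebesgue_eq)
qed

lemma square_integrable_unit_lebesgue:
  fixes g :: "real \<Rightarrow> 'a::euclidean_space"
  assumes [measurable]: "g \<in> borel_measurable unit_lebesgue"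
    and "integrable unit_lebesgue (\<lambda>t. (norm (g t))\<^sup>2)"
  shows "integrable unit_lebesgue g"
proof -
  interpret finite_measure unit_lebesgue by (rule finite_measure_unit_lebesgue)
  have "norm (g t) \<le> norm (1 + (norm (g t))\<^sup>2)" for t
  proof -
    have "0 \<le> (norm (g t) - 1/2)\<^sup>2" by simp
    also have "\<dots> = (norm (g t))\<^sup>2 - norm (g t) + 1/4" by (simp add: power2_eq_square algebra_simps)
    finally show ?thesis by simp
  qed
  moreover have "integrable unit_lebesgue (\<lambda>t. 1 + (norm (g t))\<^sup>2)"
    by (intro Bochner_Integration.integrable_add assms) simp
  ultimately show ?thesis
    by (intro Bochner_Integration.integrable_bound[OF _ assms(1)] AE_I2)
qed

lemma has_L2_derivativeD:
  fixes f g :: "real \<Rightarrow> 'a::euclidean_space"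
  assumes "has_L2_derivative f g"
  shows "g \<in> borel_measurable unit_lebesgue" "integrable unit_lebesgue (\<lambda>t. (norm (g t))\<^sup>2)"
    "integrable unit_lebesgue g"
    "t \<in> {0..1} \<Longrightarrow> f t = f 0 + (LINT s:{0..t}|unit_lebesgue. g s)"
proof -
  show m: "g \<in> borel_measurable unit_lebesgue" and i: "integrable unit_lebesgue (\<lambda>t. (norm (g t))\<^sup>2)"
    using assms by (auto simp: has_L2_derivative_iff)
  show "integrable unit_lebesgue g" by (rule square_integrable_unit_lebesgue[OF m i])
  show "t \<in> {0..1} \<Longrightarrow> f t = f 0 + (LINT s:{0..t}|unit_lebesgue. g s)"
    using assms unfolding has_L2_derivative_iff by blast
qed

lemma integral_unit_lebesgue_split:
  fixes g :: "real \<Rightarrow> 'a::euclidean_space"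
  assumes "integrable unit_lebesgue g" "a \<le> s" "s \<le> t"
  shows "(LINT x:{a..t}|unit_lebesgue. g x) =
    (LINT x:{a..s}|unit_lebesgue. g x) + (LINT x:{s<..t}|unit_lebesgue. g x)"
proof -
  have "{a..t} = {a..s} \<union> {s<..t}" using assms by auto
  moreover have "(LINT x:{a..s} \<union> {s<..t}|unit_lebesgue. g x)
     = (LINT x:{a..s}|unit_lebesgue. g x) + (LINT x:{s<..t}|unit_lebesgue. g x)"
    by (rule set_integral_Un) (auto intro!: set_integrable_unit_lebesgue assms)
  ultimately show ?thesis by simp
qed

text \<open>Half-open intervals are used so that adjacent pieces are disjoint and increments add
  up.\<close>

lemma has_L2_derivative_increment:
  fixes f g :: "real \<Rightarrow> 'a::euclidean_space"
  assumes "has_L2_derivative f g" "0 \<le> s" "s \<le> t" "t \<le> 1"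
  shows "f t - f s = (LINT x:{s<..t}|unit_lebesgue. g x)"
  using integral_unit_lebesgue_split[OF has_L2_derivativeD(3)[OF assms(1)] assms(2,3)]
    has_L2_derivativeD(4)[OF assms(1), of s] has_L2_derivativeD(4)[OF assms(1), of t] assms
  by simp

lemma continuous_on_indefinite_integral:
  fixes g :: "real \<Rightarrow> 'a::euclidean_space"
  assumes "integrable unit_lebesgue g"
  shows "continuous_on {0..1} (\<lambda>t. LINT s:{0..t}|unit_lebesgue. g s)"
proof -
  have si: "set_integrable lborel {0..1} g"
    using assms by (simp add: set_integrable_unit_lebesgue_iff)
  have "continuous_on {0..1} (\<lambda>t. integral {0..t} g)"
    by (rule indefinite_integral_continuous_1) (rule set_borel_integral_eq_integral(1)[OF si])
  moreover have "integral {0..t} g = (LINT s:{0..t}|unit_lebesgue. g s)" if "t \<in> {0..1}" for t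
  proof -
    have "set_integrable lborel {0..t} g"
      by (rule set_integrable_subset[OF si]) (use that in auto)
    from set_borel_integral_eq_integral(2)[OF this] that show ?thesis
      by (simp add: integral_unit_lebesgue_eq)
  qed
  ultimately show ?thesis
    by (rule continuous_on_eq)
qed

lemma has_L2_derivative_continuous:
  fixes f g :: "real \<Rightarrow> 'a::euclidean_space"
  assumes "has_L2_derivative f g"
  shows "continuous_on {0..1} f"
proof -
  have "continuous_on {0..1} (\<lambda>t. f 0 + (LINT s:{0..t}|unit_lebesgue. g s))"
    by (intro continuous_intros continuous_on_indefinite_integral has_L2_derivativeD[OF assms])
  then show ?thesis
    by (rule continuous_on_eq) (simp add: has_L2_derivativeD(4)[OF assms, symmetric])
qed

lemma norm_set_integral_le:
  fixes g :: "real \<Rightarrow> 'a::euclidean_space"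
  assumes "integrable unit_lebesgue g" "S \<in> sets borel"
  shows "norm (LINT x:S|unit_lebesgue. g x) \<le> (LINT x:S|unit_lebesgue. norm (g x))"
  using integral_norm_bound[of unit_lebesgue "\<lambda>x. indicat_real S x *\<^sub>R g x"]
  by (simp add: set_lebesgue_integral_def)

lemma set_integral_const_Ioc:
  assumes "0 \<le> s" "s \<le> t" "t \<le> 1"
  shows "(LINT x:{s<..t}|unit_lebesgue. (c::real)) = c * (t - s)"
proof -
  have "(LINT x:{s<..t}|unit_lebesgue. c) = (LINT x:{s<..t}|lborel. c)"
    by (rule integral_unit_lebesgue_eq) (use assms in auto)
  also have "\<dots> = c * (t - s)"
    using assms by (simp add: set_lebesgue_integral_def)
  finally show ?thesis .
qed

text \<open>Cauchy-Schwarz, derived from the pointwise Young inequality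
  \<open>norm (g x) \<le> l / 2 + (norm (g x))^2 / (2 * l)\<close> with a free parameter
  \<open>l > 0\<close>. It controls how fast a colliding separation can grow away from the
  collision.\<close>

lemma has_L2_derivative_hoelder:
  fixes f g :: "real \<Rightarrow> 'a::euclidean_space"
  assumes fg: "has_L2_derivative f g" and st: "0 \<le> s" "s \<le> t" "t \<le> 1"
  shows "(norm (f t - f s))\<^sup>2 \<le> (t - s) * (LINT x:{s<..t}|unit_lebesgue. (norm (g x))\<^sup>2)"
proof -
  define X where "X = norm (f t - f s)"
  define E where "E = (LINT x:{s<..t}|unit_lebesgue. (norm (g x))\<^sup>2)"
  note g = has_L2_derivativeD[OF fg]
  interpret finite_measure unit_lebesgue by (rule finite_measure_unit_lebesgue)
  have key: "2 * X \<le> l * (t - s) + E / l" if "l > 0" for l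
  proof -
    have "X \<le> (LINT x:{s<..t}|unit_lebesgue. norm (g x))"
      unfolding X_def has_L2_derivative_increment[OF fg st]
      by (rule norm_set_integral_le) (use g(3) in auto)
    also have "\<dots> \<le> (LINT x:{s<..t}|unit_lebesgue. l / 2 + (norm (g x))\<^sup>2 / (2 * l))"
    proof (rule set_integral_mono)
      show "norm (g x) \<le> l / 2 + (norm (g x))\<^sup>2 / (2 * l)" for x
      proof -
        have "0 \<le> (norm (g x) - l)\<^sup>2 / (2 * l)" using that by simp
        also have "\<dots> = (norm (g x))\<^sup>2 / (2 * l) - norm (g x) + l / 2"
          using that by (simp add: power2_eq_square field_simps)
        finally show ?thesis by simp
      qed
    qed (intro set_integrable_unit_lebesgue; use g(2,3) in simp)+
    also have "\<dots> = l / 2 * (t - s) + E / (2 * l)"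
    proof -
      have "(LINT x:{s<..t}|unit_lebesgue. l / 2 + (norm (g x))\<^sup>2 / (2 * l)) =
        (LINT x:{s<..t}|unit_lebesgue. l / 2) + (LINT x:{s<..t}|unit_lebesgue. (norm (g x))\<^sup>2 / (2 * l))"
        by (rule set_integral_add) (intro set_integrable_unit_lebesgue; use g(2,3) in simp)+
      then show ?thesis
        unfolding set_integral_const_Ioc[OF st] E_def by simp
    qed
    finally show ?thesis using that by (simp add: field_simps)
  qed
  show ?thesis
  proof (cases "X = 0 \<or> s = t")
    case True
    have "E \<ge> 0" unfolding E_def set_lebesgue_integral_def
      by (intro integral_nonneg_AE) (auto simp: indicator_def)
    with True st show ?thesis by (auto simp: X_def E_def)
  next
    case False
    then have "X > 0" "t - s > 0" using st by (auto simp: X_def)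
    \<comment> \<open>This \<open>l\<close> turns the first summand of the bound into
      \<open>X\<close>, which cancels against one half of the left side; no square root and no case
      \<open>E = 0\<close> arise.\<close>
    with key[of "X / (t - s)"] have "2 * X \<le> X + E * (t - s) / X" by simp
    then have "X * X \<le> E * (t - s)"
      using \<open>X > 0\<close> by (simp add: field_simps)
    then show ?thesis by (simp add: X_def E_def power2_eq_square mult.commute)
  qed
qed

section \<open>Uniqueness of the derivative\<close>

text \<open>The initial segments form an intersection-stable generator of the Borel sets, so a
  Dynkin argument extends the vanishing of the integral from them to all Borel sets, and a density
  with zero integrals vanishes almost everywhere.\<close>

lemma integrable_zero_integrals_imp_AE_zero:
  fixes h :: "real \<Rightarrow> 'a::euclidean_space"
  assumes h: "integrable unit_lebesgue h"
    and z: "\<And>t. t \<in> {0..1} \<Longrightarrow> (LINT s:{0..t}|unit_lebesgue. h s) = 0"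
  shows "AE t in unit_lebesgue. h t = 0"
proof -
  \<comment> \<open>Extension by zero moves the question to the whole line, where the sets
    \<open>{..a}\<close> generate \<open>borel\<close>.\<close>
  define k where "k = (\<lambda>t. indicat_real {0..1} t *\<^sub>R h t)"
  have k: "integrable lborel k"
    using h by (simp add: integrable_restrict_space k_def)
  have k0: "(LINT s:{..a}|lborel. k s) = 0" for a
  proof (cases "a < 0")
    case True
    then have "(\<lambda>s. indicat_real {..a} s *\<^sub>R k s) = (\<lambda>s. 0)"
      by (auto simp: k_def fun_eq_iff indicator_def)
    then show ?thesis by (simp add: set_lebesgue_integral_def)
  next
    case False
    then have "(\<lambda>s. indicat_real {..a} s *\<^sub>R k s) = (\<lambda>s. indicat_real {0..min a 1} s *\<^sub>R h s)"
      by (auto simp: k_def fun_eq_iff indicator_def)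
    then have "(LINT s:{..a}|lborel. k s) = (LINT s:{0..min a 1}|unit_lebesgue. h s)"
      by (subst integral_unit_lebesgue_eq) (auto simp: set_lebesgue_integral_def)
    then show ?thesis using z[of "min a 1"] False by simp
  qed
  have kS: "set_integrable lborel A k" if "A \<in> sets borel" for A
    unfolding set_integrable_def using k that by (intro integrable_mult_indicator) auto
  have kU: "(LINT s:UNIV|lborel. k s) = 0"
  proof -
    have "(\<lambda>s. indicat_real UNIV s *\<^sub>R k s) = (\<lambda>s. indicat_real {..1} s *\<^sub>R k s)"
      by (auto simp: k_def fun_eq_iff indicator_def)
    then have "(LINT s:UNIV|lborel. k s) = (LINT s:{..1}|lborel. k s)"
      unfolding set_lebesgue_integral_def by (rule arg_cong)
    then show ?thesis using k0[of 1] by (rule trans)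
  qed
  have "(LINT s:A|lborel. k s) = 0" if "A \<in> sets borel" for A
  proof -
    have A: "A \<in> sigma_sets UNIV (range (\<lambda>a. {..a::real}))"
      using that by (simp add: borel_eq_atMost)
    have I: "Int_stable (range (\<lambda>a. {..a::real}))"
      by (auto simp: Int_stable_def)
    have borelI: "B \<in> sets borel" if "B \<in> sigma_sets UNIV (range (\<lambda>a. {..a::real}))" for B
      using that by (simp add: borel_eq_atMost)
    have "range (\<lambda>a. {..a::real}) \<subseteq> Pow UNIV" by simp
    from I this A show ?thesis
    proof (induction rule: sigma_sets_induct_disjoint)
      case (compl A)
      have "(LINT s:(UNIV - A) \<union> A|lborel. k s) = (LINT s:UNIV - A|lborel. k s) + (LINT s:A|lborel. k s)"
        using borelI[OF compl(1)] by (intro set_integral_Un kS) auto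
      with compl kU show ?case by simp
    next
      case (union A)
      have [simp]: "A i \<in> sets borel" for i
        by (rule borelI) (use union(2) in auto)
      have "(LINT s:(\<Union>i. A i)|lborel. k s) = (\<Sum>i. (LINT s:A i|lborel. k s))"
        by (rule lebesgue_integral_countable_add)
          (use union(1) in \<open>auto intro!: kS simp: disjoint_family_on_def\<close>)
      then show ?case using union by simp
    qed (use k0 in \<open>auto simp: set_lebesgue_integral_def\<close>)
  qed
  then have "AE t in lborel. k t = 0"
    using sigma_finite_measure.density_zero[OF lborel.sigma_finite_measure_axioms k] by simp
  then show ?thesis
    unfolding AE_unit_lebesgue by (rule AE_mp) (auto simp: k_def)
qed

lemma has_L2_derivative_unique:
  fixes f g :: "real \<Rightarrow> 'a::euclidean_space"
  assumes "has_L2_derivative f g" "has_L2_derivative f h"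
  shows "AE t in unit_lebesgue. g t = h t"
proof -
  note g = has_L2_derivativeD[OF assms(1)] and h = has_L2_derivativeD[OF assms(2)]
  have "AE t in unit_lebesgue. g t - h t = 0"
  proof (rule integrable_zero_integrals_imp_AE_zero)
    fix t :: real assume t: "t \<in> {0..1}"
    have "(LINT s:{0..t}|unit_lebesgue. g s - h s) =
      (LINT s:{0..t}|unit_lebesgue. g s) - (LINT s:{0..t}|unit_lebesgue. h s)"
      by (intro set_integral_diff set_integrable_unit_lebesgue g(3) h(3)) auto
    then show "(LINT s:{0..t}|unit_lebesgue. g s - h s) = 0"
      using g(4)[OF t] h(4)[OF t] by simp
  qed (use g(3) h(3) in auto)
  then show ?thesis by simp
qed

section \<open>Linear operations on paths\<close>

lemma has_L2_derivative_linear: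
  fixes f g :: "real \<Rightarrow> 'a::euclidean_space" and T :: "'a \<Rightarrow> 'b::euclidean_space"
  assumes fg: "has_L2_derivative f g" and T: "bounded_linear T"
  shows "has_L2_derivative (\<lambda>t. T (f t)) (\<lambda>t. T (g t))"
  unfolding has_L2_derivative_iff
proof (intro conjI ballI)
  note g = has_L2_derivativeD[OF fg]
  show m: "(\<lambda>t. T (g t)) \<in> borel_measurable unit_lebesgue"
    by (rule measurable_compose[OF g(1) borel_measurable_continuous_onI[OF linear_continuous_on[OF T]]])
  obtain K where K: "\<And>x. norm (T x) \<le> norm x * K"
    using bounded_linear.bounded[OF T] by blast
  show "integrable unit_lebesgue (\<lambda>t. (norm (T (g t)))\<^sup>2)"
  proof (rule Bochner_Integration.integrable_bound)
    show "integrable unit_lebesgue (\<lambda>t. K\<^sup>2 * (norm (g t))\<^sup>2)" using g(2) by simp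
    show "AE t in unit_lebesgue. norm ((norm (T (g t)))\<^sup>2) \<le> norm (K\<^sup>2 * (norm (g t))\<^sup>2)"
      using power_mono[OF K, of _ 2] by (auto simp: power_mult_distrib mult.commute)
  qed (use m in measurable)
  fix t :: real assume t: "t \<in> {0..1}"
  have "T (LINT s:{0..t}|unit_lebesgue. g s) = (LINT s:{0..t}|unit_lebesgue. T (g s))"
    using integral_bounded_linear[OF T, of unit_lebesgue "\<lambda>s. indicat_real {0..t} s *\<^sub>R g s"]
      set_integrable_unit_lebesgue[OF g(3), of "{0..t}"]
    by (simp add: set_lebesgue_integral_def set_integrable_def linear_cmul[OF bounded_linear.linear[OF T]])
  then show "T (f t) = T (f 0) + (LINT s:{0..t}|unit_lebesgue. T (g s))"
    using g(4)[OF t] linear_add[OF bounded_linear.linear[OF T], of "f 0"] by simp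
qed

lemma has_L2_derivative_add:
  fixes f g :: "real \<Rightarrow> 'a::euclidean_space"
  assumes fg: "has_L2_derivative f g" and hk: "has_L2_derivative h k"
  shows "has_L2_derivative (\<lambda>t. f t + h t) (\<lambda>t. g t + k t)"
  unfolding has_L2_derivative_iff
proof (intro conjI ballI)
  note g = has_L2_derivativeD[OF fg] and k = has_L2_derivativeD[OF hk]
  note [measurable] = g(1) k(1)
  show "(\<lambda>t. g t + k t) \<in> borel_measurable unit_lebesgue" by measurable
  show "integrable unit_lebesgue (\<lambda>t. (norm (g t + k t))\<^sup>2)"
  proof (rule Bochner_Integration.integrable_bound)
    show "integrable unit_lebesgue (\<lambda>t. 2 * (norm (g t))\<^sup>2 + 2 * (norm (k t))\<^sup>2)" using g(2) k(2) by simp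
    have "(norm (x + y))\<^sup>2 \<le> 2 * (norm x)\<^sup>2 + 2 * (norm y)\<^sup>2" for x y :: 'a
      using zero_le_power2[of "norm (x - y)"]
      by (simp add: power2_norm_eq_inner inner_add_left inner_add_right inner_diff_left inner_diff_right inner_commute)
    then show "AE t in unit_lebesgue. norm ((norm (g t + k t))\<^sup>2) \<le> norm (2 * (norm (g t))\<^sup>2 + 2 * (norm (k t))\<^sup>2)"
      by simp
  qed measurable
  fix t :: real assume t: "t \<in> {0..1}"
  have "(LINT s:{0..t}|unit_lebesgue. g s + k s) =
      (LINT s:{0..t}|unit_lebesgue. g s) + (LINT s:{0..t}|unit_lebesgue. k s)"
    using g k by (intro set_integral_add set_integrable_unit_lebesgue) auto
  then show "f t + h t = f 0 + h 0 + (LINT s:{0..t}|unit_lebesgue. g s + k s)"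
    using g(4)[OF t] k(4)[OF t] by simp
qed

lemma borel_measurable_indicator_unit_lebesgue:
  "A \<in> sets borel \<Longrightarrow> indicat_real A \<in> borel_measurable unit_lebesgue"
  by (rule measurable_restrict_space1) simp

lemma set_integral_Icc_eq_Ioc:
  fixes g :: "real \<Rightarrow> 'a::euclidean_space"
  assumes "g \<in> borel_measurable unit_lebesgue"
  shows "(LINT x:{s..t}|unit_lebesgue. g x) = (LINT x:{s<..t}|unit_lebesgue. g x)"
proof (rule set_integral_cong_set)
  show "set_borel_measurable unit_lebesgue {s<..t} g" "set_borel_measurable unit_lebesgue {s..t} g"
    unfolding set_borel_measurable_def by (intro borel_measurable_scaleR borel_measurable_indicator_unit_lebesgue assms; simp)+
  show "AE x in unit_lebesgue. (x \<in> {s<..t}) = (x \<in> {s..t})"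
    unfolding AE_unit_lebesgue by (rule AE_mp[OF AE_lborel_singleton[of s]]) auto
qed

section \<open>Chain rule, absolute values and ramps\<close>

lemma integrable_mult_continuous:
  fixes g h :: "real \<Rightarrow> real"
  assumes g: "integrable unit_lebesgue g" and h: "continuous_on {0..1} h"
  shows "integrable unit_lebesgue (\<lambda>t. h t * g t)"
proof -
  obtain K where K: "\<And>t. t \<in> {0..1} \<Longrightarrow> norm (h t) \<le> K"
    using compact_imp_bounded[OF compact_continuous_image[OF h compact_Icc]]
    unfolding bounded_iff by (metis imageI)
  show ?thesis
  proof (rule Bochner_Integration.integrable_bound)
    show "integrable unit_lebesgue (\<lambda>t. K * g t)" using g by simp
    show "AE t in unit_lebesgue. norm (h t * g t) \<le> norm (K * g t)"
    proof (rule AE_I2)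
      fix t assume "t \<in> space unit_lebesgue"
      then have "\<bar>h t\<bar> \<le> \<bar>K\<bar>" using K[of t] by auto
      then show "norm (h t * g t) \<le> norm (K * g t)"
        by (simp add: abs_mult mult_right_mono)
    qed
  qed (intro borel_measurable_times continuous_on_imp_measurable_unit_lebesgue h borel_measurable_integrable g)
qed

text \<open>Mean value inequality for \<open>F u - F' c * u\<close>, whose derivative is smaller
  than \<open>e\<close> near \<open>c\<close>. The error is proportional to
  \<open>\<bar>q - p\<bar>\<close>, so over a subdivision the errors sum to at most \<open>e\<close>
  times the variation.\<close>

lemma chain_rule_local_bound:
  fixes F F' :: "real \<Rightarrow> real"
  assumes F: "\<And>u. (F has_real_derivative F' u) (at u)"
    and ball: "\<And>u. \<bar>u - c\<bar> < d \<Longrightarrow> \<bar>F' u - F' c\<bar> < e"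
    and "\<bar>p - c\<bar> < d" "\<bar>q - c\<bar> < d"
  shows "\<bar>F q - F p - F' c * (q - p)\<bar> \<le> e * \<bar>q - p\<bar>"
proof -
  have pq: "p \<in> ball c d" "q \<in> ball c d"
    using assms(3,4) by (simp_all add: dist_real_def abs_minus_commute)
  have "norm ((F q - F' c * q) - (F p - F' c * p)) \<le> e * norm (q - p)"
  proof (rule differentiable_bound[of "ball c d" "\<lambda>u. F u - F' c * u" "\<lambda>u x. (F' u - F' c) * x"])
    fix u assume "u \<in> ball c d"
    then have "\<bar>F' u - F' c\<bar> \<le> e" using ball[of u] by (auto simp: dist_real_def abs_minus_commute)
    then show "onorm ((*) (F' u - F' c)) \<le> e"
      by (intro onorm_le) (simp add: abs_mult mult_right_mono)
    show "((\<lambda>u. F u - F' c * u) has_derivative (*) (F' u - F' c)) (at u within ball c d)"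
      by (rule has_derivative_at_withinI, fold has_field_derivative_def)
        (rule DERIV_diff[OF F DERIV_cmult_Id])
  qed (use assms in \<open>auto simp: dist_real_def abs_minus_commute\<close>)
  then show ?thesis by (simp add: algebra_simps)
qed

text \<open>The defect \<open>E\<close> of the formula and the variation \<open>G\<close> are both
  additive over adjacent intervals. Hence a bound of \<open>E\<close> by \<open>\<eta> * G\<close>
  on short intervals spreads to \<open>{0..t}\<close> by bisection, and \<eta> is arbitrary.
  Pointwise differentiability of \<open>f\<close> never enters.\<close>

lemma has_L2_derivative_chain:
  fixes f g F F' :: "real \<Rightarrow> real"
  assumes fg: "has_L2_derivative f g"
    and F: "\<And>u. (F has_real_derivative F' u) (at u)" and F': "continuous_on UNIV F'"
    and t: "t \<in> {0..1}"
  shows "F (f t) = F (f 0) + (LINT s:{0..t}|unit_lebesgue. F' (f s) * g s)"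
proof -
  note g = has_L2_derivativeD[OF fg]
  have f: "continuous_on {0..1} f" by (rule has_L2_derivative_continuous[OF fg])
  define k where "k = (\<lambda>s. F' (f s) * g s)"
  have k: "integrable unit_lebesgue k"
    unfolding k_def
    by (rule integrable_mult_continuous[OF g(3)]) (rule continuous_on_compose2[OF F' f], simp)
  define E where "E a b = F (f b) - F (f a) - (LINT s:{a<..b}|unit_lebesgue. k s)" for a b
  define G where "G a b = (LINT s:{a<..b}|unit_lebesgue. \<bar>g s\<bar>)" for a b
  have Ioc: "(LINT s:{a<..c}|unit_lebesgue. h s)
      = (LINT s:{a<..b}|unit_lebesgue. h s) + (LINT s:{b<..c}|unit_lebesgue. h s)"
    if "integrable unit_lebesgue h" "a \<le> b" "b \<le> c" for h :: "real \<Rightarrow> real" and a b c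
  proof -
    have "{a<..c} = {a<..b} \<union> {b<..c}" using that by auto
    then show ?thesis
      using that by (auto intro!: set_integral_Un set_integrable_unit_lebesgue)
  qed
  have bound: "\<bar>E 0 t\<bar> \<le> \<eta> * G 0 t" if "\<eta> > 0" for \<eta>
  proof -
    have "0 \<le> t" using t by simp
    \<comment> \<open>The guard is part of \<open>P\<close> because the local case of the bisection
      also meets intervals that stick out of \<open>{0..1}\<close>.\<close>
    define P where "P a b \<longleftrightarrow> (0 \<le> a \<and> b \<le> 1 \<longrightarrow> \<bar>E a b\<bar> \<le> \<eta> * G a b)" for a b
    from \<open>0 \<le> t\<close> have "P 0 t"
    proof (induction rule: Bolzano)
      case (trans a b c)
      have "E a c = E a b + E b c" "G a c = G a b + G b c"
        unfolding E_def G_def using Ioc[OF k trans(3,4)] Ioc[of "\<lambda>s. \<bar>g s\<bar>", OF _ trans(3,4)] g(3) by auto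
      with trans show ?case by (auto simp: P_def distrib_left)
    next
      case (local x)
      with t have x: "x \<in> {0..1}" by auto
      have "isCont F' (f x)" using F' by (simp add: continuous_on_eq_continuous_at)
      with \<open>\<eta> > 0\<close> obtain d where d: "d > 0" "\<And>u. \<bar>u - f x\<bar> < d \<Longrightarrow> \<bar>F' u - F' (f x)\<bar> < \<eta> / 2"
        unfolding isCont_def LIM_def dist_real_def
        by (metis abs_zero diff_self half_gt_zero_iff)
      obtain e where e: "e > 0" "\<And>y. y \<in> {0..1} \<Longrightarrow> \<bar>y - x\<bar> < e \<Longrightarrow> \<bar>f y - f x\<bar> < d"
        using f[unfolded continuous_on_iff, rule_format, OF x \<open>d > 0\<close>] by (auto simp: dist_real_def)
      show ?case
        unfolding P_def
      proof (intro exI[of _ e] conjI allI impI e(1))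
        fix a b assume ab: "a \<le> x \<and> x \<le> b \<and> b - a < e" "0 \<le> a \<and> b \<le> 1"
        \<comment> \<open>One half of \<eta> pays for linearising \<open>F\<close> at
          \<open>f x\<close>, the other half for replacing \<open>F' (f s)\<close> by
          \<open>c\<close> under the integral.\<close>
        define c where "c = F' (f x)"
        have near: "\<bar>f s - f x\<bar> < d" if "s \<in> {a..b}" for s
          using that ab by (intro e(2)) auto
        have "\<bar>F (f b) - F (f a) - c * (f b - f a)\<bar> \<le> \<eta> / 2 * \<bar>f b - f a\<bar>"
          unfolding c_def by (rule chain_rule_local_bound[OF F d(2)]) (use near ab in auto)
        also have "\<bar>f b - f a\<bar> \<le> G a b"
          using has_L2_derivative_increment[OF fg, of a b] norm_set_integral_le[OF g(3), of "{a<..b}"] ab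
          by (simp add: G_def)
        finally have 1: "\<bar>F (f b) - F (f a) - c * (f b - f a)\<bar> \<le> \<eta> / 2 * G a b"
          using \<open>\<eta> > 0\<close> by simp
        have "c * (f b - f a) - (LINT s:{a<..b}|unit_lebesgue. k s)
            = (LINT s:{a<..b}|unit_lebesgue. c * g s - k s)"
          using has_L2_derivative_increment[OF fg, of a b] ab g(3) k
          by (subst set_integral_diff) (auto intro!: set_integrable_unit_lebesgue)
        moreover have "\<bar>(LINT s:{a<..b}|unit_lebesgue. c * g s - k s)\<bar>
            \<le> (LINT s:{a<..b}|unit_lebesgue. \<bar>c * g s - k s\<bar>)"
          using norm_set_integral_le[of "\<lambda>s. c * g s - k s" "{a<..b}"] g(3) k by auto
        moreover have "\<dots> \<le> (LINT s:{a<..b}|unit_lebesgue. \<eta> / 2 * \<bar>g s\<bar>)"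
        proof (rule set_integral_mono)
          fix s assume "s \<in> {a<..b}"
          then have "\<bar>F' (f s) - c\<bar> \<le> \<eta> / 2"
            unfolding c_def by (intro less_imp_le d(2) near) auto
          then have "\<bar>c - F' (f s)\<bar> * \<bar>g s\<bar> \<le> \<eta> / 2 * \<bar>g s\<bar>"
            by (intro mult_right_mono) (auto simp: abs_minus_commute)
          then show "\<bar>c * g s - k s\<bar> \<le> \<eta> / 2 * \<bar>g s\<bar>"
            by (simp add: k_def abs_mult[symmetric] left_diff_distrib)
        qed (use g(3) k in \<open>auto intro!: set_integrable_unit_lebesgue\<close>)
        moreover have "(LINT s:{a<..b}|unit_lebesgue. \<eta> / 2 * \<bar>g s\<bar>) = \<eta> / 2 * G a b"
          by (simp add: G_def)
        ultimately show "\<bar>E a b\<bar> \<le> \<eta> * G a b"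
          using 1 unfolding E_def by linarith
      qed
    qed
    with t show ?thesis by (simp add: P_def)
  qed
  have "E 0 t = 0"
  proof (rule ccontr)
    assume "E 0 t \<noteq> 0"
    have "G 0 t \<ge> 0" unfolding G_def set_lebesgue_integral_def
      by (intro integral_nonneg_AE) (auto simp: indicator_def)
    then have "\<bar>E 0 t\<bar> / (2 * (G 0 t + 1)) * G 0 t < \<bar>E 0 t\<bar>"
      using \<open>E 0 t \<noteq> 0\<close> by (simp add: field_simps) (smt (verit) mult_nonneg_nonneg)
    moreover have "\<bar>E 0 t\<bar> / (2 * (G 0 t + 1)) > 0"
      using \<open>E 0 t \<noteq> 0\<close> \<open>G 0 t \<ge> 0\<close> by simp
    ultimately show False using bound by fastforce
  qed
  then show ?thesis
    using set_integral_Icc_eq_Ioc[OF borel_measurable_integrable[OF k], of 0 t]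
    by (simp add: E_def k_def)
qed

lemma sgn_borel_measurable: "(sgn :: real \<Rightarrow> real) \<in> borel_measurable borel"
proof -
  have "(sgn :: real \<Rightarrow> real) = (\<lambda>x. indicat_real {0<..} x - indicat_real {..<0} x)"
    by (auto simp: fun_eq_iff indicator_def)
  then show ?thesis by simp
qed

text \<open>Apply the chain rule to \<open>sqrt (u\<^sup>2 + \<epsilon>\<^sup>2)\<close> and let \<open>\<epsilon>\<close> tend to 0; the smoothing avoids the null
  set where \<open>f\<close> vanishes but \<open>g\<close> need not.\<close>

lemma has_L2_derivative_abs:
  fixes f g :: "real \<Rightarrow> real"
  assumes fg: "has_L2_derivative f g"
  shows "has_L2_derivative (\<lambda>t. \<bar>f t\<bar>) (\<lambda>t. sgn (f t) * g t)"
  unfolding has_L2_derivative_iff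
proof (intro conjI ballI)
  note g = has_L2_derivativeD[OF fg]
  have f: "f \<in> borel_measurable unit_lebesgue"
    by (rule continuous_on_imp_measurable_unit_lebesgue[OF has_L2_derivative_continuous[OF fg]])
  show m: "(\<lambda>t. sgn (f t) * g t) \<in> borel_measurable unit_lebesgue"
    by (rule borel_measurable_times[OF measurable_compose[OF f sgn_borel_measurable] g(1)])
  show "integrable unit_lebesgue (\<lambda>t. (norm (sgn (f t) * g t))\<^sup>2)"
  proof (rule Bochner_Integration.integrable_bound[OF g(2)])
    show "AE t in unit_lebesgue. norm ((norm (sgn (f t) * g t))\<^sup>2) \<le> norm ((norm (g t))\<^sup>2)"
      by (auto simp: sgn_if)
  qed (use m in measurable)
  fix t :: real assume t: "t \<in> {0..1}"
  define e where "e n = inverse (real (Suc n))" for n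
  have e: "e n > 0" for n by (simp add: e_def)
  have e0: "e \<longlonglongrightarrow> 0"
    unfolding e_def by (rule LIMSEQ_inverse_real_of_nat)
  define F where "F n u = sqrt (u\<^sup>2 + (e n)\<^sup>2)" for n u
  define F' where "F' n u = u / sqrt (u\<^sup>2 + (e n)\<^sup>2)" for n u
  have pos: "u\<^sup>2 + (e n)\<^sup>2 > 0" for n u
    using e[of n] by (simp add: add_nonneg_pos)
  have F: "(F n has_real_derivative F' n u) (at u)" for n u
    unfolding F_def F'_def using pos[of u n]
    by (auto intro!: derivative_eq_intros simp: field_simps)
  have F': "continuous_on UNIV (F' n)" for n
    unfolding F'_def using pos[of _ n] by (auto intro!: continuous_intros simp: less_imp_neq[symmetric])
  have eq: "F n (f t) = F n (f 0) + (LINT s:{0..t}|unit_lebesgue. F' n (f s) * g s)" for n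
    by (rule has_L2_derivative_chain[OF fg F F' t])
  have lim: "(\<lambda>n. F n u) \<longlonglongrightarrow> \<bar>u\<bar>" for u
  proof -
    have "(\<lambda>n. F n u) \<longlonglongrightarrow> sqrt (u\<^sup>2 + 0\<^sup>2)"
      unfolding F_def by (intro tendsto_intros e0)
    then show ?thesis by simp
  qed
  have lim': "(\<lambda>n. F' n u) \<longlonglongrightarrow> sgn u" for u
  proof (cases "u = 0")
    case False
    have "(\<lambda>n. u / F n u) \<longlonglongrightarrow> u / \<bar>u\<bar>"
      by (intro tendsto_intros lim) (use False in auto)
    moreover have "u / \<bar>u\<bar> = sgn u" by (simp add: sgn_if False)
    ultimately show ?thesis by (simp add: F_def F'_def)
  qed (simp add: F'_def)
  have "(\<lambda>n. LINT s:{0..t}|unit_lebesgue. F' n (f s) * g s) \<longlonglongrightarrow> (LINT s:{0..t}|unit_lebesgue. sgn (f s) * g s)"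
    unfolding set_lebesgue_integral_def
  proof (rule integral_dominated_convergence[where w = "\<lambda>s. \<bar>g s\<bar>"])
    have i: "indicat_real {0..t} \<in> borel_measurable unit_lebesgue"
      by (intro borel_measurable_indicator) (use t in \<open>auto simp: sets_unit_lebesgue_iff\<close>)
    show "(\<lambda>x. indicat_real {0..t} x *\<^sub>R (sgn (f x) * g x)) \<in> borel_measurable unit_lebesgue"
      by (intro borel_measurable_scaleR i m)
    show "(\<lambda>x. indicat_real {0..t} x *\<^sub>R (F' n (f x) * g x)) \<in> borel_measurable unit_lebesgue" for n
      by (intro borel_measurable_scaleR i borel_measurable_times g(1)
           measurable_compose[OF f borel_measurable_continuous_onI[OF F']])
    show "integrable unit_lebesgue (\<lambda>s. \<bar>g s\<bar>)" using g(3) by simp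
    show "AE x in unit_lebesgue. (\<lambda>n. indicat_real {0..t} x *\<^sub>R (F' n (f x) * g x))
        \<longlonglongrightarrow> indicat_real {0..t} x *\<^sub>R (sgn (f x) * g x)"
      by (intro AE_I2 tendsto_intros lim')
    have "\<bar>F' n u\<bar> \<le> 1" for n u
    proof -
      have "\<bar>u\<bar> \<le> sqrt (u\<^sup>2 + (e n)\<^sup>2)" by (rule real_le_rsqrt) simp
      then show ?thesis using pos[of u n] by (simp add: F'_def)
    qed
    then show "AE x in unit_lebesgue. norm (indicat_real {0..t} x *\<^sub>R (F' n (f x) * g x)) \<le> \<bar>g x\<bar>" for n
      by (auto simp: abs_mult indicator_def mult_left_le_one_le intro!: AE_I2)
  qed
  then have "(\<lambda>n. F n (f t)) \<longlonglongrightarrow> \<bar>f 0\<bar> + (LINT s:{0..t}|unit_lebesgue. sgn (f s) * g s)"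
    unfolding eq by (intro tendsto_intros lim)
  then show "\<bar>f t\<bar> = \<bar>f 0\<bar> + (LINT s:{0..t}|unit_lebesgue. sgn (f s) * g s)"
    using lim LIMSEQ_unique by blast
qed

text \<open>Ramps are the building blocks: hat functions and the straight segment between two points
  are combinations of them.\<close>

lemma has_L2_derivative_ramp:
  assumes "0 \<le> c"
  shows "has_L2_derivative (\<lambda>t. max 0 (t - c)) (indicat_real {c<..})"
  unfolding has_L2_derivative_iff
proof (intro conjI ballI)
  show m: "indicat_real {c<..} \<in> borel_measurable unit_lebesgue"
    by (rule borel_measurable_indicator_unit_lebesgue) simp
  interpret finite_measure unit_lebesgue by (rule finite_measure_unit_lebesgue)
  have "(\<lambda>t. (norm (indicat_real {c<..} t))\<^sup>2) = indicat_real {c<..}"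
    by (auto simp: indicator_def)
  then show "integrable unit_lebesgue (\<lambda>t. (norm (indicat_real {c<..} t))\<^sup>2)"
    using integrable_const_bound[OF _ m, of 1] by (simp add: indicator_def)
  fix t :: real assume t: "t \<in> {0..1}"
  have "(LINT s:{0..t}|unit_lebesgue. indicat_real {c<..} s) = (LINT s:{c<..max c t}|unit_lebesgue. 1)"
    unfolding set_lebesgue_integral_def using assms
    by (intro Bochner_Integration.integral_cong) (auto simp: indicator_def)
  also have "\<dots> = max 0 (t - c)"
  proof (cases "c \<le> t")
    case True
    then show ?thesis using set_integral_const_Ioc[of c t 1] assms t by simp
  next
    case False
    then show ?thesis by (simp add: set_lebesgue_integral_def)
  qed
  finally show "max 0 (t - c) = max 0 (0 - c) + (LINT s:{0..t}|unit_lebesgue. indicat_real {c<..} s)"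
    using assms by simp
qed

section \<open>Action and first variation\<close>

text \<open>\<open>separation\<close> enumerates \<open>q\<^sub>3 - q\<^sub>2\<close>, \<open>q\<^sub>1 - q\<^sub>2\<close> and, up to sign, \<open>q\<^sub>1 - q\<^sub>3\<close>; every index above 1 stands for the last.\<close>

definition separation :: "nat \<Rightarrow> complex \<times> complex \<Rightarrow> complex" where
  "separation k z = (if k = 0 then fst z else if k = 1 then fst z / 2 + snd z else fst z / 2 - snd z)"

definition weight :: "real \<Rightarrow> nat \<Rightarrow> real" where
  "weight m k = (if k = 0 then m\<^sup>2 else m)"

text \<open>Division by zero makes a colliding term 0 here, so this agrees with
  \<open>potential\<close> only away from collisions.\<close>

definition real_potential :: "real \<Rightarrow> complex \<times> complex \<Rightarrow> real" where
  "real_potential m z = (\<Sum>k<3. weight m k / cmod (separation k z))"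

text \<open>The polarization of twice the kinetic energy, that is, the mass inner product with
  respect to which Newton's force is the gradient of the potential.\<close>

definition kinetic_inner :: "real \<Rightarrow> complex \<times> complex \<Rightarrow> complex \<times> complex \<Rightarrow> real" where
  "kinetic_inner m u v = m / 2 * (fst u \<bullet> fst v) + 2 * m / (2 * m + 1) * (snd u \<bullet> snd v)"

lemma sum_lessThan_3: "(\<Sum>k<3. f k) = f 0 + f 1 + f (2::nat)"
  by (simp add: eval_nat_numeral)

lemma all_less_3: "(\<forall>k<3. P k) \<longleftrightarrow> P 0 \<and> P 1 \<and> P (2::nat)"
  by (auto simp: eval_nat_numeral less_Suc_eq)

lemma weight_pos: "m > 0 \<Longrightarrow> weight m k > 0"
  by (simp add: weight_def)

lemma separation_linear:
  "separation k (x + y) = separation k x + separation k y"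
  "separation k (r *\<^sub>R x) = r *\<^sub>R separation k x"
  by (auto simp: separation_def add_divide_distrib scaleR_diff_right scaleR_add_right)

lemma bounded_linear_separation: "bounded_linear (separation k)"
proof -
  have "linear (separation k)" by (rule linearI) (auto simp: separation_linear)
  then show ?thesis by (simp add: linear_conv_bounded_linear)
qed

lemma collision_free_iff: "collision_free z \<longleftrightarrow> (\<forall>k<3. separation k z \<noteq> 0)"
  by (auto simp: collision_free_def all_less_3 separation_def add.commute)

lemma potential_eq:
  "potential m z = (\<Sum>k<3. ennreal (weight m k) / ennreal (cmod (separation k z)))"
  by (simp add: sum_lessThan_3 potential_def separation_def weight_def)

lemma potential_collision_free:
  assumes "m > 0" "collision_free z"
  shows "potential m z = ennreal (real_potential m z)"
proof -
  have "ennreal (weight m k) / ennreal (cmod (separation k z)) = ennreal (weight m k / cmod (separation k z))"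
    if "k < 3" for k
    using assms that less_imp_le[OF weight_pos[OF assms(1)]] by (intro divide_ennreal) (auto simp: collision_free_iff)
  then show ?thesis
    unfolding potential_eq real_potential_def
    using less_imp_le[OF weight_pos[OF assms(1)]] by (subst sum_ennreal[symmetric]) auto
qed

lemma potential_collision:
  assumes "m > 0" "\<not> collision_free z"
  shows "potential m z = top"
proof -
  obtain k where k: "k < 3" "separation k z = 0"
    using assms(2) by (auto simp: collision_free_iff)
  have "ennreal (weight m k) / ennreal (cmod (separation k z)) = top"
    using k weight_pos[OF assms(1), of k] by simp
  moreover have "ennreal (weight m k) / ennreal (cmod (separation k z)) \<le> potential m z"
    unfolding potential_eq by (rule member_le_sum) (use k(1) in auto)
  ultimately have "top \<le> potential m z" by simp
  then show ?thesis by (simp add: top_unique)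
qed

lemma real_potential_nonneg: "m > 0 \<Longrightarrow> real_potential m z \<ge> 0"
  unfolding real_potential_def using less_imp_le[OF weight_pos]
  by (intro sum_nonneg divide_nonneg_nonneg) auto

lemma separation_borel_measurable:
  assumes "continuous_on {0..1} f"
  shows "(\<lambda>t. separation k (f t)) \<in> borel_measurable unit_lebesgue"
  by (intro continuous_on_imp_measurable_unit_lebesgue
      continuous_on_compose2[OF linear_continuous_on[OF bounded_linear_separation, of UNIV] assms]) auto

lemma potential_borel_measurable:
  assumes "continuous_on {0..1} f"
  shows "(\<lambda>t. potential m (f t)) \<in> borel_measurable unit_lebesgue"
proof -
  note [measurable] = separation_borel_measurable[OF assms]
  show ?thesis unfolding potential_eq by measurable
qed

lemma real_potential_borel_measurable:
  assumes "continuous_on {0..1} f"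
  shows "(\<lambda>t. real_potential m (f t)) \<in> borel_measurable unit_lebesgue"
proof -
  note [measurable] = separation_borel_measurable[OF assms]
  show ?thesis unfolding real_potential_def by measurable
qed

lemma kinetic_nonneg: "m > 0 \<Longrightarrow> kinetic m v \<ge> 0"
  by (simp add: kinetic_def)

lemma kinetic_add_scaleR:
  "kinetic m (u + r *\<^sub>R v) = kinetic m u + r * kinetic_inner m u v + r\<^sup>2 * kinetic m v"
proof -
  have sq: "(cmod (x + r *\<^sub>R y))\<^sup>2 = (cmod x)\<^sup>2 + 2 * r * (x \<bullet> y) + r\<^sup>2 * (cmod y)\<^sup>2" for x y
    unfolding power2_norm_eq_inner
    by (simp add: inner_add_left inner_add_right inner_commute power2_eq_square)
  show ?thesis
    unfolding kinetic_def kinetic_inner_def fst_add snd_add fst_scaleR snd_scaleR sq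
    by (simp add: algebra_simps add_divide_distrib)
qed

lemma bounded_linear_kinetic_inner: "bounded_linear (\<lambda>u. kinetic_inner m u v)"
proof -
  have "linear (\<lambda>u. kinetic_inner m u v)"
    by (rule linearI) (auto simp: kinetic_inner_def inner_add_left add_divide_distrib[symmetric] distrib_left algebra_simps)
  then show ?thesis by (simp add: linear_conv_bounded_linear)
qed

lemma kinetic_le:
  assumes "m > 0" shows "kinetic m u \<le> (m + 1) * (norm u)\<^sup>2"
proof -
  have n: "(norm u)\<^sup>2 = (cmod (fst u))\<^sup>2 + (cmod (snd u))\<^sup>2"
    by (simp add: norm_prod_def)
  have "m / 4 \<le> m + 1" "m / (2 * m + 1) \<le> m + 1" using assms by (auto simp: field_simps)
  then show ?thesis unfolding n kinetic_def distrib_left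
    by (intro add_mono mult_right_mono) auto
qed

lemma kinetic_borel_measurable:
  assumes "g \<in> borel_measurable M"
  shows "(\<lambda>t. kinetic m (g t)) \<in> borel_measurable M"
proof -
  have "continuous_on UNIV (kinetic m)" unfolding kinetic_def by (intro continuous_intros)
  from measurable_compose[OF assms borel_measurable_continuous_onI[OF this]] show ?thesis .
qed

lemma kinetic_integrable:
  assumes "m > 0" "has_L2_derivative f g"
  shows "integrable unit_lebesgue (\<lambda>t. kinetic m (g t))"
proof (rule Bochner_Integration.integrable_bound)
  note g = has_L2_derivativeD[OF assms(2)]
  show "integrable unit_lebesgue (\<lambda>t. (m + 1) * (norm (g t))\<^sup>2)" using g(2) by simp
  show "AE t in unit_lebesgue. norm (kinetic m (g t)) \<le> norm ((m + 1) * (norm (g t))\<^sup>2)"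
    using kinetic_le[OF assms(1)] kinetic_nonneg[OF assms(1)] assms(1) by simp
qed (rule kinetic_borel_measurable[OF has_L2_derivativeD(1)[OF assms(2)]])

lemma has_L2_derivative_H1: "has_L2_derivative f g \<Longrightarrow> f \<in> H1"
  by (auto simp: H1_def)

lemma H1_velocity: "f \<in> H1 \<Longrightarrow> has_L2_derivative f (velocity f)"
  using someI_ex[of "has_L2_derivative f"] by (simp add: H1_def velocity_def)

text \<open>By uniqueness of the derivative the choice hidden in \<open>velocity\<close> is
  harmless, so any derivative at hand computes the action.\<close>

lemma action_eq:
  assumes "has_L2_derivative f g"
  shows "action m f = (\<integral>\<^sup>+ t. ennreal (kinetic m (g t)) + potential m (f t) \<partial>unit_lebesgue)"
proof -
  have "AE t in unit_lebesgue. velocity f t = g t"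
    by (rule has_L2_derivative_unique[OF H1_velocity[OF has_L2_derivative_H1[OF assms]] assms])
  then show ?thesis
    unfolding action_def
    by (subst nn_integral_restrict_space[symmetric]) (auto intro!: nn_integral_cong_AE)
qed

lemma integrable_mult_square_integrable:
  fixes a b :: "real \<Rightarrow> real"
  assumes "a \<in> borel_measurable M" "b \<in> borel_measurable M"
    "integrable M (\<lambda>t. (a t)\<^sup>2)" "integrable M (\<lambda>t. (b t)\<^sup>2)"
  shows "integrable M (\<lambda>t. a t * b t)"
proof (rule Bochner_Integration.integrable_bound)
  show "integrable M (\<lambda>t. (a t)\<^sup>2 + (b t)\<^sup>2)" using assms by simp
  show "(\<lambda>t. a t * b t) \<in> borel_measurable M" using assms by simp
  have "\<bar>x * y\<bar> \<le> x\<^sup>2 + y\<^sup>2" for x y :: real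
  proof -
    have "0 \<le> (\<bar>x\<bar> - \<bar>y\<bar>)\<^sup>2" "0 \<le> \<bar>x\<bar> * \<bar>y\<bar>" by simp_all
    then show ?thesis unfolding power2_diff abs_mult power2_abs by linarith
  qed
  then show "AE t in M. norm (a t * b t) \<le> norm ((a t)\<^sup>2 + (b t)\<^sup>2)" by simp
qed

section \<open>Minimizers and the comparison inequality\<close>

definition action_minimizer :: "real \<Rightarrow> (real \<Rightarrow> complex \<times> complex) \<Rightarrow> bool" where
  "action_minimizer m Z \<longleftrightarrow> Z \<in> H1 \<and>
     (\<forall>W\<in>H1. W 0 = Z 0 \<longrightarrow> W 1 = Z 1 \<longrightarrow> action m Z \<le> action m W)"

text \<open>Finite action excludes collisions only at almost every time. That is enough to treat the
  potential along the path as an integrable real function; single collision times need a separate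
  argument.\<close>

lemma finite_actionD:
  assumes m: "m > 0" and Zg: "has_L2_derivative Z g" and fin: "action m Z \<noteq> top"
  shows "AE t in unit_lebesgue. collision_free (Z t)"
    "integrable unit_lebesgue (\<lambda>t. real_potential m (Z t))"
    "action m Z = ennreal ((LINT t|unit_lebesgue. kinetic m (g t)) + (LINT t|unit_lebesgue. real_potential m (Z t)))"
proof -
  note cont = has_L2_derivative_continuous[OF Zg]
  have K[measurable]: "(\<lambda>t. ennreal (kinetic m (g t))) \<in> borel_measurable unit_lebesgue"
    using kinetic_borel_measurable[OF has_L2_derivativeD(1)[OF Zg]] by simp
  note [measurable] = potential_borel_measurable[OF cont] real_potential_borel_measurable[OF cont]
  have split: "action m Z = (\<integral>\<^sup>+ t. ennreal (kinetic m (g t)) \<partial>unit_lebesgue) + (\<integral>\<^sup>+ t. potential m (Z t) \<partial>unit_lebesgue)"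
    unfolding action_eq[OF Zg] by (rule nn_integral_add) measurable
  with fin have P: "(\<integral>\<^sup>+ t. potential m (Z t) \<partial>unit_lebesgue) \<noteq> top" by auto
  have "AE t in unit_lebesgue. potential m (Z t) \<noteq> top"
    using nn_integral_PInf_AE[OF _ P[folded infinity_ennreal_def]] by simp
  then show cf: "AE t in unit_lebesgue. collision_free (Z t)"
    by eventually_elim (use potential_collision[OF m] in blast)
  then have eq: "(\<integral>\<^sup>+ t. potential m (Z t) \<partial>unit_lebesgue) = (\<integral>\<^sup>+ t. ennreal (real_potential m (Z t)) \<partial>unit_lebesgue)"
    by (intro nn_integral_cong_AE) (auto simp: potential_collision_free[OF m])
  show int: "integrable unit_lebesgue (\<lambda>t. real_potential m (Z t))"
    by (rule integrableI_nonneg) (use P eq real_potential_nonneg[OF m] in \<open>auto simp: less_top\<close>)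
  show "action m Z = ennreal ((LINT t|unit_lebesgue. kinetic m (g t)) + (LINT t|unit_lebesgue. real_potential m (Z t)))"
    unfolding split eq
    using kinetic_nonneg[OF m] real_potential_nonneg[OF m] kinetic_integrable[OF m Zg] int
    by (simp add: nn_integral_eq_integral ennreal_plus integral_nonneg_AE)
qed

text \<open>The kinetic energy of the varied path is an exact quadratic polynomial in
  \<open>r\<close>, whose constant term cancels against that of \<open>Z\<close>. For the potential
  only an upper bound \<open>B\<close> is asked, so one inequality serves both the exclusion of
  collisions, where \<open>B\<close> drops by a definite amount, and the equations of motion, where
  \<open>B\<close> is a second-order expansion.\<close>

lemma minimizer_variation:
  fixes \<phi> \<psi> B :: "real \<Rightarrow> real"
  assumes m: "m > 0" and min: "action_minimizer m Z" and fin: "action m Z \<noteq> top"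
    and Zg: "has_L2_derivative Z g" and \<phi>: "has_L2_derivative \<phi> \<psi>" "\<phi> 0 = 0" "\<phi> 1 = 0"
    and B: "integrable unit_lebesgue B" "AE t in unit_lebesgue. 0 \<le> B t"
    and le: "AE t in unit_lebesgue. potential m (Z t + (r * \<phi> t) *\<^sub>R v) \<le> ennreal (B t)"
  shows "(LINT t|unit_lebesgue. real_potential m (Z t)) \<le> (LINT t|unit_lebesgue. B t)
    + r * (LINT t|unit_lebesgue. \<psi> t * kinetic_inner m (g t) v)
    + r\<^sup>2 * ((LINT t|unit_lebesgue. (\<psi> t)\<^sup>2) * kinetic m v)"
proof -
  define W where "W t = Z t + (r * \<phi> t) *\<^sub>R v" for t
  define w where "w t = g t + (r * \<psi> t) *\<^sub>R v" for t
  have "bounded_linear (\<lambda>x. (r * x) *\<^sub>R v)"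
    by (rule bounded_linear_compose[OF bounded_linear_scaleR_left bounded_linear_mult_right])
  then have Ww: "has_L2_derivative W w"
    unfolding W_def w_def by (intro has_L2_derivative_add[OF Zg] has_L2_derivative_linear[OF \<phi>(1)])
  note \<psi> = has_L2_derivativeD[OF \<phi>(1)]
  have gv: "has_L2_derivative (\<lambda>t. kinetic_inner m (Z t) v) (\<lambda>t. kinetic_inner m (g t) v)"
    by (rule has_L2_derivative_linear[OF Zg bounded_linear_kinetic_inner])
  note gv = has_L2_derivativeD[OF gv]
  have X: "integrable unit_lebesgue (\<lambda>t. \<psi> t * kinetic_inner m (g t) v)"
    by (rule integrable_mult_square_integrable) (use \<psi>(1,2) gv(1,2) in simp_all)
  have Y: "integrable unit_lebesgue (\<lambda>t. (\<psi> t)\<^sup>2)" using \<psi>(2) by simp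
  have "(\<lambda>t. kinetic m (w t)) = (\<lambda>t. kinetic m (g t) + r * (\<psi> t * kinetic_inner m (g t) v)
      + r\<^sup>2 * ((\<psi> t)\<^sup>2 * kinetic m v))"
    by (simp add: w_def kinetic_add_scaleR power_mult_distrib mult.assoc)
  then have Kw: "(LINT t|unit_lebesgue. kinetic m (w t)) = (LINT t|unit_lebesgue. kinetic m (g t))
      + r * (LINT t|unit_lebesgue. \<psi> t * kinetic_inner m (g t) v)
      + r\<^sup>2 * ((LINT t|unit_lebesgue. (\<psi> t)\<^sup>2) * kinetic m v)"
    using kinetic_integrable[OF m Zg] X Y by simp
  have "action m Z \<le> action m W"
    using min has_L2_derivative_H1[OF Ww] \<phi>(2,3) unfolding action_minimizer_def W_def by auto
  also have "action m W \<le> (\<integral>\<^sup>+ t. ennreal (kinetic m (w t) + B t) \<partial>unit_lebesgue)"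
    unfolding action_eq[OF Ww]
  proof (rule nn_integral_mono_AE)
    show "AE t in unit_lebesgue. ennreal (kinetic m (w t)) + potential m (W t) \<le> ennreal (kinetic m (w t) + B t)"
      using le B(2)
    proof eventually_elim
      case (elim t)
      then show ?case using kinetic_nonneg[OF m]
        by (simp add: W_def ennreal_plus add_left_mono)
    qed
  qed
  also have "\<dots> = ennreal (LINT t|unit_lebesgue. kinetic m (w t) + B t)"
    by (rule nn_integral_eq_integral)
      (use kinetic_integrable[OF m Ww] B in
        \<open>auto intro: add_nonneg_nonneg kinetic_nonneg[OF m] elim!: eventually_mono\<close>)
  also have "(LINT t|unit_lebesgue. kinetic m (w t) + B t) = (LINT t|unit_lebesgue. kinetic m (w t)) + (LINT t|unit_lebesgue. B t)"
    using kinetic_integrable[OF m Ww] B by simp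
  finally have "(LINT t|unit_lebesgue. kinetic m (g t)) + (LINT t|unit_lebesgue. real_potential m (Z t))
    \<le> (LINT t|unit_lebesgue. kinetic m (w t)) + (LINT t|unit_lebesgue. B t)"
    unfolding finite_actionD(3)[OF m Zg fin]
    by (subst (asm) ennreal_le_iff)
      (intro add_nonneg_nonneg integral_nonneg_AE[OF B(2)] Bochner_Integration.integral_nonneg kinetic_nonneg[OF m])
  then show ?thesis unfolding Kw by simp
qed

section \<open>Absence of interior collisions\<close>

definition sign_cone :: "(complex \<times> complex) set" where
  "sign_cone = {z. Re (fst z) \<ge> 0 \<and> Im (fst z) \<ge> 0 \<and> Re (snd z) \<ge> 0 \<and> Im (snd z) \<le> 0}"

text \<open>The direction is chosen so that its separations \<open>1 + \<i>\<close>, \<open>1\<close> and \<open>\<i>\<close> have nonnegative inner product with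
  the corresponding separations of every point of the cone: moving inward lengthens all three.\<close>

definition inward :: "complex \<times> complex" where
  "inward = (Complex 1 1, Complex (1/2) (-1/2))"

text \<open>The cross term is nonnegative on the cone, and each separation of \<open>inward\<close>
  has modulus at least 1. The surplus \<open>r^2\<close> separates the bodies even if
  \<open>z\<close> is a collision.\<close>

lemma cmod_separation_inward:
  assumes "z \<in> sign_cone" "r \<ge> 0"
  shows "(cmod (separation k z))\<^sup>2 + r\<^sup>2 \<le> (cmod (separation k (z + r *\<^sub>R inward)))\<^sup>2"
proof -
  have *: "(cmod (x + r *\<^sub>R y))\<^sup>2 = (cmod x)\<^sup>2 + 2 * r * (x \<bullet> y) + r\<^sup>2 * (cmod y)\<^sup>2" for x y
    unfolding power2_norm_eq_inner
    by (simp add: inner_add_left inner_add_right inner_commute power2_eq_square)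
  have "separation k z \<bullet> separation k inward \<ge> 0" "cmod (separation k inward) \<ge> 1"
    using assms(1) by (auto simp: separation_def inward_def sign_cone_def inner_complex_def cmod_def)
  then have "2 * r * (separation k z \<bullet> separation k inward) \<ge> 0"
    "r\<^sup>2 * 1 \<le> r\<^sup>2 * (cmod (separation k inward))\<^sup>2"
    using assms(2) by (simp, intro mult_left_mono) auto
  then show ?thesis unfolding separation_linear * by simp
qed

lemma cmod_separation_inward_ge:
  assumes "z \<in> sign_cone" "r \<ge> 0"
  shows "cmod (separation k z) \<le> cmod (separation k (z + r *\<^sub>R inward))"
    "r \<le> cmod (separation k (z + r *\<^sub>R inward))"
proof -
  note * = cmod_separation_inward[OF assms, of k]
  have "(cmod (separation k z))\<^sup>2 \<le> (cmod (separation k (z + r *\<^sub>R inward)))\<^sup>2"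
    using * zero_le_power2[of r] by linarith
  then show "cmod (separation k z) \<le> cmod (separation k (z + r *\<^sub>R inward))"
    by (rule power2_le_imp_le) simp
  have "r\<^sup>2 \<le> (cmod (separation k (z + r *\<^sub>R inward)))\<^sup>2"
    using * zero_le_power2[of "cmod (separation k z)"] by linarith
  then show "r \<le> cmod (separation k (z + r *\<^sub>R inward))"
    by (rule power2_le_imp_le) simp
qed

lemma sign_cone_convex:
  assumes "a \<in> sign_cone" "b \<in> sign_cone" "0 \<le> t" "t \<le> (1::real)"
  shows "a + t *\<^sub>R (b - a) \<in> sign_cone"
proof -
  have *: "a + t *\<^sub>R (b - a) = (1 - t) *\<^sub>R a + t *\<^sub>R b"
    by (simp add: algebra_simps)
  show ?thesis unfolding * using assms
    by (auto simp: sign_cone_def mult_nonneg_nonneg mult_nonneg_nonpos intro!: add_nonneg_nonneg add_nonpos_nonpos)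
qed

text \<open>The exponent \<open>2/3\<close> is that of the parabolic collision orbit; it makes both \<open>h'\<^sup>2\<close> and \<open>1 / h\<close> integrable,
  so that a path may leave a collision with finite action.\<close>

lemma has_L2_derivative_bump:
  "has_L2_derivative (\<lambda>t. (t * (1 - t)) powr (2/3))
     (\<lambda>t. 2/3 * (t * (1 - t)) powr (-1/3) * (1 - 2 * t))"
proof -
  define h where "h t = (t * (1 - t)) powr (2/3)" for t :: real
  define h' where "h' t = 2/3 * (t * (1 - t)) powr (-1/3) * (1 - 2 * t)" for t :: real
  have "h' \<in> borel_measurable borel" unfolding h'_def by measurable
  then have m: "h' \<in> borel_measurable unit_lebesgue"
    by (intro measurable_restrict_space1) simp
  have sq: "integrable unit_lebesgue (\<lambda>t. (norm (h' t))\<^sup>2)"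
  proof (rule Bochner_Integration.integrable_bound)
    \<comment> \<open>Squaring \<open>h'\<close> doubles the exponent \<open>-1/3\<close>, and
      \<open>-2/3 = 1/3 - 1\<close>: up to a factor at most 1 this is the integrand of the Beta
      function at \<open>(1/3, 1/3)\<close>.\<close>
    show "integrable unit_lebesgue (\<lambda>t. t powr (1/3 - 1) * (1 - t) powr (1/3 - 1))"
      using integrable_Beta[of "1/3" "1/3"] by (simp add: set_integrable_unit_lebesgue_iff)
    show "(\<lambda>t. (norm (h' t))\<^sup>2) \<in> borel_measurable unit_lebesgue" using m by measurable
    show "AE t in unit_lebesgue. norm ((norm (h' t))\<^sup>2) \<le> norm (t powr (1/3 - 1) * (1 - t) powr (1/3 - 1))"
    proof (rule AE_I2)
      fix t assume "t \<in> space unit_lebesgue"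
      then have t: "0 \<le> t" "t \<le> 1" by auto
      have "((t * (1 - t)) powr (-1/3))\<^sup>2 = (t * (1 - t)) powr (-2/3)"
        by (simp add: power2_eq_square powr_add[symmetric])
      then have eq: "(h' t)\<^sup>2 = (4/9 * (1 - 2 * t)\<^sup>2) * (t powr (-2/3) * (1 - t) powr (-2/3))"
        unfolding h'_def using t by (simp add: power_mult_distrib powr_mult power_divide)
      have "\<bar>1 - 2 * t\<bar> \<le> 1" using t by auto
      then have "(1 - 2 * t)\<^sup>2 \<le> 1" by (simp add: abs_square_le_1)
      then have "4/9 * (1 - 2 * t)\<^sup>2 \<le> 1" by simp
      then have "(h' t)\<^sup>2 \<le> 1 * (t powr (-2/3) * (1 - t) powr (-2/3))"
        unfolding eq by (intro mult_right_mono) auto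
      then show "norm ((norm (h' t))\<^sup>2) \<le> norm (t powr (1/3 - 1) * (1 - t) powr (1/3 - 1))"
        by simp
    qed
  qed
  have "h t = h 0 + (LINT s:{0..t}|unit_lebesgue. h' s)" if t: "t \<in> {0..1}" for t
  proof -
    have "set_integrable lborel {0..1} h'"
      using square_integrable_unit_lebesgue[OF m sq] by (simp add: set_integrable_unit_lebesgue_iff)
    then have si: "set_integrable lborel {0..t} h'"
      by (rule set_integrable_subset) (use t in auto)
    \<comment> \<open>The derivative is unbounded at both ends of the unit interval, so the
      fundamental theorem is used in the form that asks for it only in the interior.\<close>
    have "(h' has_integral (h t - h 0)) {0..t}"
    proof (rule fundamental_theorem_of_calculus_interior)
      show "continuous_on {0..t} h"
        unfolding h_def using t by (intro continuous_on_powr' continuous_intros) auto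
      fix x assume x: "x \<in> {0<..<t}"
      then have "x * (1 - x) > 0" using t by auto
      then have "(h has_real_derivative h' x) (at x)"
        unfolding h_def h'_def
        by (auto intro!: derivative_eq_intros simp: powr_diff[symmetric] algebra_simps)
      then show "(h has_vector_derivative h' x) (at x)"
        by (simp add: has_real_derivative_iff_has_vector_derivative)
    qed (use t in auto)
    moreover have "(h' has_integral (LINT s:{0..t}|unit_lebesgue. h' s)) {0..t}"
      using set_borel_integral_eq_integral[OF si] t
      by (simp add: integral_unit_lebesgue_eq has_integral_integral)
    ultimately show ?thesis by (auto dest: has_integral_unique)
  qed
  then show ?thesis
    using m sq unfolding has_L2_derivative_iff h_def h'_def by blast
qed

lemma has_L2_derivative_hat:
  assumes "0 \<le> a" "a < t" "t < b"
  obtains \<phi> \<psi> :: "real \<Rightarrow> real" where "has_L2_derivative \<phi> \<psi>"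
    "\<And>s. s \<le> a \<Longrightarrow> \<phi> s = 0" "\<And>s. a \<le> s \<Longrightarrow> s \<le> t \<Longrightarrow> \<phi> s = (s - a) / (t - a)"
    "\<And>s. t \<le> s \<Longrightarrow> s \<le> b \<Longrightarrow> \<phi> s = (b - s) / (b - t)" "\<And>s. b \<le> s \<Longrightarrow> \<phi> s = 0"
    "\<And>s. \<psi> s = indicator {a<..t} s / (t - a) - indicator {t<..b} s / (b - t)"
proof -
  \<comment> \<open>The coefficient of each ramp is the jump of the slope at its corner
    \<open>a\<close>, \<open>t\<close> or \<open>b\<close>.\<close>
  define \<phi> where "\<phi> s = 1 / (t - a) * max 0 (s - a) + (- (1 / (t - a) + 1 / (b - t))) * max 0 (s - t)
     + 1 / (b - t) * max 0 (s - b)" for s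
  define \<psi> where "\<psi> s = 1 / (t - a) * indicat_real {a<..} s + (- (1 / (t - a) + 1 / (b - t))) * indicat_real {t<..} s
     + 1 / (b - t) * indicat_real {b<..} s" for s
  have "has_L2_derivative \<phi> \<psi>"
    unfolding \<phi>_def \<psi>_def using assms
    by (intro has_L2_derivative_add has_L2_derivative_linear[OF has_L2_derivative_ramp]
         bounded_linear_mult_right) auto
  moreover have pos: "t - a > 0" "b - t > 0" using assms by auto
  have "\<phi> s = 0" if "s \<le> a" for s using that assms by (simp add: \<phi>_def)
  moreover have "\<phi> s = (s - a) / (t - a)" if "a \<le> s" "s \<le> t" for s using that assms by (simp add: \<phi>_def)
  moreover have hat2: "\<phi> s = (b - s) / (b - t)" if "t \<le> s" "s \<le> b" for s
  proof -
    have "(s - a) / (t - a) - (s - t) / (t - a) = 1" using pos by (simp add: diff_divide_distrib[symmetric])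
    moreover have "1 - (s - t) / (b - t) = (b - s) / (b - t)" using pos by (simp add: field_simps)
    ultimately show ?thesis
      using that assms by (simp add: \<phi>_def left_diff_distrib distrib_right)
  qed
  moreover have "\<phi> s = 0" if "b \<le> s" for s
  proof -
    have "(s - a) / (t - a) - (s - t) / (t - a) = 1" using pos by (simp add: diff_divide_distrib[symmetric])
    moreover have "(s - t) / (b - t) - (s - b) / (b - t) = 1" using pos
      by (simp add: diff_divide_distrib[symmetric])
    ultimately show ?thesis
      using that assms by (simp add: \<phi>_def left_diff_distrib distrib_right)
  qed
  moreover have "\<psi> s = indicator {a<..t} s / (t - a) - indicator {t<..b} s / (b - t)" for s
    using assms by (auto simp: \<psi>_def indicator_def)
  ultimately show ?thesis using that by blast
qed

text \<open>The straight segment stays in the cone but may meet collisions. Adding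
  \<open>h t\<close> times \<open>inward\<close> keeps every separation at least \<open>h t\<close>,
  so the potential is at most the total weight divided by \<open>h t\<close>, which is
  integrable.\<close>

lemma finite_action_path:
  assumes m: "m > 0" and a: "a \<in> sign_cone" and b: "b \<in> sign_cone"
  shows "\<exists>W\<in>H1. W 0 = a \<and> W 1 = b \<and> action m W \<noteq> top"
proof -
  define h where "h t = (t * (1 - t)) powr (2/3)" for t :: real
  define B where "B t = (\<Sum>k<3. weight m k) * (t powr (1/3 - 1) * (1 - t) powr (1/3 - 1))" for t :: real
  obtain h' where h': "has_L2_derivative h h'"
    using has_L2_derivative_bump unfolding h_def by blast
  \<comment> \<open>On \<open>{0..1}\<close> the ramp at 0 is the identity; this form makes its
    derivative available.\<close>
  define W where "W t = (a + max 0 (t - 0) *\<^sub>R (b - a)) + h t *\<^sub>R inward" for t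
  define w where "w t = (0 + indicat_real {0<..} t *\<^sub>R (b - a)) + h' t *\<^sub>R inward" for t
  have const: "has_L2_derivative (\<lambda>t. a) (\<lambda>t. 0)"
    by (simp add: has_L2_derivative_iff)
  have Ww: "has_L2_derivative W w"
    unfolding W_def w_def
    by (intro has_L2_derivative_add const has_L2_derivative_linear[OF has_L2_derivative_ramp]
        has_L2_derivative_linear[OF h'] bounded_linear_scaleR_left) simp
  have W01: "W 0 = a" "W 1 = b" by (auto simp: W_def h_def)
  have B: "integrable unit_lebesgue B"
    unfolding B_def using integrable_Beta[of "1/3" "1/3"]
    by (intro integrable_mult_right) (simp add: set_integrable_unit_lebesgue_iff)
  have B0: "B t \<ge> 0" for t
    unfolding B_def using less_imp_le[OF weight_pos[OF m]] by (intro mult_nonneg_nonneg sum_nonneg) auto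
  have le: "AE t in unit_lebesgue. potential m (W t) \<le> ennreal (B t)"
    unfolding AE_unit_lebesgue using AE_lborel_singleton[of 0] AE_lborel_singleton[of 1]
  proof eventually_elim
    case (elim t)
    show ?case
    proof
      assume "t \<in> {0..1}"
      with elim have t: "0 < t" "t < 1" by auto
      then have h: "h t > 0" unfolding h_def by simp
      have sign_cone: "a + t *\<^sub>R (b - a) \<in> sign_cone" using sign_cone_convex[OF a b] t by simp
      have sep: "h t \<le> cmod (separation k (W t))" for k
        using cmod_separation_inward_ge(2)[OF sign_cone less_imp_le[OF h]] t by (simp add: W_def)
      then have cf: "collision_free (W t)"
        using h unfolding collision_free_iff by (metis norm_zero not_le)
      have "real_potential m (W t) \<le> (\<Sum>k<3. weight m k / h t)"
        unfolding real_potential_def using sep h less_imp_le[OF weight_pos[OF m]] less_le_trans[OF h sep]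
        by (intro sum_mono divide_left_mono mult_pos_pos) auto
      also have "\<dots> = (\<Sum>k<3. weight m k) * inverse (h t)"
        by (simp add: sum_distrib_right divide_inverse)
      also have "inverse (h t) = t powr (1/3 - 1) * (1 - t) powr (1/3 - 1)"
        unfolding h_def using t by (simp add: powr_minus[symmetric] powr_mult)
      finally show "potential m (W t) \<le> ennreal (B t)"
        by (simp add: potential_collision_free[OF m cf] B_def ennreal_leI)
    qed
  qed
  have "action m W \<le> (\<integral>\<^sup>+ t. ennreal (kinetic m (w t) + B t) \<partial>unit_lebesgue)"
    unfolding action_eq[OF Ww]
  proof (rule nn_integral_mono_AE)
    show "AE t in unit_lebesgue. ennreal (kinetic m (w t)) + potential m (W t) \<le> ennreal (kinetic m (w t) + B t)"
      using le by eventually_elim (use kinetic_nonneg[OF m] B0 in \<open>simp add: ennreal_plus add_left_mono\<close>)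
  qed
  also have "\<dots> = ennreal (LINT t|unit_lebesgue. kinetic m (w t) + B t)"
    by (rule nn_integral_eq_integral)
      (use kinetic_integrable[OF m Ww] B kinetic_nonneg[OF m] B0 in \<open>auto intro!: AE_I2 add_nonneg_nonneg\<close>)
  finally have "action m W \<noteq> top" by (auto simp: top_unique)
  then show ?thesis using W01 has_L2_derivative_H1[OF Ww] by blast
qed

text \<open>Rules out the degenerate situation in which all competitors have infinite action and
  minimality says nothing.\<close>

lemma minimizer_finite_action:
  assumes "m > 0" "action_minimizer m Z" "Z 0 \<in> sign_cone" "Z 1 \<in> sign_cone"
  shows "action m Z \<noteq> top"
proof -
  obtain W where "W \<in> H1" "W 0 = Z 0" "W 1 = Z 1" "action m W \<noteq> top"
    using finite_action_path[OF assms(1,3,4)] by blast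
  moreover have "action m Z \<le> action m W"
    using assms(2) \<open>W \<in> H1\<close> \<open>W 0 = Z 0\<close> \<open>W 1 = Z 1\<close> by (auto simp: action_minimizer_def)
  ultimately show ?thesis by (auto simp: top_unique)
qed

text \<open>Pushing the path inward by \<open>r \<phi>\<close> costs at most \<open>O(r)\<close> in kinetic energy. Since
  \<open>\<bar>f t\<bar>\<^sup>2 \<le> (t - t0) \<integral> \<bar>f'\<bar>\<^sup>2\<close> for the colliding separation \<open>f\<close>, with an integral over a short interval, the
  potential drops by \<open>r / (16 \<eta>)\<close> up to a constant, where \<open>\<eta>\<close> is as small as we please.\<close>

lemma minimizer_in_cone_collision_free:
  assumes m: "m > 0" and min: "action_minimizer m Z" and sign_cone: "\<And>t. t \<in> {0..1} \<Longrightarrow> Z t \<in> sign_cone"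
    and t0: "t0 \<in> {0<..<1}"
  shows "collision_free (Z t0)"
proof (rule ccontr)
  assume "\<not> collision_free (Z t0)"
  then obtain k0 where k0: "k0 < 3" "separation k0 (Z t0) = 0" by (auto simp: collision_free_iff)
  obtain g where g: "has_L2_derivative Z g" using min by (auto simp: action_minimizer_def H1_def)
  have fin: "action m Z \<noteq> top" using minimizer_finite_action[OF m min] sign_cone by simp
  note D = finite_actionD[OF m g fin]
  have pre: "0 < t0" "t0 < 1" using t0 by auto
  obtain \<phi> \<psi> :: "real \<Rightarrow> real" where \<phi>: "has_L2_derivative \<phi> \<psi>" "\<And>s. s \<le> 0 \<Longrightarrow> \<phi> s = 0"
    "\<And>s. 0 \<le> s \<Longrightarrow> s \<le> t0 \<Longrightarrow> \<phi> s = (s - 0) / (t0 - 0)"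
    "\<And>s. t0 \<le> s \<Longrightarrow> s \<le> 1 \<Longrightarrow> \<phi> s = (1 - s) / (1 - t0)" "\<And>s. 1 \<le> s \<Longrightarrow> \<phi> s = 0"
    by (rule has_L2_derivative_hat[OF order_refl pre]) (rule that)
  have \<phi>_nonneg: "\<phi> s \<ge> 0" if "s \<in> {0..1}" for s
    using \<phi>(3)[of s] \<phi>(4)[of s] that t0 by (cases "s \<le> t0") auto
  define X where "X = (LINT t|unit_lebesgue. \<psi> t * kinetic_inner m (g t) inward)"
  define Y where "Y = (LINT t|unit_lebesgue. (\<psi> t)\<^sup>2) * kinetic m inward"
  have Y: "Y \<ge> 0" unfolding Y_def by (intro mult_nonneg_nonneg kinetic_nonneg[OF m] Bochner_Integration.integral_nonneg) auto
  define \<mu> where "\<mu> = weight m k0"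
  have \<mu>: "\<mu> > 0" unfolding \<mu>_def by (rule weight_pos[OF m])
  \<comment> \<open>The gain will turn out to be \<open>r * \<mu> / (8 * \<eta>)\<close>; this value
    makes it \<open>r * (\<bar>X\<bar> + Y + 1)\<close>, more than the kinetic cost.\<close>
  define \<eta> where "\<eta> = \<mu> / (8 * (\<bar>X\<bar> + Y + 1))"
  have \<eta>: "\<eta> > 0" using \<mu> Y by (simp add: \<eta>_def)
  define f where "f t = separation k0 (Z t)" for t
  define fg where "fg t = separation k0 (g t)" for t
  have f: "has_L2_derivative f fg" unfolding f_def fg_def
    by (rule has_L2_derivative_linear[OF g bounded_linear_separation])
  define En where "En t = (LINT s:{t0<..t}|unit_lebesgue. (norm (fg s))\<^sup>2)" for t
  have En_diff: "En t = (LINT s:{0..t}|unit_lebesgue. (norm (fg s))\<^sup>2) - (LINT s:{0..t0}|unit_lebesgue. (norm (fg s))\<^sup>2)"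
    if "t \<ge> t0" for t
    using integral_unit_lebesgue_split[OF has_L2_derivativeD(2)[OF f], of 0 t0 t] t0 that by (simp add: En_def)
  \<comment> \<open>The energy on \<open>{t0<..t}\<close> tends to 0 as \<open>t\<close> decreases
    to \<open>t0\<close>. The second bound on \<delta> keeps the hat above \<open>1/2\<close> on the
    interval used.\<close>
  obtain \<delta> where \<delta>: "\<delta> > 0" "\<delta> \<le> (1 - t0) / 2" "\<And>t. t0 \<le> t \<Longrightarrow> t \<le> t0 + \<delta> \<Longrightarrow> En t \<le> \<eta>"
  proof -
    have c: "continuous_on {0..1} (\<lambda>t. LINT s:{0..t}|unit_lebesgue. (norm (fg s))\<^sup>2)"
      by (rule continuous_on_indefinite_integral[OF has_L2_derivativeD(2)[OF f]])
    have "t0 \<in> {0..1}" using t0 by auto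
    obtain d where d: "d > 0" "\<And>t. t \<in> {0..1} \<Longrightarrow> \<bar>t - t0\<bar> < d \<Longrightarrow>
       \<bar>(LINT s:{0..t}|unit_lebesgue. (norm (fg s))\<^sup>2) - (LINT s:{0..t0}|unit_lebesgue. (norm (fg s))\<^sup>2)\<bar> < \<eta>"
      using c[unfolded continuous_on_iff dist_real_def, rule_format, OF \<open>t0 \<in> {0..1}\<close> \<eta>] by blast
    show ?thesis
    proof (rule that[of "min (d/2) ((1 - t0) / 2)"])
      fix t assume t: "t0 \<le> t" "t \<le> t0 + min (d/2) ((1 - t0) / 2)"
      have "t - t0 \<le> d / 2" "t - t0 \<le> (1 - t0) / 2"
        using t(2) min.cobounded1[of "d / 2" "(1 - t0) / 2"] min.cobounded2[of "d / 2" "(1 - t0) / 2"]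
        by linarith+
      with t(1) t0 d(1) have "t \<in> {0..1}" "\<bar>t - t0\<bar> < d" by (auto simp: field_simps)
      from d(2)[OF this] show "En t \<le> \<eta>" using En_diff[OF t(1)] by simp
    next
      show "min (d/2) ((1 - t0) / 2) \<le> (1 - t0) / 2" by (rule min.cobounded2)
    qed (use d(1) t0 in auto)
  qed
  \<comment> \<open>The cap 1 gives \<open>r * Y \<le> Y\<close> at the end; the other cap gives
    \<open>\<tau> \<le> \<delta>\<close>.\<close>
  define r where "r = min 1 (4 * sqrt (\<eta> * \<delta>))"
  have r: "r > 0" "r \<le> 1" using \<eta> \<delta>(1) by (auto simp: r_def)
  have "r\<^sup>2 \<le> (4 * sqrt (\<eta> * \<delta>))\<^sup>2" using r(1) by (intro power_mono) (auto simp: r_def)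
  then have r2: "r\<^sup>2 \<le> 16 * (\<eta> * \<delta>)" using \<eta> \<delta>(1) by (simp add: power_mult_distrib)
  \<comment> \<open>Chosen so that \<open>\<tau> * \<eta> = (r / 4)^2\<close>: on \<open>S\<close>
    the colliding separation is at most \<open>r / 4\<close> before the push and at least
    \<open>r / 2\<close> after it. Its term falls by at least
    \<open>\<mu> / (r / 4) - \<mu> / (r / 2) = 2 * \<mu> / r\<close>.\<close>
  define \<tau> where "\<tau> = r\<^sup>2 / (16 * \<eta>)"
  have \<tau>: "\<tau> > 0" "\<tau> \<le> \<delta>" using r r2 \<eta> by (auto simp: \<tau>_def field_simps)
  define S where "S = {t0<..t0 + \<tau>}"
  define B where "B t = real_potential m (Z t) - 2 * \<mu> / r * indicat_real S t" for t
  have fS: "cmod (f t) \<le> r / 4" "\<phi> t \<ge> 1/2" if "t \<in> S" for t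
  proof -
    have t: "t0 \<le> t" "t \<le> t0 + \<tau>" "t \<le> t0 + \<delta>" "t \<le> 1" "0 \<le> t0" "t - t0 \<le> \<tau>"
      using that \<tau> \<delta> t0 by (auto simp: S_def field_simps)
    have "(norm (f t - f t0))\<^sup>2 \<le> (t - t0) * En t"
      unfolding En_def by (rule has_L2_derivative_hoelder[OF f]) (use t in auto)
    also have "\<dots> \<le> \<tau> * \<eta>"
      using \<delta>(3)[OF t(1,3)] t \<tau> by (intro mult_mono') (auto simp: En_def set_lebesgue_integral_def intro!: Bochner_Integration.integral_nonneg)
    also have "\<dots> = (r / 4)\<^sup>2" using \<eta> by (simp add: \<tau>_def power_divide)
    finally have "(norm (f t))\<^sup>2 \<le> (r / 4)\<^sup>2" using k0 by (simp add: f_def)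
    then show "cmod (f t) \<le> r / 4" by (rule power2_le_imp_le) (use r in simp)
    have "t - t0 \<le> (1 - t0) / 2" using t(3) \<delta>(2) by simp
    then show "\<phi> t \<ge> 1/2" unfolding \<phi>(4)[OF t(1,4)] using t0
      by (subst pos_le_divide_eq) (auto simp: field_simps)
  qed
  have key: "AE t in unit_lebesgue. potential m (Z t + (r * \<phi> t) *\<^sub>R inward) = ennreal (real_potential m (Z t + (r * \<phi> t) *\<^sub>R inward))
     \<and> real_potential m (Z t + (r * \<phi> t) *\<^sub>R inward) \<le> B t"
    using D(1) AE_space
  proof eventually_elim
    case (elim t)
    then have t: "t \<in> {0..1}" by simp
    define W where "W = Z t + (r * \<phi> t) *\<^sub>R inward"
    have rp: "r * \<phi> t \<ge> 0" using \<phi>_nonneg[OF t] r by simp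
    note ge = cmod_separation_inward_ge[OF sign_cone[OF t] rp, folded W_def]
    have pos: "cmod (separation k (Z t)) > 0" if "k < 3" for k
      using elim that by (auto simp: collision_free_iff)
    then have posW: "cmod (separation k W) > 0" if "k < 3" for k
      using pos[OF that] ge(1)[of k] by linarith
    then have cfW: "collision_free W" by (auto simp: collision_free_iff)
    have summand_le: "weight m k / cmod (separation k W) \<le> weight m k / cmod (separation k (Z t))" if "k < 3" for k
      using ge(1) pos[OF that] posW[OF that] less_imp_le[OF weight_pos[OF m]] by (intro divide_left_mono) auto
    have "real_potential m W \<le> B t"
    proof (cases "t \<in> S")
      case False
      then show ?thesis unfolding B_def real_potential_def using summand_le by (auto intro!: sum_mono)
    next
      case True
      define G where "G = 2 * \<mu> / r"
      have G: "\<mu> / (r / 2) = G" "\<mu> / (r / 4) = G + G"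
        by (simp_all add: G_def add_divide_distrib[symmetric])
      have "r / 2 \<le> r * \<phi> t" using fS(2)[OF True] r by simp
      also have "\<dots> \<le> cmod (separation k0 W)" by (rule ge(2))
      finally have "\<mu> / cmod (separation k0 W) \<le> \<mu> / (r / 2)"
        using \<mu> r posW[OF k0(1)] by (intro divide_left_mono mult_pos_pos) auto
      moreover have "\<mu> / (r / 4) \<le> \<mu> / cmod (separation k0 (Z t))"
        using fS(1)[OF True] pos[OF k0(1)] \<mu> r by (intro divide_left_mono mult_pos_pos) (auto simp: f_def)
      ultimately have gain: "weight m k0 / cmod (separation k0 W) \<le> weight m k0 / cmod (separation k0 (Z t)) - 2 * \<mu> / r"
        unfolding \<mu>_def[symmetric] G_def[symmetric] G by linarith
      \<comment> \<open>Only the colliding term supplies the gain; the other two merely do not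
        increase.\<close>
      have "real_potential m W = weight m k0 / cmod (separation k0 W) + (\<Sum>k\<in>{..<3}-{k0}. weight m k / cmod (separation k W))"
        unfolding real_potential_def by (rule sum.remove) (use k0 in auto)
      also have "\<dots> \<le> (weight m k0 / cmod (separation k0 (Z t)) - 2 * \<mu> / r) + (\<Sum>k\<in>{..<3}-{k0}. weight m k / cmod (separation k (Z t)))"
        by (intro add_mono gain sum_mono summand_le) auto
      also have "\<dots> = B t"
        unfolding B_def real_potential_def using True k0 by (subst (2) sum.remove[of _ k0]) auto
      finally show ?thesis .
    qed
    then show ?case using potential_collision_free[OF m cfW] by (simp add: W_def)
  qed
  have S: "S \<in> sets unit_lebesgue" "S \<subseteq> {0..1}"
    using t0 \<tau>(2) \<delta>(2) by (auto simp: S_def sets_unit_lebesgue_iff field_simps)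
  interpret finite_measure unit_lebesgue by (rule finite_measure_unit_lebesgue)
  have iS: "integrable unit_lebesgue (indicat_real S)"
    using S by (intro integrable_real_indicator) (auto simp: less_top[symmetric])
  have intS: "(LINT t|unit_lebesgue. indicat_real S t) = \<tau>"
    using set_integral_const_Ioc[of t0 "t0 + \<tau>" 1] t0 \<tau> \<delta>(2)
    by (simp add: set_lebesgue_integral_def S_def field_simps)
  have B: "integrable unit_lebesgue B" unfolding B_def using D(2) iS by simp
  have "(LINT t|unit_lebesgue. real_potential m (Z t)) \<le> (LINT t|unit_lebesgue. B t) + r * X + r\<^sup>2 * Y"
    unfolding X_def Y_def
  proof (rule minimizer_variation[OF m min fin g \<phi>(1)])
    show "AE t in unit_lebesgue. 0 \<le> B t"
      using key by eventually_elim (use real_potential_nonneg[OF m] order_trans in blast)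
    show "AE t in unit_lebesgue. potential m (Z t + (r * \<phi> t) *\<^sub>R inward) \<le> ennreal (B t)"
      using key by eventually_elim (auto intro: ennreal_leI)
  qed (use B \<phi>(2)[of 0] \<phi>(5)[of 1] in auto)
  also have "(LINT t|unit_lebesgue. B t) = (LINT t|unit_lebesgue. real_potential m (Z t)) - 2 * \<mu> / r * \<tau>"
    unfolding B_def using D(2) iS intS by simp
  finally have "2 * \<mu> / r * \<tau> \<le> r * X + r\<^sup>2 * Y" by simp
  also have "2 * \<mu> / r * \<tau> = r * (\<bar>X\<bar> + Y + 1)"
  proof -
    have "2 * \<mu> / r * \<tau> = r * (\<mu> / (8 * \<eta>))" using r(1) \<eta> by (simp add: \<tau>_def power2_eq_square)
    also have "\<mu> / (8 * \<eta>) = \<bar>X\<bar> + Y + 1" using \<mu> Y by (simp add: \<eta>_def)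
    finally show ?thesis .
  qed
  finally have "r * (\<bar>X\<bar> + Y + 1) \<le> r * (X + r * Y)" by (simp add: algebra_simps power2_eq_square)
  then have "\<bar>X\<bar> + Y + 1 \<le> X + r * Y" using r(1) by simp
  moreover have "r * Y \<le> Y" using r Y by (simp add: mult_left_le_one_le)
  ultimately show False by linarith
qed

section \<open>Regularity of minimizers\<close>

text \<open>Taylor expansion of the Newtonian kernel with explicit remainder. An upper bound
  suffices, since minimality is only compared with upper bounds for competitors, and
  \<open>w\<close> may be reversed.\<close>

lemma inverse_norm_add_le:
  fixes x w :: complex
  assumes "x \<noteq> 0" "cmod w \<le> cmod x / 2"
  shows "1 / cmod (x + w) \<le> 1 / cmod x - (x \<bullet> w) / cmod x ^ 3 + 2 * (cmod w)\<^sup>2 / cmod x ^ 3"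
proof -
  define p q where "p = cmod x" and "q = cmod (x + w)"
  have p: "p > 0" using assms by (simp add: p_def)
  have "p - q \<le> cmod w" "q - p \<le> cmod w"
    using norm_triangle_ineq4[of "x + w" w] norm_triangle_ineq[of x w] by (auto simp: p_def q_def)
  then have q: "q \<ge> p / 2" "\<bar>p - q\<bar> \<le> cmod w" using assms(2) by (auto simp: p_def)
  have q0: "q > 0" using q(1) p by simp
  have qq: "q\<^sup>2 - p\<^sup>2 = 2 * (x \<bullet> w) + (cmod w)\<^sup>2"
    by (simp add: p_def q_def power2_norm_eq_inner inner_add_left inner_add_right inner_commute)
  have sq: "(p - q)\<^sup>2 \<le> (cmod w)\<^sup>2" using power_mono[OF q(2), of 2] by simp
  \<comment> \<open>An exact identity. As \<open>q \<ge> p / 2\<close>, the factor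
    \<open>(2 * p + q) / q\<close> is at most 5; with the \<open>(cmod w)^2\<close> contained in
    \<open>q^2 - p^2\<close> this leaves \<open>(5 - 1) / 2 = 2\<close> as the constant of the
    remainder.\<close>
  have "1 / q = 1 / p - (q\<^sup>2 - p\<^sup>2) / (2 * p ^ 3) + (p - q)\<^sup>2 * ((2 * p + q) / q) / (2 * p ^ 3)"
    using p q0 by (simp add: divide_simps) (simp add: power2_eq_square power3_eq_cube algebra_simps)
  also have "(p - q)\<^sup>2 * ((2 * p + q) / q) \<le> (cmod w)\<^sup>2 * 5"
    using sq q(1) q0 p by (intro mult_mono) (auto simp: divide_simps)
  finally have "1 / q \<le> 1 / p - (2 * (x \<bullet> w) + (cmod w)\<^sup>2) / (2 * p ^ 3) + (cmod w)\<^sup>2 * 5 / (2 * p ^ 3)"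
    using p by (simp add: qq divide_right_mono)
  also have "\<dots> = 1 / p - (x \<bullet> w) / p ^ 3 + 2 * (cmod w)\<^sup>2 / p ^ 3"
    using p by (simp add: field_simps)
  finally show ?thesis by (simp add: p_def q_def)
qed

text \<open>The right side is the derivative of the potential in direction \<open>v\<close>:
  Newton's force is its gradient for the mass inner product.\<close>

lemma kinetic_inner_newton_force:
  assumes "m > 0"
  shows "kinetic_inner m (newton_force m z) v =
    - (\<Sum>k<3. weight m k * (separation k z \<bullet> separation k v) / cmod (separation k z) ^ 3)"
proof -
  define a b c where "a = separation 2 z" and "b = separation 1 z" and "c = separation 0 z"
  define \<alpha> \<beta> \<gamma> where "\<alpha> = inverse (cmod a ^ 3)" and "\<beta> = inverse (cmod b ^ 3)" and "\<gamma> = inverse (cmod c ^ 3)"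
  have n: "snd z - c / 2 = - a" "snd z + c / 2 = b" "fst z = c"
    by (auto simp: a_def b_def c_def separation_def)
  have F: "newton_force m z = (- (\<alpha> *\<^sub>R a) - \<beta> *\<^sub>R b - (2 * m) *\<^sub>R (\<gamma> *\<^sub>R c),
     - (((1 + 2 * m) / 2) *\<^sub>R (- (\<alpha> *\<^sub>R a) + \<beta> *\<^sub>R b)))"
    unfolding newton_force_def Let_def n by (simp add: \<alpha>_def \<beta>_def \<gamma>_def)
  have half: "x / 2 = (1/2) *\<^sub>R x" for x :: complex by (simp add: scaleR_conv_of_real)
  have v: "separation 2 v = (1/2) *\<^sub>R fst v - snd v" "separation 1 v = (1/2) *\<^sub>R fst v + snd v" "separation 0 v = fst v"
    by (auto simp: separation_def half)
  have "2 * m / (2 * m + 1) * - ((1 + 2 * m) / 2 * y) = - (m * y)" for y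
    using assms by (simp add: field_simps)
  then have "kinetic_inner m (newton_force m z) v = m / 2 * (- \<alpha> * (a \<bullet> fst v) - \<beta> * (b \<bullet> fst v) - 2 * m * \<gamma> * (c \<bullet> fst v))
     - m * (- \<alpha> * (a \<bullet> snd v) + \<beta> * (b \<bullet> snd v))"
    unfolding kinetic_inner_def F fst_conv snd_conv
    by (simp add: inner_diff_left inner_add_left mult.assoc)
  also have "\<dots> = - (m\<^sup>2 * (c \<bullet> fst v) * \<gamma> + m * (b \<bullet> ((1/2) *\<^sub>R fst v + snd v)) * \<beta> + m * (a \<bullet> ((1/2) *\<^sub>R fst v - snd v)) * \<alpha>)"
    unfolding inner_add_right inner_diff_right inner_scaleR_right by algebra
  also have "\<dots> = - (\<Sum>k<3. weight m k * (separation k z \<bullet> separation k v) / cmod (separation k z) ^ 3)"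
    unfolding sum_lessThan_3 weight_def a_def b_def c_def \<alpha>_def \<beta>_def \<gamma>_def divide_inverse
      v[unfolded divide_inverse] by simp
  finally show ?thesis .
qed

lemma kinetic_inner_self: "kinetic_inner m u u = 2 * kinetic m u"
  by (simp add: kinetic_inner_def kinetic_def dot_square_norm)

lemma kinetic_eq_0_iff: "m > 0 \<Longrightarrow> kinetic m u = 0 \<longleftrightarrow> u = 0"
proof -
  assume m: "m > 0"
  have "kinetic m u = 0 \<longleftrightarrow> m / 4 * (cmod (fst u))\<^sup>2 = 0 \<and> m / (2 * m + 1) * (cmod (snd u))\<^sup>2 = 0"
    unfolding kinetic_def using m by (intro add_nonneg_eq_0_iff) auto
  then show ?thesis using m by (simp add: prod_eq_iff)
qed

lemma continuous_on_newton_force: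
  assumes "continuous_on S Z" "\<And>t. t \<in> S \<Longrightarrow> collision_free (Z t)"
  shows "continuous_on S (\<lambda>t. newton_force m (Z t))"
  unfolding newton_force_def Let_def
  using assms by (intro continuous_intros) (auto simp: collision_free_def)

section \<open>Weak form of the equations and regularity\<close>

text \<open>For small \<open>r\<close> of the sign opposite to \<open>A\<close> the linear term
  would outweigh the quadratic one.\<close>

lemma nonneg_perturbation_imp_zero:
  fixes A D :: real
  assumes "r0 > 0" "\<And>r. \<bar>r\<bar> \<le> r0 \<Longrightarrow> 0 \<le> r * A + r\<^sup>2 * D"
  shows "A = 0"
proof (rule ccontr)
  assume A: "A \<noteq> 0"
  define h where "h = min r0 (\<bar>A\<bar> / (2 * (\<bar>D\<bar> + 1)))"
  have h: "h > 0" "h \<le> r0" using assms(1) A by (auto simp: h_def)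
  have "h * (2 * (\<bar>D\<bar> + 1)) \<le> \<bar>A\<bar>" by (simp add: h_def min_le_iff_disj pos_le_divide_eq[symmetric])
  then have "h * \<bar>D\<bar> < \<bar>A\<bar>" using h(1) mult_nonneg_nonneg[of h "\<bar>D\<bar>"] by (simp add: algebra_simps)
  then have "h * (h * \<bar>D\<bar>) < h * \<bar>A\<bar>" using h(1) by simp
  moreover have sq: "(- sgn A * h)\<^sup>2 = h\<^sup>2" using A by (simp add: power_mult_distrib sgn_if)
  have lin: "- sgn A * h * A = - (h * \<bar>A\<bar>)" by (simp add: sgn_if)
  have "0 \<le> (- sgn A * h) * A + (- sgn A * h)\<^sup>2 * D"
    using h A by (intro assms(2)) (auto simp: sgn_if)
  then have "0 \<le> - (h * \<bar>A\<bar>) + h\<^sup>2 * D" unfolding lin sq .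
  moreover have "h\<^sup>2 * D \<le> h * (h * \<bar>D\<bar>)"
    using mult_left_mono[OF abs_ge_self[of D], of "h\<^sup>2"] by (simp add: power2_eq_square mult.assoc)
  ultimately show False by linarith
qed

text \<open>On the two sides of the peak the integrand has the primitives
  \<open>((s - a) * q s - p s) / (t - a)\<close> and \<open>((b - s) * q s + p s) / (b - t)\<close>.
  The contributions of \<open>q t\<close> cancel, so only difference quotients of the second
  antiderivative \<open>p\<close> remain.\<close>

lemma hat_integral:
  fixes p q G :: "real \<Rightarrow> real"
  assumes ab: "a < t" "t < b"
    and p: "\<And>s. s \<in> {a..b} \<Longrightarrow> (p has_vector_derivative q s) (at s within {a..b})"
    and q: "\<And>s. s \<in> {a..b} \<Longrightarrow> (q has_vector_derivative G s) (at s within {a..b})"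
    and \<phi>: "\<And>s. a \<le> s \<Longrightarrow> s \<le> t \<Longrightarrow> \<phi> s = (s - a) / (t - a)" "\<And>s. t \<le> s \<Longrightarrow> s \<le> b \<Longrightarrow> \<phi> s = (b - s) / (b - t)"
  shows "((\<lambda>s. \<phi> s * G s) has_integral ((p b - p t) / (b - t) - (p t - p a) / (t - a))) {a..b}"
proof -
  have p': "(p has_real_derivative q s) (at s within S)" and q': "(q has_real_derivative G s) (at s within S)"
    if "s \<in> S" "S \<subseteq> {a..b}" for s S
    unfolding has_real_derivative_iff_has_vector_derivative
    using has_vector_derivative_within_subset[OF p] has_vector_derivative_within_subset[OF q] that by blast+
  have 1: "((\<lambda>s. \<phi> s * G s) has_integral (((t - a) * q t - p t) / (t - a) - ((a - a) * q a - p a) / (t - a))) {a..t}"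
  proof (rule has_integral_eq[rotated], rule fundamental_theorem_of_calculus)
    show "((\<lambda>s. ((s - a) * q s - p s) / (t - a)) has_vector_derivative (s - a) / (t - a) * G s) (at s within {a..t})"
      if "s \<in> {a..t}" for s
    proof -
      have "((\<lambda>s. ((s - a) * q s - p s)) has_real_derivative (s - a) * G s) (at s within {a..t})"
        using that ab by (auto intro!: derivative_eq_intros p' q' simp: algebra_simps)
      from DERIV_cdivide[OF this, of "(t - a)"] show ?thesis
        unfolding has_real_derivative_iff_has_vector_derivative[symmetric] by simp
    qed
  qed (use ab \<phi> in auto)
  have 2: "((\<lambda>s. \<phi> s * G s) has_integral (((b - b) * q b + p b) / (b - t) - ((b - t) * q t + p t) / (b - t))) {t..b}"
  proof (rule has_integral_eq[rotated], rule fundamental_theorem_of_calculus)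
    show "((\<lambda>s. ((b - s) * q s + p s) / (b - t)) has_vector_derivative (b - s) / (b - t) * G s) (at s within {t..b})"
      if "s \<in> {t..b}" for s
    proof -
      have "((\<lambda>s. ((b - s) * q s + p s)) has_real_derivative (b - s) * G s) (at s within {t..b})"
        using that ab by (auto intro!: derivative_eq_intros p' q' simp: algebra_simps)
      from DERIV_cdivide[OF this, of "(b - t)"] show ?thesis
        unfolding has_real_derivative_iff_has_vector_derivative[symmetric] by simp
    qed
  qed (use ab \<phi> in auto)
  have "(((t - a) * q t - p t) / (t - a) - ((a - a) * q a - p a) / (t - a)) +
    (((b - b) * q b + p b) / (b - t) - ((b - t) * q t + p t) / (b - t)) = (p b - p t) / (b - t) - (p t - p a) / (t - a)"
    using ab by (simp add: diff_divide_distrib add_divide_distrib)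
  then show ?thesis
    using has_integral_combine[OF _ _ 1 2] ab by simp
qed

text \<open>The variation by a hat function with peak \<open>t\<close> and feet \<open>a\<close>, \<open>b\<close> evaluates the kinetic term in closed form,
  so no du Bois-Reymond lemma is needed: the path minus a second antiderivative of the force is affine.\<close>

lemma minimizer_weak_equation:
  assumes m: "m > 0" and min: "action_minimizer m Z" and fin: "action m Z \<noteq> top"
    and ab: "0 \<le> a" "a < t" "t < b" "b \<le> 1" and cf: "\<And>s. s \<in> {a..b} \<Longrightarrow> collision_free (Z s)"
    and p: "\<And>s. s \<in> {a..b} \<Longrightarrow> (p has_vector_derivative q s) (at s within {a..b})"
    and q: "\<And>s. s \<in> {a..b} \<Longrightarrow> (q has_vector_derivative kinetic_inner m (newton_force m (Z s)) v) (at s within {a..b})"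
    and \<zeta>: "\<zeta> = (\<lambda>s. kinetic_inner m (Z s) v)"
  shows "(\<zeta> t - \<zeta> a) / (t - a) - (\<zeta> b - \<zeta> t) / (b - t) + ((p b - p t) / (b - t) - (p t - p a) / (t - a)) = 0"
proof -
  obtain g where g: "has_L2_derivative Z g" using min by (auto simp: action_minimizer_def H1_def)
  note D = finite_actionD[OF m g fin]
  have cont: "continuous_on {0..1} Z" by (rule has_L2_derivative_continuous[OF g])
  then have contab: "continuous_on {a..b} Z" by (rule continuous_on_subset) (use ab in auto)
  obtain \<phi> \<psi> :: "real \<Rightarrow> real" where \<phi>: "has_L2_derivative \<phi> \<psi>" "\<And>s. s \<le> a \<Longrightarrow> \<phi> s = 0"
    "\<And>s. a \<le> s \<Longrightarrow> s \<le> t \<Longrightarrow> \<phi> s = (s - a) / (t - a)"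
    "\<And>s. t \<le> s \<Longrightarrow> s \<le> b \<Longrightarrow> \<phi> s = (b - s) / (b - t)" "\<And>s. b \<le> s \<Longrightarrow> \<phi> s = 0"
    "\<And>s. \<psi> s = indicator {a<..t} s / (t - a) - indicator {t<..b} s / (b - t)"
    by (rule has_L2_derivative_hat[OF ab(1-3)]) (rule that)
  have \<phi>01: "\<bar>\<phi> s\<bar> \<le> 1" for s
  proof -
    consider "s \<le> a" | "a \<le> s" "s \<le> t" | "t \<le> s" "s \<le> b" | "b \<le> s" by linarith
    then show ?thesis using ab by cases (simp_all add: \<phi>(2-5))
  qed
  define G where "G s = kinetic_inner m (newton_force m (Z s)) v" for s
  have contG: "continuous_on {a..b} G" unfolding G_def
    by (rule continuous_on_compose2[OF linear_continuous_on[OF bounded_linear_kinetic_inner, of UNIV]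
          continuous_on_newton_force[OF contab cf]]) auto
  define J where "J = (LINT s|unit_lebesgue. indicat_real {a..b} s * (\<phi> s * G s))"
  have "set_integrable lborel {a..b} (\<lambda>s. \<phi> s * G s)"
    unfolding set_integrable_def
    by (rule borel_integrable_compact)
      (use ab in \<open>auto intro!: continuous_intros contG continuous_on_subset[OF has_L2_derivative_continuous[OF \<phi>(1)]]\<close>)
  note J' = this set_borel_integral_eq_integral[OF this]
  have iJ: "integrable unit_lebesgue (\<lambda>s. indicat_real {a..b} s * (\<phi> s * G s))"
  proof -
    have "set_integrable lborel {0..1} (\<lambda>s. indicat_real {a..b} s * (\<phi> s * G s))"
      using J'(1) unfolding set_integrable_def
      by (rule Bochner_Integration.integrable_cong[THEN iffD1, rotated 2]) (use ab in \<open>auto simp: indicator_def\<close>)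
    then show ?thesis by (simp add: set_integrable_unit_lebesgue_iff)
  qed
  have "J = integral {a..b} (\<lambda>s. \<phi> s * G s)"
    using integral_unit_lebesgue_eq[of "{a..b}" "\<lambda>s. \<phi> s * G s"] ab J'(3)
    by (simp add: J_def set_lebesgue_integral_def)
  also have "\<dots> = (p b - p t) / (b - t) - (p t - p a) / (t - a)"
    by (rule integral_unique, rule hat_integral[OF ab(2,3) p q \<phi>(3,4), folded G_def])
  finally have J: "J = (p b - p t) / (b - t) - (p t - p a) / (t - a)" .
  define X where "X = (LINT s|unit_lebesgue. \<psi> s * kinetic_inner m (g s) v)"
  have \<zeta>g: "has_L2_derivative \<zeta> (\<lambda>s. kinetic_inner m (g s) v)"
    unfolding \<zeta> by (rule has_L2_derivative_linear[OF g bounded_linear_kinetic_inner])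
  note i\<zeta> = set_integrable_unit_lebesgue[OF has_L2_derivativeD(3)[OF \<zeta>g], unfolded set_integrable_def real_scaleR_def]
  \<comment> \<open>The slope of the hat is constant on either side of \<open>t\<close>, so only the
    values of \<zeta> at \<open>a\<close>, \<open>t\<close> and \<open>b\<close> survive.\<close>
  have "X = (LINT s|unit_lebesgue. (indicat_real {a<..t} s * kinetic_inner m (g s) v) / (t - a)
      - (indicat_real {t<..b} s * kinetic_inner m (g s) v) / (b - t))"
    unfolding X_def \<phi>(6) by (simp add: left_diff_distrib)
  also have "\<dots> = (LINT s:{a<..t}|unit_lebesgue. kinetic_inner m (g s) v) / (t - a)
      - (LINT s:{t<..b}|unit_lebesgue. kinetic_inner m (g s) v) / (b - t)"
    unfolding set_lebesgue_integral_def real_scaleR_def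
    by (subst Bochner_Integration.integral_diff) (auto intro!: i\<zeta>)
  also have "\<dots> = (\<zeta> t - \<zeta> a) / (t - a) - (\<zeta> b - \<zeta> t) / (b - t)"
    using has_L2_derivative_increment[OF \<zeta>g, of a t] has_L2_derivative_increment[OF \<zeta>g, of t b] ab by simp
  finally have X: "X = (\<zeta> t - \<zeta> a) / (t - a) - (\<zeta> b - \<zeta> t) / (b - t)" .
  define Y where "Y = (LINT t|unit_lebesgue. (\<psi> t)\<^sup>2) * kinetic m v"
  have "\<exists>d>0. \<forall>s\<in>{a..b}. d \<le> cmod (separation k (Z s))" if "k < 3" for k
  proof -
    have c: "continuous_on {a..b} (\<lambda>s. cmod (separation k (Z s)))"
      by (intro continuous_on_norm continuous_on_compose2[OF linear_continuous_on[OF bounded_linear_separation, of UNIV] contab]) auto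
    obtain x where "x \<in> {a..b}" "\<forall>y\<in>{a..b}. cmod (separation k (Z x)) \<le> cmod (separation k (Z y))"
      using continuous_attains_inf[OF compact_Icc _ c] ab by auto
    moreover have "cmod (separation k (Z x)) > 0"
      using cf[OF \<open>x \<in> {a..b}\<close>] that by (auto simp: collision_free_iff)
    ultimately show ?thesis by blast
  qed
  then obtain d where d: "\<And>k. k < 3 \<Longrightarrow> d k > 0" "\<And>k s. k < 3 \<Longrightarrow> s \<in> {a..b} \<Longrightarrow> d k \<le> cmod (separation k (Z s))"
    by metis
  define \<delta> where "\<delta> = Min (d ` {..<3})"
  have "\<delta> \<in> d ` {..<3}" unfolding \<delta>_def by (rule Min_in) (auto simp: lessThan_empty_iff)
  then have \<delta>: "\<delta> > 0" using d(1) by auto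
  have \<delta>_le: "\<delta> \<le> cmod (separation k (Z s))" if "k < 3" "s \<in> {a..b}" for k s
  proof -
    have "\<delta> \<le> d k" unfolding \<delta>_def using that by (intro Min_le) auto
    then show ?thesis using d(2)[OF that] by simp
  qed
  \<comment> \<open>The summand 1 keeps \<open>V\<close> positive, since it appears as a divisor in
    the range allowed for \<open>r\<close>.\<close>
  define V where "V = 1 + (\<Sum>k<3. cmod (separation k v))"
  have V: "V > 0" unfolding V_def by (intro add_pos_nonneg sum_nonneg) auto
  have V_ge: "cmod (separation k v) \<le> V" if "k < 3" for k
  proof -
    have "cmod (separation k v) \<le> (\<Sum>k<3. cmod (separation k v))"
      by (rule member_le_sum) (use that in auto)
    then show ?thesis by (simp add: V_def)
  qed
  define Cst where "Cst = (\<Sum>k<3. weight m k * (2 * V\<^sup>2 / \<delta> ^ 3))"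
  have Cst: "Cst \<ge> 0" unfolding Cst_def
    using \<delta> less_imp_le[OF weight_pos[OF m]] by (intro sum_nonneg mult_nonneg_nonneg) auto
  interpret finite_measure unit_lebesgue by (rule finite_measure_unit_lebesgue)
  have "0 \<le> r * (X + J) + r\<^sup>2 * (Cst + Y)" if r: "\<bar>r\<bar> \<le> \<delta> / (2 * V)" for r
  proof -
    define B where "B s = real_potential m (Z s) + r * (indicat_real {a..b} s * (\<phi> s * G s)) + Cst * r\<^sup>2" for s
    have key: "AE s in unit_lebesgue. potential m (Z s + (r * \<phi> s) *\<^sub>R v) = ennreal (real_potential m (Z s + (r * \<phi> s) *\<^sub>R v))
     \<and> real_potential m (Z s + (r * \<phi> s) *\<^sub>R v) \<le> B s"
      using D(1) AE_space
    proof eventually_elim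
      case (elim s)
      show ?case
      proof (cases "s \<in> {a..b}")
        case False
        then have "\<phi> s = 0" using \<phi>(2,5)[of s] by auto
        then show ?thesis using elim False Cst
          by (simp add: B_def potential_collision_free[OF m])
      next
        case True
        define W where "W = Z s + (r * \<phi> s) *\<^sub>R v"
        have small: "cmod ((r * \<phi> s) *\<^sub>R separation k v) \<le> \<bar>r\<bar> * V" if "k < 3" for k
        proof -
          have "\<bar>\<phi> s\<bar> * cmod (separation k v) \<le> 1 * V" by (intro mult_mono \<phi>01 V_ge that) auto
          then show ?thesis by (simp add: abs_mult mult.assoc mult_left_mono)
        qed
        have rV: "\<bar>r\<bar> * V \<le> \<delta> / 2" using r V by (simp add: field_simps)
        have half: "cmod ((r * \<phi> s) *\<^sub>R separation k v) \<le> cmod (separation k (Z s)) / 2" if "k < 3" for k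
          using small[OF that] rV \<delta>_le[OF that True] by linarith
        have sW: "separation k W = separation k (Z s) + (r * \<phi> s) *\<^sub>R separation k v" for k
          by (simp add: W_def separation_linear)
        have pos: "cmod (separation k (Z s)) > 0" if "k < 3" for k
          using \<delta>_le[OF that True] \<delta> by linarith
        have "separation k W \<noteq> 0" if "k < 3" for k
        proof
          assume "separation k W = 0"
          then have "separation k (Z s) = - ((r * \<phi> s) *\<^sub>R separation k v)"
            by (simp add: sW eq_neg_iff_add_eq_0)
          then have "cmod (separation k (Z s)) = cmod ((r * \<phi> s) *\<^sub>R separation k v)"
            by (metis norm_minus_cancel)
          then show False using half[OF that] pos[OF that] by linarith
        qed
        then have cfW: "collision_free W" by (auto simp: collision_free_iff)
        have summand_le: "weight m k / cmod (separation k W) \<le> weight m k / cmod (separation k (Z s))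
           - r * \<phi> s * (weight m k * (separation k (Z s) \<bullet> separation k v) / cmod (separation k (Z s)) ^ 3)
           + weight m k * (2 * V\<^sup>2 / \<delta> ^ 3) * r\<^sup>2" if k: "k < 3" for k
        proof -
          define x where "x = separation k (Z s)"
          define w where "w = (r * \<phi> s) *\<^sub>R separation k v"
          have x: "x \<noteq> 0" "cmod w \<le> cmod x / 2" "\<delta> \<le> cmod x"
            using pos[OF k] half[OF k] \<delta>_le[OF k True] by (auto simp: x_def w_def)
          have "cmod w \<le> \<bar>r\<bar> * V" using small[OF k] by (simp only: w_def)
          then have "2 * (cmod w)\<^sup>2 / cmod x ^ 3 \<le> 2 * (\<bar>r\<bar> * V)\<^sup>2 / \<delta> ^ 3"
            using \<delta> x by (intro frac_le mult_left_mono power_mono) auto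
          then have "1 / cmod (x + w) \<le> 1 / cmod x - (x \<bullet> w) / cmod x ^ 3 + 2 * (\<bar>r\<bar> * V)\<^sup>2 / \<delta> ^ 3"
            using inverse_norm_add_le[OF x(1,2)] by linarith
          then have "weight m k * (1 / cmod (x + w)) \<le> weight m k * (1 / cmod x - (x \<bullet> w) / cmod x ^ 3 + 2 * (\<bar>r\<bar> * V)\<^sup>2 / \<delta> ^ 3)"
            using weight_pos[OF m, of k] by (intro mult_left_mono) auto
          also have "\<dots> = weight m k / cmod x - r * \<phi> s * (weight m k * (x \<bullet> separation k v) / cmod x ^ 3)
            + weight m k * (2 * V\<^sup>2 / \<delta> ^ 3) * r\<^sup>2"
            by (simp add: w_def algebra_simps power_mult_distrib)
          finally show ?thesis unfolding sW x_def w_def by simp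
        qed
        have "real_potential m W \<le> (\<Sum>k<3. weight m k / cmod (separation k (Z s))
           - r * \<phi> s * (weight m k * (separation k (Z s) \<bullet> separation k v) / cmod (separation k (Z s)) ^ 3)
           + weight m k * (2 * V\<^sup>2 / \<delta> ^ 3) * r\<^sup>2)"
          unfolding real_potential_def by (intro sum_mono summand_le) auto
        also have "\<dots> = B s"
          unfolding sum.distrib sum_subtractf B_def G_def kinetic_inner_newton_force[OF m] real_potential_def Cst_def
            sum_distrib_left[symmetric] sum_distrib_right[symmetric]
          using True by (simp add: mult.assoc)
        finally show ?thesis using potential_collision_free[OF m cfW] by (simp add: W_def)
      qed
    qed
    have B: "integrable unit_lebesgue B" unfolding B_def using D(2) iJ by simp
    have "(LINT t|unit_lebesgue. real_potential m (Z t)) \<le> (LINT t|unit_lebesgue. B t) + r * X + r\<^sup>2 * Y"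
      unfolding X_def Y_def
    proof (rule minimizer_variation[OF m min fin g \<phi>(1)])
      show "AE t in unit_lebesgue. 0 \<le> B t"
        using key by eventually_elim (use real_potential_nonneg[OF m] order_trans in blast)
      show "AE t in unit_lebesgue. potential m (Z t + (r * \<phi> t) *\<^sub>R v) \<le> ennreal (B t)"
        using key by eventually_elim (auto intro: ennreal_leI)
    qed (use B \<phi>(2)[of 0] \<phi>(5)[of 1] ab in auto)
    also have "(LINT t|unit_lebesgue. B t) = (LINT t|unit_lebesgue. real_potential m (Z t)) + r * J + Cst * r\<^sup>2"
      unfolding B_def J_def using D(2) iJ by simp
    finally show ?thesis by (simp add: algebra_simps)
  qed
  then have "X + J = 0"
    using \<delta> V by (intro nonneg_perturbation_imp_zero[of "\<delta> / (2 * V)"]) auto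
  then show ?thesis unfolding X J .
qed

text \<open>\<open>P\<close> is a second antiderivative of the continuous force along
  \<open>Z\<close>. The weak equation says that \<open>E = Z - P\<close> has the same mean slope on
  both sides of every interior \<open>t\<close>, hence is affine, and \<open>Z\<close> inherits the
  regularity of \<open>P\<close>.\<close>

lemma minimizer_newton_solution:
  assumes m: "m > 0" and min: "action_minimizer m Z" and fin: "action m Z \<noteq> top"
    and ab: "0 \<le> a" "a < b" "b \<le> 1" and cf: "\<And>s. s \<in> {a..b} \<Longrightarrow> collision_free (Z s)"
  shows "newton_solution m Z {a..b}"
proof -
  obtain g where g: "has_L2_derivative Z g" using min by (auto simp: action_minimizer_def H1_def)
  have contab: "continuous_on {a..b} Z"
    by (rule continuous_on_subset[OF has_L2_derivative_continuous[OF g]]) (use ab in auto)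
  define F where "F s = newton_force m (Z s)" for s
  have contF: "continuous_on {a..b} F" unfolding F_def by (rule continuous_on_newton_force[OF contab cf])
  define Q where "Q s = integral {a..s} F" for s
  define P where "P s = integral {a..s} Q" for s
  have Q: "(Q has_vector_derivative F s) (at s within {a..b})" if "s \<in> {a..b}" for s
    unfolding Q_def using integral_has_vector_derivative[OF contF that] .
  have contQ: "continuous_on {a..b} Q"
    unfolding continuous_on_eq_continuous_within using has_vector_derivative_continuous[OF Q] by blast
  have P: "(P has_vector_derivative Q s) (at s within {a..b})" if "s \<in> {a..b}" for s
    unfolding P_def using integral_has_vector_derivative[OF contQ that] .
  define E where "E s = Z s - P s" for s
  define e where "e = (1 / (b - a)) *\<^sub>R (E b - E a)"
  have affine: "E t = E a + (t - a) *\<^sub>R e" if t: "a < t" "t < b" for t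
  proof -
    define u where "u = (1 / (t - a)) *\<^sub>R (E t - E a) - (1 / (b - t)) *\<^sub>R (E b - E t)"
    have "kinetic_inner m u v = 0" for v
    proof -
      note bl = bounded_linear_kinetic_inner[of m v]
      interpret bounded_linear "\<lambda>u. kinetic_inner m u v" by (rule bl)
      have "(\<lambda>s. kinetic_inner m (Z s) v) = (\<lambda>s. kinetic_inner m (Z s) v)" ..
      from minimizer_weak_equation[OF m min fin ab(1) t ab(3) cf
          bounded_linear.has_vector_derivative[OF bl P] bounded_linear.has_vector_derivative[OF bl Q, unfolded F_def] this]
      show ?thesis
        unfolding u_def E_def by (simp add: diff scaleR diff_divide_distrib)
    qed
    \<comment> \<open>Testing with \<open>v = u\<close> uses that the mass inner product is positive
      definite.\<close>
    from this[of u] have "u = 0"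
      using kinetic_eq_0_iff[OF m, of u] by (simp add: kinetic_inner_self)
    then have "(1 / (t - a)) *\<^sub>R (E t - E a) = (1 / (b - t)) *\<^sub>R (E b - E t)" by (simp add: u_def)
    then have "((t - a) * (b - t)) *\<^sub>R ((1 / (t - a)) *\<^sub>R (E t - E a)) = ((t - a) * (b - t)) *\<^sub>R ((1 / (b - t)) *\<^sub>R (E b - E t))"
      by (rule arg_cong)
    then have "(b - t) *\<^sub>R (E t - E a) = (t - a) *\<^sub>R (E b - E t)" using t by simp
    then have "(b - a) *\<^sub>R (E t - E a) = (t - a) *\<^sub>R (E b - E a)"
      by (simp add: algebra_simps)
    then have "(1 / (b - a)) *\<^sub>R ((b - a) *\<^sub>R (E t - E a)) = (1 / (b - a)) *\<^sub>R ((t - a) *\<^sub>R (E b - E a))" by simp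
    then have "E t - E a = (t - a) *\<^sub>R e" using ab by (simp add: e_def)
    then show ?thesis by (simp add: diff_eq_eq add.commute)
  qed
  have "E b = E a + (b - a) *\<^sub>R e" using ab by (simp add: e_def)
  then have E: "Z t = P t + (E a + (t - a) *\<^sub>R e)" if "t \<in> {a..b}" for t
    using affine[of t] that by (cases "t = a \<or> t = b") (auto simp: E_def algebra_simps)
  have "(Z has_vector_derivative Q t + e) (at t within {a..b})" if "t \<in> {a..b}" for t
  proof (rule has_vector_derivative_transform[OF that E])
    show "((\<lambda>t. P t + (E a + (t - a) *\<^sub>R e)) has_vector_derivative Q t + e) (at t within {a..b})"
    proof (rule has_vector_derivative_add[OF P[OF that]])
      show "((\<lambda>t. E a + (t - a) *\<^sub>R e) has_vector_derivative e) (at t within {a..b})"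
        by (auto intro!: derivative_eq_intros)
    qed
  qed
  moreover have "((\<lambda>t. Q t + e) has_vector_derivative newton_force m (Z t)) (at t within {a..b})" if "t \<in> {a..b}" for t
  proof -
    have "((\<lambda>t. Q t + e) has_vector_derivative F t + 0) (at t within {a..b})"
      by (rule has_vector_derivative_add[OF Q[OF that] has_vector_derivative_const])
    then show ?thesis unfolding F_def add_0_right .
  qed
  ultimately have "\<forall>t\<in>{a..b}. (Z has_vector_derivative Q t + e) (at t within {a..b}) \<and>
      ((\<lambda>t. Q t + e) has_vector_derivative newton_force m (Z t)) (at t within {a..b})"
    by blast
  then show ?thesis
    unfolding newton_solution_def using cf by (intro conjI exI[of _ "\<lambda>t. Q t + e"]) auto
qed

section \<open>The equations of motion inside the cone\<close>

text \<open>\<open>E t * exp (- C * t)\<close> is nonincreasing and \<open>E t * exp (C * t)\<close>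
  nondecreasing, so a zero of the nonnegative \<open>E\<close> spreads forwards by the first and
  backwards by the second.\<close>

lemma gronwall_zero:
  fixes E E' :: "real \<Rightarrow> real"
  assumes E: "\<And>t. t \<in> {l..u} \<Longrightarrow> (E has_real_derivative E' t) (at t)"
    and bound: "\<And>t. t \<in> {l..u} \<Longrightarrow> \<bar>E' t\<bar> \<le> C * E t" "\<And>t. t \<in> {l..u} \<Longrightarrow> 0 \<le> E t"
    and t: "t0 \<in> {l..u}" "t1 \<in> {l..u}" "E t0 = 0"
  shows "E t1 = 0"
proof (cases "t0 \<le> t1")
  case True
  have "E t1 * exp (- C * t1) \<le> E t0 * exp (- C * t0)"
  proof (rule DERIV_nonpos_imp_nonincreasing[OF True])
    fix x assume "t0 \<le> x" "x \<le> t1"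
    then have x: "x \<in> {l..u}" using t by auto
    have "((\<lambda>t. E t * exp (- C * t)) has_real_derivative (E' x - C * E x) * exp (- C * x)) (at x)"
      by (auto intro!: derivative_eq_intros E[OF x] simp: algebra_simps)
    moreover have "(E' x - C * E x) * exp (- C * x) \<le> 0"
      using bound(1)[OF x] by (intro mult_nonpos_nonneg) auto
    ultimately show "\<exists>y. ((\<lambda>t. E t * exp (- C * t)) has_real_derivative y) (at x) \<and> y \<le> 0" by blast
  qed
  then have "E t1 * exp (- C * t1) \<le> 0" using t by simp
  then have "E t1 \<le> 0" by (simp add: mult_le_0_iff)
  then show ?thesis using bound(2)[OF t(2)] by simp
next
  case False
  then have le: "t1 \<le> t0" by simp
  have "E t1 * exp (C * t1) \<le> E t0 * exp (C * t0)"
  proof (rule DERIV_nonneg_imp_nondecreasing[OF le])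
    fix x assume "t1 \<le> x" "x \<le> t0"
    then have x: "x \<in> {l..u}" using t by auto
    have "((\<lambda>t. E t * exp (C * t)) has_real_derivative (E' x + C * E x) * exp (C * x)) (at x)"
      by (auto intro!: derivative_eq_intros E[OF x] simp: algebra_simps)
    moreover have "0 \<le> (E' x + C * E x) * exp (C * x)"
      using bound(1)[OF x] by (intro mult_nonneg_nonneg) auto
    ultimately show "\<exists>y. ((\<lambda>t. E t * exp (C * t)) has_real_derivative y) (at x) \<and> 0 \<le> y" by blast
  qed
  then have "E t1 * exp (C * t1) \<le> 0" using t by simp
  then have "E t1 \<le> 0" by (simp add: mult_le_0_iff)
  then show ?thesis using bound(2)[OF t(2)] by simp
qed

text \<open>Uniqueness for zero data, by Gronwall applied to \<open>p^2 + p'^2 + q^2 + q'^2\<close>.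
  The coefficients may be unbounded near 0 and 1, so they are bounded only on the compact interval
  between \<open>t0\<close> and \<open>t1\<close>.\<close>

lemma linear_second_order_zero:
  fixes p q p' q' k11 k12 k21 k22 :: "real \<Rightarrow> real"
  assumes p: "\<And>t. t \<in> {0<..<1} \<Longrightarrow> (p has_real_derivative p' t) (at t)"
      "\<And>t. t \<in> {0<..<1} \<Longrightarrow> (p' has_real_derivative k11 t * p t + k12 t * q t) (at t)"
    and q: "\<And>t. t \<in> {0<..<1} \<Longrightarrow> (q has_real_derivative q' t) (at t)"
      "\<And>t. t \<in> {0<..<1} \<Longrightarrow> (q' has_real_derivative k21 t * p t + k22 t * q t) (at t)"
    and k: "continuous_on {0<..<1} k11" "continuous_on {0<..<1} k12"
      "continuous_on {0<..<1} k21" "continuous_on {0<..<1} k22"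
    and t0: "t0 \<in> {0<..<1}" "p t0 = 0" "p' t0 = 0" "q t0 = 0" "q' t0 = 0"
    and t1: "t1 \<in> {0<..<1}"
  shows "p t1 = 0"
proof -
  define l u where "l = min t0 t1" and "u = max t0 t1"
  have lu: "{l..u} \<subseteq> {0<..<1}" "t0 \<in> {l..u}" "t1 \<in> {l..u}"
    using t0 t1 by (auto simp: l_def u_def)
  have "\<exists>K. \<forall>t\<in>{l..u}. \<bar>f t\<bar> \<le> K" if "continuous_on {0<..<1} f" for f :: "real \<Rightarrow> real"
    using compact_imp_bounded[OF compact_continuous_image[OF continuous_on_subset[OF that lu(1)] compact_Icc]]
    unfolding bounded_iff real_norm_def by (metis imageI)
  from this[OF k(1)] this[OF k(2)] this[OF k(3)] this[OF k(4)]
  obtain K1 K2 K3 K4 where K: "\<forall>t\<in>{l..u}. \<bar>k11 t\<bar> \<le> K1" "\<forall>t\<in>{l..u}. \<bar>k12 t\<bar> \<le> K2"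
    "\<forall>t\<in>{l..u}. \<bar>k21 t\<bar> \<le> K3" "\<forall>t\<in>{l..u}. \<bar>k22 t\<bar> \<le> K4" by metis
  define E where "E t = (p t)\<^sup>2 + (p' t)\<^sup>2 + (q t)\<^sup>2 + (q' t)\<^sup>2" for t
  define E' where "E' t = 2 * p t * p' t + 2 * p' t * (k11 t * p t + k12 t * q t)
      + 2 * q t * q' t + 2 * q' t * (k21 t * p t + k22 t * q t)" for t
  have prod: "\<bar>2 * x * y\<bar> \<le> E t" if "x\<^sup>2 + y\<^sup>2 \<le> E t" for x y t
  proof -
    have "0 \<le> (x + y)\<^sup>2" "0 \<le> (x - y)\<^sup>2" by simp_all
    then show ?thesis using that by (simp add: power2_eq_square algebra_simps abs_le_iff)
  qed
  have kprod: "\<bar>c * (2 * x * y)\<bar> \<le> K * E t" if "x\<^sup>2 + y\<^sup>2 \<le> E t" "\<bar>c\<bar> \<le> K" for x y t c K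
    unfolding abs_mult[of c] by (intro mult_mono prod that) (use that in auto)
  have "E t1 = 0"
  proof (rule gronwall_zero[where E = E and E' = E' and C = "2 + K1 + K2 + K3 + K4"])
    fix t assume t: "t \<in> {l..u}"
    then have t': "t \<in> {0<..<1}" using lu(1) by blast
    show "(E has_real_derivative E' t) (at t)"
      unfolding E_def E'_def
      by (auto intro!: derivative_eq_intros p[OF t'] q[OF t'] simp: algebra_simps)
    show "0 \<le> E t" unfolding E_def by simp
    have "E' t = 2 * p t * p' t + k11 t * (2 * p t * p' t) + k12 t * (2 * q t * p' t)
        + 2 * q t * q' t + k21 t * (2 * p t * q' t) + k22 t * (2 * q t * q' t)"
      by (simp add: E'_def algebra_simps)
    moreover have "\<bar>2 * p t * p' t\<bar> \<le> E t" "\<bar>2 * q t * q' t\<bar> \<le> E t"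
      by (rule prod, simp add: E_def)+
    moreover have "\<bar>k11 t * (2 * p t * p' t)\<bar> \<le> K1 * E t" "\<bar>k12 t * (2 * q t * p' t)\<bar> \<le> K2 * E t"
       "\<bar>k21 t * (2 * p t * q' t)\<bar> \<le> K3 * E t" "\<bar>k22 t * (2 * q t * q' t)\<bar> \<le> K4 * E t"
      by (rule kprod; use K t in \<open>simp add: E_def\<close>)+
    ultimately show "\<bar>E' t\<bar> \<le> (2 + K1 + K2 + K3 + K4) * E t"
      unfolding distrib_right by linarith
  qed (use lu t0 in \<open>auto simp: E_def\<close>)
  then have "(p t1)\<^sup>2 \<le> 0" unfolding E_def
    using zero_le_power2[of "p t1"] zero_le_power2[of "p' t1"] zero_le_power2[of "q t1"] zero_le_power2[of "q' t1"]
    by linarith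
  then show ?thesis by simp
qed

text \<open>A zero is an interior minimum. If the second derivative there were negative,
  \<open>f'\<close> would be negative just to the right of \<open>t0\<close> and \<open>f\<close>
  would fall below 0.\<close>

lemma nonneg_zero_imp_derivs:
  fixes f f' :: "real \<Rightarrow> real"
  assumes f: "\<And>t. t \<in> {0<..<1} \<Longrightarrow> (f has_real_derivative f' t) (at t)"
    and nonneg: "\<And>t. t \<in> {0<..<1} \<Longrightarrow> 0 \<le> f t" and t0: "t0 \<in> {0<..<1}" "f t0 = 0"
  shows "f' t0 = 0" "(f' has_real_derivative y) (at t0) \<Longrightarrow> 0 \<le> y"
proof -
  define d where "d = min t0 (1 - t0)"
  have d: "d > 0" using t0 by (auto simp: d_def)
  show f'0: "f' t0 = 0"
  proof (rule DERIV_local_min[OF f[OF t0(1)] d])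
    show "\<forall>y. \<bar>t0 - y\<bar> < d \<longrightarrow> f t0 \<le> f y"
    proof (intro allI impI)
      fix y assume "\<bar>t0 - y\<bar> < d"
      then have "y \<in> {0<..<1}" by (auto simp: d_def abs_less_iff)
      then show "f t0 \<le> f y" using nonneg t0(2) by simp
    qed
  qed
  show "0 \<le> y" if y: "(f' has_real_derivative y) (at t0)"
  proof (rule ccontr)
    assume "\<not> 0 \<le> y"
    then obtain e where e: "e > 0" "\<And>h. 0 < h \<Longrightarrow> h < e \<Longrightarrow> f' (t0 + h) < 0"
      using DERIV_neg_dec_right[OF y] f'0 by auto
    define h where "h = min e (1 - t0) / 2"
    have h: "h > 0" "h < e" "t0 + h < 1" using e t0 by (auto simp: h_def min_def field_simps)
    have "f (t0 + h) < f t0"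
    proof (rule DERIV_neg_imp_decreasing_open[where f = f and a = t0 and b = "t0 + h"])
      show "\<exists>y. (f has_real_derivative y) (at x) \<and> y < 0" if "t0 < x" "x < t0 + h" for x
        using f[of x] e(2)[of "x - t0"] that h t0 by auto
      show "continuous_on {t0..t0 + h} f"
        by (rule DERIV_continuous_on, rule has_field_derivative_at_within, rule f) (use h t0 in auto)
    qed (use h in auto)
    then show False using nonneg[of "t0 + h"] h t0 by auto
  qed
qed

text \<open>The shape of Newton's equations in the coordinates \<open>(Re Z\<^sub>1, Im Z\<^sub>1, Re Z\<^sub>2, - Im Z\<^sub>2)\<close>. With
  \<open>s = ac - bd\<close> the inner product of the two vectors, the difference of the two inverse cubes in the force is
  \<open>\<theta> s\<close> for a positive continuous \<open>\<theta>\<close>. So if two of the coordinates vanish together with their velocities,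
  they solve a linear system with continuous coefficients, whichever pair it is.\<close>

definition coupled_flow ::
  "(real \<Rightarrow> real) \<Rightarrow> (real \<Rightarrow> real) \<Rightarrow> (real \<Rightarrow> real) \<Rightarrow> (real \<Rightarrow> real) \<Rightarrow>
   (real \<Rightarrow> real) \<Rightarrow> (real \<Rightarrow> real) \<Rightarrow> (real \<Rightarrow> real) \<Rightarrow> (real \<Rightarrow> real) \<Rightarrow> bool" where
  "coupled_flow a b c d \<theta> \<kappa> \<mu> \<nu> \<longleftrightarrow>
    continuous_on {0<..<1} \<theta> \<and> continuous_on {0<..<1} \<kappa> \<and> continuous_on {0<..<1} \<mu> \<and> continuous_on {0<..<1} \<nu> \<and>
    (\<forall>t\<in>{0<..<1}. \<theta> t > 0 \<and> \<kappa> t > 0 \<and> a t \<ge> 0 \<and> b t \<ge> 0 \<and> c t \<ge> 0 \<and> d t \<ge> 0) \<and>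
    (\<exists>a' b' c' d'. \<forall>t\<in>{0<..<1}.
      (a has_real_derivative a' t) (at t) \<and> (b has_real_derivative b' t) (at t) \<and>
      (c has_real_derivative c' t) (at t) \<and> (d has_real_derivative d' t) (at t) \<and>
      (a' has_real_derivative \<theta> t * c t * (a t * c t - b t * d t) - \<mu> t * a t) (at t) \<and>
      (b' has_real_derivative \<theta> t * d t * (b t * d t - a t * c t) - \<mu> t * b t) (at t) \<and>
      (c' has_real_derivative \<kappa> t * a t * (a t * c t - b t * d t) - \<nu> t * c t) (at t) \<and>
      (d' has_real_derivative \<kappa> t * b t * (b t * d t - a t * c t) - \<nu> t * d t) (at t))"

text \<open>The two symmetries exchange real and imaginary parts, or the two vectors. Together they
  bring any coordinate to the first place, so only zeros of \<open>a\<close> need be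
  studied.\<close>

lemma coupled_flow_swap:
  assumes "coupled_flow a b c d \<theta> \<kappa> \<mu> \<nu>"
  shows "coupled_flow b a d c \<theta> \<kappa> \<mu> \<nu>" "coupled_flow c d a b \<kappa> \<theta> \<nu> \<mu>"
proof -
  from assms obtain a' b' c' d' where *: "\<forall>t\<in>{0<..<1}.
      (a has_real_derivative a' t) (at t) \<and> (b has_real_derivative b' t) (at t) \<and>
      (c has_real_derivative c' t) (at t) \<and> (d has_real_derivative d' t) (at t) \<and>
      (a' has_real_derivative \<theta> t * c t * (a t * c t - b t * d t) - \<mu> t * a t) (at t) \<and>
      (b' has_real_derivative \<theta> t * d t * (b t * d t - a t * c t) - \<mu> t * b t) (at t) \<and>
      (c' has_real_derivative \<kappa> t * a t * (a t * c t - b t * d t) - \<nu> t * c t) (at t) \<and>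
      (d' has_real_derivative \<kappa> t * b t * (b t * d t - a t * c t) - \<nu> t * d t) (at t)"
    unfolding coupled_flow_def by blast
  have base: "continuous_on {0<..<1} \<theta>" "continuous_on {0<..<1} \<kappa>" "continuous_on {0<..<1} \<mu>"
      "continuous_on {0<..<1} \<nu>"
    and sign: "\<And>t. t \<in> {0<..<1} \<Longrightarrow> \<theta> t > 0 \<and> \<kappa> t > 0 \<and> a t \<ge> 0 \<and> b t \<ge> 0 \<and> c t \<ge> 0 \<and> d t \<ge> 0"
    using assms by (simp_all add: coupled_flow_def)
  show "coupled_flow b a d c \<theta> \<kappa> \<mu> \<nu>"
    unfolding coupled_flow_def
  proof (intro conjI base)
    show "\<forall>t\<in>{0<..<1}. \<theta> t > 0 \<and> \<kappa> t > 0 \<and> b t \<ge> 0 \<and> a t \<ge> 0 \<and> d t \<ge> 0 \<and> c t \<ge> 0"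
      using sign by simp
  qed (rule exI[of _ b'], rule exI[of _ a'], rule exI[of _ d'], rule exI[of _ c'],
      rule ballI, drule bspec[OF *], elim conjE, intro conjI, assumption+)
  have comm: "a t * c t = c t * a t" "b t * d t = d t * b t" for t by simp_all
  show "coupled_flow c d a b \<kappa> \<theta> \<nu> \<mu>"
    unfolding coupled_flow_def
  proof (intro conjI base)
    show "\<forall>t\<in>{0<..<1}. \<kappa> t > 0 \<and> \<theta> t > 0 \<and> c t \<ge> 0 \<and> d t \<ge> 0 \<and> a t \<ge> 0 \<and> b t \<ge> 0"
      using sign by simp
  qed (rule exI[of _ c'], rule exI[of _ d'], rule exI[of _ a'], rule exI[of _ b'],
      rule ballI, drule bspec[OF *[unfolded comm]], elim conjE, intro conjI, assumption+)
qed

lemma coupled_flow_vanishing: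
  assumes flow: "coupled_flow a b c d \<theta> \<kappa> \<mu> \<nu>" and t0: "t0 \<in> {0<..<1}" "a t0 = 0"
  shows "b t0 = 0 \<or> c t0 = 0 \<or> d t0 = 0" "\<forall>t\<in>{0<..<1}. a t = 0"
proof -
  let ?I = "{0<..<1::real}"
  from flow obtain a' b' c' d' where *: "\<And>t. t \<in> ?I \<Longrightarrow>
      (a has_real_derivative a' t) (at t) \<and> (b has_real_derivative b' t) (at t) \<and>
      (c has_real_derivative c' t) (at t) \<and> (d has_real_derivative d' t) (at t) \<and>
      (a' has_real_derivative \<theta> t * c t * (a t * c t - b t * d t) - \<mu> t * a t) (at t) \<and>
      (b' has_real_derivative \<theta> t * d t * (b t * d t - a t * c t) - \<mu> t * b t) (at t) \<and>
      (c' has_real_derivative \<kappa> t * a t * (a t * c t - b t * d t) - \<nu> t * c t) (at t) \<and>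
      (d' has_real_derivative \<kappa> t * b t * (b t * d t - a t * c t) - \<nu> t * d t) (at t)"
    unfolding coupled_flow_def by blast
  have D: "(a has_real_derivative a' t) (at t)" "(b has_real_derivative b' t) (at t)"
      "(c has_real_derivative c' t) (at t)" "(d has_real_derivative d' t) (at t)"
    and D2: "(a' has_real_derivative \<theta> t * c t * (a t * c t - b t * d t) - \<mu> t * a t) (at t)"
      "(b' has_real_derivative \<theta> t * d t * (b t * d t - a t * c t) - \<mu> t * b t) (at t)"
      "(c' has_real_derivative \<kappa> t * a t * (a t * c t - b t * d t) - \<nu> t * c t) (at t)"
      "(d' has_real_derivative \<kappa> t * b t * (b t * d t - a t * c t) - \<nu> t * d t) (at t)" if "t \<in> ?I" for t
    using *[OF that] by blast+
  have nonneg: "\<theta> t > 0" "a t \<ge> 0" "b t \<ge> 0" "c t \<ge> 0" "d t \<ge> 0" if "t \<in> ?I" for t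
    using flow that by (auto simp: coupled_flow_def)
  have cont: "continuous_on ?I \<theta>" "continuous_on ?I \<kappa>" "continuous_on ?I \<mu>" "continuous_on ?I \<nu>"
    using flow by (auto simp: coupled_flow_def)
  have contD: "continuous_on ?I a" "continuous_on ?I b" "continuous_on ?I c" "continuous_on ?I d"
    by (rule DERIV_continuous_on, rule has_field_derivative_at_within, erule D)+
  note zero = nonneg_zero_imp_derivs(1)
  have a0: "a' t0 = 0" by (rule zero[OF D(1) nonneg(2) t0])
  \<comment> \<open>The minimum forces \<open>a'' \<ge> 0\<close> at \<open>t0\<close>, whereas the equation gives \<open>a'' = - \<theta> b c d\<close> there.\<close>
  have "0 \<le> \<theta> t0 * c t0 * (a t0 * c t0 - b t0 * d t0) - \<mu> t0 * a t0"
    by (rule nonneg_zero_imp_derivs(2)[OF D(1) nonneg(2) t0 D2(1)[OF t0(1)]])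
  then have "\<not> 0 < \<theta> t0 * (b t0 * c t0 * d t0)" using t0(2) by (simp add: algebra_simps)
  then have "\<not> 0 < b t0 * c t0 * d t0" using nonneg(1)[OF t0(1)] mult_pos_pos by blast
  moreover have "b t0 * c t0 * d t0 \<ge> 0" using nonneg[OF t0(1)] by simp
  ultimately have "b t0 * c t0 * d t0 = 0" by linarith
  then show cases: "b t0 = 0 \<or> c t0 = 0 \<or> d t0 = 0" by simp
  show "\<forall>t\<in>?I. a t = 0"
  proof
    fix t assume t: "t \<in> ?I"
    from cases consider "b t0 = 0" | "c t0 = 0" | "d t0 = 0" by blast
    then show "a t = 0"
    proof cases
      \<comment> \<open>\<open>c\<close> and \<open>d\<close> are regarded as known functions and
        absorbed into the coefficients; case 3 treats \<open>b\<close> and \<open>c\<close> in the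
        same way.\<close>
      case 1
      show ?thesis
      proof (rule linear_second_order_zero[OF D(1) _ D(2) _ _ _ _ _ t0 a0 1 zero[OF D(2) nonneg(3) t0(1) 1] t])
        show "(a' has_real_derivative (\<theta> t * (c t)\<^sup>2 - \<mu> t) * a t + (- \<theta> t * c t * d t) * b t) (at t)"
          "(b' has_real_derivative (- \<theta> t * c t * d t) * a t + (\<theta> t * (d t)\<^sup>2 - \<mu> t) * b t) (at t)"
          if "t \<in> ?I" for t
          using D2(1,2)[OF that] by (simp_all add: algebra_simps power2_eq_square)
      qed (assumption | intro continuous_intros cont contD)+
    next
      \<comment> \<open>Here the whole factor \<open>a t * c t - b t * d t\<close> is regarded as a
        known coefficient, which makes the system for \<open>a\<close> and \<open>c\<close>
        linear.\<close>
      case 2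
      show ?thesis
      proof (rule linear_second_order_zero[OF D(1) _ D(3) _ _ _ _ _ t0 a0 2 zero[OF D(3) nonneg(4) t0(1) 2] t])
        show "(a' has_real_derivative (- \<mu> t) * a t + (\<theta> t * (a t * c t - b t * d t)) * c t) (at t)"
          "(c' has_real_derivative (\<kappa> t * (a t * c t - b t * d t)) * a t + (- \<nu> t) * c t) (at t)"
          if "t \<in> ?I" for t
          using D2(1,3)[OF that] by (simp_all add: algebra_simps)
      qed (assumption | intro continuous_intros cont contD)+
    next
      case 3
      show ?thesis
      proof (rule linear_second_order_zero[OF D(1) _ D(4) _ _ _ _ _ t0 a0 3 zero[OF D(4) nonneg(5) t0(1) 3] t])
        show "(a' has_real_derivative (\<theta> t * (c t)\<^sup>2 - \<mu> t) * a t + (- \<theta> t * c t * b t) * d t) (at t)"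
          "(d' has_real_derivative (- \<kappa> t * b t * c t) * a t + (\<kappa> t * (b t)\<^sup>2 - \<nu> t) * d t) (at t)"
          if "t \<in> ?I" for t
          using D2(1,4)[OF that] by (simp_all add: algebra_simps power2_eq_square)
      qed (assumption | intro continuous_intros cont contD)+
    qed
  qed
qed

section \<open>From minimizers to the coupled equations\<close>

text \<open>At a colliding end the domain is not closed, so the solutions on compact subintervals
  have to be glued. Taking the velocity to be the derivative within the whole domain makes the local
  velocities agree.\<close>

lemma minimizer_newton_solution_collision_free:
  assumes m: "m > 0" and min: "action_minimizer m Z" and fin: "action m Z \<noteq> top"
    and cf: "\<And>t. t \<in> {0<..<1} \<Longrightarrow> collision_free (Z t)"
  shows "newton_solution m Z {t\<in>{0..1}. collision_free (Z t)}"
proof -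
  define I where "I = {t\<in>{0..1}. collision_free (Z t)}"
  define V where "V t = vector_derivative Z (at t within I)" for t
  have "(Z has_vector_derivative V t) (at t within I) \<and> (V has_vector_derivative newton_force m (Z t)) (at t within I)"
    if t: "t \<in> I" for t
  proof -
    have t01: "0 \<le> t" "t \<le> 1" using t by (auto simp: I_def)
    \<comment> \<open>\<open>{l..u}\<close> is a neighbourhood of \<open>t\<close> relative to the
      domain and contains an end of the unit interval only if \<open>t\<close> is that end.\<close>
    define l u where "l = (if t = 0 then 0 else t / 2)" and "u = (if t = 1 then 1 else (t + 1) / 2)"
    \<comment> \<open>At an end \<open>N\<close> reaches beyond the unit interval, so that it is an
      open set containing \<open>t\<close>.\<close>
    define N where "N = {(if t = 0 then -1 else t / 2)<..<(if t = 1 then 2 else (t + 1) / 2)}"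
    have lu: "0 \<le> l" "l < u" "u \<le> 1" "t \<in> {l..u}" "t \<in> N" "open N"
      using t01 by (auto simp: l_def u_def N_def)
    have sub: "{l..u} \<subseteq> I"
    proof
      fix s assume s: "s \<in> {l..u}"
      then have "s = t \<or> s \<in> {0<..<1}" using t01 by (auto simp: l_def u_def split: if_splits)
      then show "s \<in> I" using t cf by (auto simp: I_def)
    qed
    have NI: "I \<inter> N - {s} = {l..u} \<inter> N - {s}" for s
    proof -
      have "I \<inter> N \<subseteq> {l..u}" by (auto simp: I_def N_def l_def u_def split: if_splits)
      then show ?thesis using sub by blast
    qed
    have at_eq: "at s within I = at s within {l..u}" if "s \<in> N" for s
      by (rule at_within_nhd[OF that \<open>open N\<close> NI])
    have "newton_solution m Z {l..u}"
      by (rule minimizer_newton_solution[OF m min fin lu(1-3)]) (use sub in \<open>auto simp: I_def\<close>)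
    then obtain V' where V': "\<And>s. s \<in> {l..u} \<Longrightarrow> (Z has_vector_derivative V' s) (at s within {l..u})"
      "\<And>s. s \<in> {l..u} \<Longrightarrow> (V' has_vector_derivative newton_force m (Z s)) (at s within {l..u})"
      unfolding newton_solution_def by blast
    have VV': "V s = V' s" if "s \<in> {l..u}" "s \<in> N" for s
      unfolding V_def at_eq[OF that(2)] using vector_derivative_within_closed_interval[OF lu(2) that(1) V'(1)[OF that(1)]] .
    obtain e where e: "e > 0" "ball t e \<subseteq> N" using \<open>open N\<close> lu(5) openE by blast
    have "(V has_vector_derivative newton_force m (Z t)) (at t within {l..u})"
      by (rule has_vector_derivative_transform_within[OF V'(2)[OF lu(4)] e(1) lu(4)])
        (use e(2) VV' in \<open>auto simp: dist_commute subset_iff\<close>)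
    then show ?thesis
      using V'(1)[OF lu(4)] VV'[OF lu(4,5)] at_eq[OF lu(5)] by simp
  qed
  then show ?thesis
    unfolding newton_solution_def I_def[symmetric] by (auto simp: I_def)
qed

lemma minimizer_in_cone_coupled_flow:
  assumes m: "m > 0" and min: "action_minimizer m Z" and sign_cone: "\<And>t. t \<in> {0..1} \<Longrightarrow> Z t \<in> sign_cone"
  obtains \<theta> \<kappa> \<mu> \<nu> where "coupled_flow (\<lambda>t. Re (fst (Z t))) (\<lambda>t. Im (fst (Z t))) (\<lambda>t. Re (snd (Z t)))
    (\<lambda>t. - Im (snd (Z t))) \<theta> \<kappa> \<mu> \<nu>"
proof -
  let ?I = "{0<..<1::real}"
  have fin: "action m Z \<noteq> top" using minimizer_finite_action[OF m min] sign_cone by simp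
  have cf: "collision_free (Z t)" if "t \<in> ?I" for t
    by (rule minimizer_in_cone_collision_free[OF m min sign_cone that])
  obtain V where V: "\<And>t. t \<in> {t\<in>{0..1}. collision_free (Z t)} \<Longrightarrow>
      (Z has_vector_derivative V t) (at t within {t\<in>{0..1}. collision_free (Z t)}) \<and>
      (V has_vector_derivative newton_force m (Z t)) (at t within {t\<in>{0..1}. collision_free (Z t)})"
    using minimizer_newton_solution_collision_free[OF m min fin cf] unfolding newton_solution_def by blast
  have V': "(Z has_vector_derivative V t) (at t)" "(V has_vector_derivative newton_force m (Z t)) (at t)" if t: "t \<in> ?I" for t
  proof -
    have "?I \<subseteq> {t\<in>{0..1}. collision_free (Z t)}" using cf by auto
    then have "t \<in> interior {t\<in>{0..1}. collision_free (Z t)}"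
      using t by (meson interior_maximal open_greaterThanLessThan subsetD)
    then have at_eq: "at t within {t\<in>{0..1}. collision_free (Z t)} = at t" by (rule at_within_interior)
    have "t \<in> {t\<in>{0..1}. collision_free (Z t)}" using t cf by auto
    from V[OF this, unfolded at_eq]
    show "(Z has_vector_derivative V t) (at t)" "(V has_vector_derivative newton_force m (Z t)) (at t)" by blast+
  qed
  have contZ: "continuous_on ?I Z"
    by (rule continuous_at_imp_continuous_on) (use V'(1) has_vector_derivative_continuous in blast)
  define p q where "p t = cmod (snd (Z t) + fst (Z t) / 2)" and "q t = cmod (snd (Z t) - fst (Z t) / 2)" for t
  define n where "n t = cmod (fst (Z t))" for t
  have pos: "p t > 0" "q t > 0" "n t > 0" if "t \<in> ?I" for t
    using cf[OF that] by (auto simp: p_def q_def n_def collision_free_def)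
  have cont: "continuous_on ?I p" "continuous_on ?I q" "continuous_on ?I n"
    unfolding p_def q_def n_def
    by (intro continuous_on_norm continuous_on_add continuous_on_diff continuous_on_divide
        continuous_on_fst continuous_on_snd continuous_on_const contZ; simp)+
  \<comment> \<open>With \<open>s\<close> the inner product of the two vectors,
    \<open>p^2 - q^2 = 2 * s\<close>. So \<open>1 / q^3 - 1 / p^3\<close>, which is
    \<open>(p - q) * (p^2 + p * q + q^2) / (p^3 * q^3)\<close>, equals \<open>\<theta> * s\<close>
    without a division by \<open>p - q\<close>.\<close>
  define \<theta> where "\<theta> t = 2 * ((p t)\<^sup>2 + p t * q t + (q t)\<^sup>2) / ((p t + q t) * (p t ^ 3 * q t ^ 3))" for t
  define \<kappa> where "\<kappa> t = (1 + 2 * m) / 4 * \<theta> t" for t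
  define \<mu> where "\<mu> t = (inverse (q t ^ 3) + inverse (p t ^ 3)) / 2 + 2 * m * inverse (n t ^ 3)" for t
  define \<nu> where "\<nu> t = (1 + 2 * m) / 2 * (inverse (q t ^ 3) + inverse (p t ^ 3))" for t
  have ne: "p t \<noteq> 0" "q t \<noteq> 0" "n t \<noteq> 0" "(p t + q t) * (p t ^ 3 * q t ^ 3) \<noteq> 0" if "t \<in> ?I" for t
    using pos[OF that] by simp_all
  have "continuous_on ?I \<theta>"
    unfolding \<theta>_def by (intro continuous_intros cont ballI ne(4))
  moreover from this have "continuous_on ?I \<kappa>" unfolding \<kappa>_def by (intro continuous_intros)
  moreover have "continuous_on ?I \<mu>" "continuous_on ?I \<nu>"
    unfolding \<mu>_def \<nu>_def by (intro continuous_intros cont ballI power_not_zero ne(1-3); simp)+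
  moreover have \<theta>pos: "\<theta> t > 0" if "t \<in> ?I" for t
    unfolding \<theta>_def using pos[OF that] by (intro divide_pos_pos mult_pos_pos add_pos_pos zero_less_power) auto
  moreover have "\<kappa> t > 0" if "t \<in> ?I" for t unfolding \<kappa>_def using \<theta>pos[OF that] m by simp
  moreover have "Re (fst (Z t)) \<ge> 0" "Im (fst (Z t)) \<ge> 0" "Re (snd (Z t)) \<ge> 0" "- Im (snd (Z t)) \<ge> 0" if "t \<in> ?I" for t
    using sign_cone[of t] that by (auto simp: sign_cone_def)
  moreover have "((\<lambda>t. Re (fst (Z t))) has_real_derivative Re (fst (V t))) (at t) \<and>
      ((\<lambda>t. Im (fst (Z t))) has_real_derivative Im (fst (V t))) (at t) \<and>
      ((\<lambda>t. Re (snd (Z t))) has_real_derivative Re (snd (V t))) (at t) \<and>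
      ((\<lambda>t. - Im (snd (Z t))) has_real_derivative - Im (snd (V t))) (at t) \<and>
      ((\<lambda>t. Re (fst (V t))) has_real_derivative \<theta> t * Re (snd (Z t)) * (Re (fst (Z t)) * Re (snd (Z t)) - Im (fst (Z t)) * - Im (snd (Z t)))
         - \<mu> t * Re (fst (Z t))) (at t) \<and>
      ((\<lambda>t. Im (fst (V t))) has_real_derivative \<theta> t * - Im (snd (Z t)) * (Im (fst (Z t)) * - Im (snd (Z t)) - Re (fst (Z t)) * Re (snd (Z t)))
         - \<mu> t * Im (fst (Z t))) (at t) \<and>
      ((\<lambda>t. Re (snd (V t))) has_real_derivative \<kappa> t * Re (fst (Z t)) * (Re (fst (Z t)) * Re (snd (Z t)) - Im (fst (Z t)) * - Im (snd (Z t)))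
         - \<nu> t * Re (snd (Z t))) (at t) \<and>
      ((\<lambda>t. - Im (snd (V t))) has_real_derivative \<kappa> t * Im (fst (Z t)) * (Im (fst (Z t)) * - Im (snd (Z t)) - Re (fst (Z t)) * Re (snd (Z t)))
         - \<nu> t * - Im (snd (Z t))) (at t)" if t: "t \<in> ?I" for t
  proof -
    define F where "F = newton_force m (Z t)"
    have comp: "((\<lambda>t. Re (fst (f t))) has_real_derivative Re (fst f')) (at t)"
      "((\<lambda>t. Im (fst (f t))) has_real_derivative Im (fst f')) (at t)"
      "((\<lambda>t. Re (snd (f t))) has_real_derivative Re (snd f')) (at t)"
      "((\<lambda>t. - Im (snd (f t))) has_real_derivative - Im (snd f')) (at t)"
      if "(f has_vector_derivative f') (at t)" for f :: "real \<Rightarrow> complex \<times> complex" and f'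
    proof -
      have bl: "bounded_linear (\<lambda>z::complex \<times> complex. Re (fst z))" "bounded_linear (\<lambda>z::complex \<times> complex. Im (fst z))"
        "bounded_linear (\<lambda>z::complex \<times> complex. Re (snd z))" "bounded_linear (\<lambda>z::complex \<times> complex. - Im (snd z))"
        by (intro bounded_linear_minus bounded_linear_compose[OF bounded_linear_Re] bounded_linear_compose[OF bounded_linear_Im]
            bounded_linear_fst bounded_linear_snd)+
      show "((\<lambda>t. Re (fst (f t))) has_real_derivative Re (fst f')) (at t)"
        "((\<lambda>t. Im (fst (f t))) has_real_derivative Im (fst f')) (at t)"
        "((\<lambda>t. Re (snd (f t))) has_real_derivative Re (snd f')) (at t)"
        "((\<lambda>t. - Im (snd (f t))) has_real_derivative - Im (snd f')) (at t)"
        unfolding has_real_derivative_iff_has_vector_derivative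
        using bl[THEN bounded_linear.has_vector_derivative, OF that] by blast+
    qed
    define a b c e where "a = Re (fst (Z t))" and "b = Im (fst (Z t))" and "c = Re (snd (Z t))" and "e = Im (snd (Z t))"
    define \<alpha> \<beta> \<gamma> where "\<alpha> = inverse (q t ^ 3)" and "\<beta> = inverse (p t ^ 3)" and "\<gamma> = inverse (n t ^ 3)"
    have diff: "\<alpha> - \<beta> = \<theta> t * (a * c + b * e)"
    proof -
      have P: "p t > 0" "q t > 0" using pos[OF t] by auto
      have "(p t)\<^sup>2 = (c + a / 2)\<^sup>2 + (e + b / 2)\<^sup>2" "(q t)\<^sup>2 = (c - a / 2)\<^sup>2 + (e - b / 2)\<^sup>2"
        by (simp_all add: p_def q_def cmod_power2 a_def b_def c_def e_def)
      then have s: "2 * (a * c + b * e) = (p t)\<^sup>2 - (q t)\<^sup>2" by (simp add: power2_eq_square algebra_simps)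
      have "\<alpha> - \<beta> = (p t ^ 3 - q t ^ 3) / (p t ^ 3 * q t ^ 3)"
        using P by (simp add: \<alpha>_def \<beta>_def field_simps)
      also have "p t ^ 3 - q t ^ 3 = ((p t)\<^sup>2 + p t * q t + (q t)\<^sup>2) * (p t - q t)"
        by (simp add: power2_eq_square power3_eq_cube algebra_simps)
      also have "\<dots> = ((p t)\<^sup>2 + p t * q t + (q t)\<^sup>2) * (2 * (a * c + b * e)) / (p t + q t)"
      proof -
        have "(p t)\<^sup>2 - (q t)\<^sup>2 = (p t - q t) * (p t + q t)"
          by (simp add: power2_eq_square algebra_simps)
        then show ?thesis unfolding s using P by simp
      qed
      finally have "\<alpha> - \<beta> = ((p t)\<^sup>2 + p t * q t + (q t)\<^sup>2) * (2 * (a * c + b * e)) / (p t + q t) / (p t ^ 3 * q t ^ 3)" .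
      moreover have "X * (2 * w) / s / k = 2 * X / (s * k) * w" for X w s k :: real by simp
      ultimately show ?thesis unfolding \<theta>_def by (simp only:)
    qed
    have half: "Re (z / 2) = Re z / 2" "Im (z / 2) = Im z / 2" for z by simp_all
    have F: "Re (fst F) = (\<alpha> - \<beta>) * c - ((\<alpha> + \<beta>) / 2 + 2 * m * \<gamma>) * a"
      "Im (fst F) = (\<alpha> - \<beta>) * e - ((\<alpha> + \<beta>) / 2 + 2 * m * \<gamma>) * b"
      "Re (snd F) = (1 + 2 * m) / 2 * ((\<alpha> - \<beta>) * a / 2 - (\<alpha> + \<beta>) * c)"
      "Im (snd F) = (1 + 2 * m) / 2 * ((\<alpha> - \<beta>) * b / 2 - (\<alpha> + \<beta>) * e)"
      unfolding F_def newton_force_def Let_def p_def[symmetric] q_def[symmetric] n_def[symmetric]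
        \<alpha>_def[symmetric] \<beta>_def[symmetric] \<gamma>_def[symmetric]
      by (simp_all add: half a_def b_def c_def e_def)
        (simp_all add: field_simps)
    have mn: "\<mu> t = (\<alpha> + \<beta>) / 2 + 2 * m * \<gamma>" "\<nu> t = (1 + 2 * m) / 2 * (\<alpha> + \<beta>)"
      by (simp_all add: \<mu>_def \<nu>_def \<alpha>_def \<beta>_def \<gamma>_def)
    have eqs: "Re (fst F) = \<theta> t * c * (a * c - b * - e) - \<mu> t * a"
      "Im (fst F) = \<theta> t * - e * (b * - e - a * c) - \<mu> t * b"
      "Re (snd F) = \<kappa> t * a * (a * c - b * - e) - \<nu> t * c"
      "- Im (snd F) = \<kappa> t * b * (b * - e - a * c) - \<nu> t * - e"
      unfolding F diff \<kappa>_def mn by (simp_all add: field_simps)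
    show ?thesis
      unfolding a_def[symmetric] b_def[symmetric] c_def[symmetric] e_def[symmetric]
      by (intro conjI comp[OF V'(1)[OF t]] comp[OF V'(2)[OF t], folded F_def, unfolded eqs])
  qed
  ultimately have "coupled_flow (\<lambda>t. Re (fst (Z t))) (\<lambda>t. Im (fst (Z t))) (\<lambda>t. Re (snd (Z t)))
    (\<lambda>t. - Im (snd (Z t))) \<theta> \<kappa> \<mu> \<nu>"
    unfolding coupled_flow_def
    by (intro conjI ballI) ((blast | rule exI[of _ "\<lambda>t. Re (fst (V t))"], rule exI[of _ "\<lambda>t. Im (fst (V t))"],
        rule exI[of _ "\<lambda>t. Re (snd (V t))"], rule exI[of _ "\<lambda>t. - Im (snd (V t))"]; blast)+)
  then show ?thesis by (rule that)
qed

section \<open>Reflections and quadrants\<close>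

definition flip :: "real \<Rightarrow> real \<Rightarrow> real \<Rightarrow> real \<Rightarrow> complex \<times> complex \<Rightarrow> complex \<times> complex" where
  "flip p q r s z = (Complex (p * Re (fst z)) (q * Im (fst z)), Complex (r * Re (snd z)) (s * Im (snd z)))"

definition fold_into_cone :: "complex \<times> complex \<Rightarrow> complex \<times> complex" where
  "fold_into_cone z = (Complex \<bar>Re (fst z)\<bar> \<bar>Im (fst z)\<bar>, Complex \<bar>Re (snd z)\<bar> (- \<bar>Im (snd z)\<bar>))"

text \<open>With \<open>X = x\<^sub>1 x\<^sub>2\<close> and \<open>Y = y\<^sub>1 y\<^sub>2\<close>, folding replaces \<open>X + Y\<close> by \<open>\<bar>X\<bar> - \<bar>Y\<bar>\<close> in the inner product of \<open>Z\<^sub>1\<close> and \<open>Z\<^sub>2\<close>, which shrinks its absolute value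
  exactly when the product \<open>XY\<close> is positive.\<close>

definition sign_product :: "complex \<times> complex \<Rightarrow> real" where
  "sign_product z = (Re (fst z) * Re (snd z)) * (Im (fst z) * Im (snd z))"

lemma bounded_linear_flip: "bounded_linear (flip p q r s)"
proof -
  have "linear (flip p q r s)"
    by (rule linearI) (auto simp: flip_def complex_eq_iff prod_eq_iff algebra_simps)
  then show ?thesis by (simp add: linear_conv_bounded_linear)
qed

lemma kinetic_flip:
  assumes "p \<in> {1, -1}" "q \<in> {1, -1}" "r \<in> {1, -1}" "s \<in> {1, -1}"
  shows "kinetic m (flip p q r s z) = kinetic m z"
proof -
  have "p\<^sup>2 = 1" "q\<^sup>2 = 1" "r\<^sup>2 = 1" "s\<^sup>2 = 1" using assms by auto
  then show ?thesis by (simp add: kinetic_def flip_def cmod_power2 power_mult_distrib)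
qed

lemma cmod_separations:
  "(cmod (separation 1 z))\<^sup>2 + (cmod (separation 2 z))\<^sup>2 = (cmod (fst z))\<^sup>2 / 2 + 2 * (cmod (snd z))\<^sup>2"
  "(cmod (separation 1 z))\<^sup>2 - (cmod (separation 2 z))\<^sup>2 = 2 * (fst z \<bullet> snd z)"
  unfolding separation_def cmod_power2 inner_complex_def
  by (simp_all add: power2_eq_square field_simps)

text \<open>The sum of the squares of these two distances depends on the moduli of the two vectors
  alone. With the moduli fixed, the inner product acts on the potential only through the product of
  the distances.\<close>

lemma cmod_separation_mult_square:
  "(cmod (separation 1 z) * cmod (separation 2 z))\<^sup>2 =
    ((cmod (fst z))\<^sup>2 / 4 + (cmod (snd z))\<^sup>2)\<^sup>2 - (fst z \<bullet> snd z)\<^sup>2"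
proof -
  have eqs: "(cmod (separation 1 z))\<^sup>2 = (cmod (fst z))\<^sup>2 / 4 + (cmod (snd z))\<^sup>2 + fst z \<bullet> snd z"
    "(cmod (separation 2 z))\<^sup>2 = (cmod (fst z))\<^sup>2 / 4 + (cmod (snd z))\<^sup>2 - fst z \<bullet> snd z"
    using cmod_separations[of z] by linarith+
  show ?thesis unfolding power_mult_distrib eqs by (simp add: power2_eq_square algebra_simps)
qed

lemma potential_three_terms:
  "potential m z = ennreal (m\<^sup>2) / ennreal (cmod (fst z)) +
    (ennreal m / ennreal (cmod (separation 1 z)) + ennreal m / ennreal (cmod (separation 2 z)))"
  by (simp add: potential_def separation_def add.assoc)

text \<open>The sign condition means \<open>p * r = q * s\<close>, so the inner product of the two
  vectors is kept or reversed as a whole; reversal just exchanges the last two separations.\<close>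

lemma potential_flip:
  assumes "p \<in> {1, -1}" "q \<in> {1, -1}" "r \<in> {1, -1}" "s \<in> {1, -1}" "p * q * r * s = 1"
  shows "potential m (flip p q r s z) = potential m z"
proof -
  have sq: "p\<^sup>2 = 1" "q\<^sup>2 = 1" "r\<^sup>2 = 1" "s\<^sup>2 = 1" using assms by auto
  have n: "cmod (fst (flip p q r s z)) = cmod (fst z)" "cmod (snd (flip p q r s z)) = cmod (snd z)"
    by (simp_all add: flip_def cmod_def power_mult_distrib sq)
  have i: "fst (flip p q r s z) \<bullet> snd (flip p q r s z) = p * r * (Re (fst z) * Re (snd z)) + q * s * (Im (fst z) * Im (snd z))"
    by (simp add: flip_def inner_complex_def)
  have "p * r = q * s" "p * r = 1 \<or> p * r = -1" using assms by auto
  then have "fst (flip p q r s z) \<bullet> snd (flip p q r s z) = fst z \<bullet> snd z \<or>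
      fst (flip p q r s z) \<bullet> snd (flip p q r s z) = - (fst z \<bullet> snd z)"
    unfolding i by (auto simp: inner_complex_def)
  then consider "cmod (separation 1 (flip p q r s z)) = cmod (separation 1 z)" "cmod (separation 2 (flip p q r s z)) = cmod (separation 2 z)"
    | "cmod (separation 1 (flip p q r s z)) = cmod (separation 2 z)" "cmod (separation 2 (flip p q r s z)) = cmod (separation 1 z)"
  proof (elim disjE)
    assume "fst (flip p q r s z) \<bullet> snd (flip p q r s z) = fst z \<bullet> snd z"
    then have "(cmod (separation 1 (flip p q r s z)))\<^sup>2 = (cmod (separation 1 z))\<^sup>2"
      "(cmod (separation 2 (flip p q r s z)))\<^sup>2 = (cmod (separation 2 z))\<^sup>2"
      using cmod_separations[of z] cmod_separations[of "flip p q r s z"] unfolding n by linarith+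
    then show ?thesis using that(1) by simp
  next
    assume "fst (flip p q r s z) \<bullet> snd (flip p q r s z) = - (fst z \<bullet> snd z)"
    then have "(cmod (separation 1 (flip p q r s z)))\<^sup>2 = (cmod (separation 2 z))\<^sup>2"
      "(cmod (separation 2 (flip p q r s z)))\<^sup>2 = (cmod (separation 1 z))\<^sup>2"
      using cmod_separations[of z] cmod_separations[of "flip p q r s z"] unfolding n by linarith+
    then show ?thesis using that(2) by simp
  qed
  then show ?thesis
    by cases (simp_all add: potential_three_terms n add.commute)
qed

section \<open>Effect of folding on the potential\<close>

text \<open>For a fixed sum of squares,
  \<open>(1 / P + 1 / Q)^2 = (P^2 + Q^2) / (P * Q)^2 + 2 / (P * Q)\<close> decreases in the product.
  Values in the extended reals cover the case in which the unprimed pair has a vanishing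
  distance.\<close>

lemma inverse_sum_mono:
  fixes P Q P' Q' :: real
  assumes m: "m > 0" and nn: "P \<ge> 0" "Q \<ge> 0" "P' \<ge> 0" "Q' \<ge> 0" and sq: "P\<^sup>2 + Q\<^sup>2 = P'\<^sup>2 + Q'\<^sup>2"
  shows "P * Q \<le> P' * Q' \<Longrightarrow> ennreal m / ennreal P' + ennreal m / ennreal Q' \<le> ennreal m / ennreal P + ennreal m / ennreal Q"
    and "P * Q < P' * Q' \<Longrightarrow> ennreal m / ennreal P' + ennreal m / ennreal Q' < ennreal m / ennreal P + ennreal m / ennreal Q"
proof -
  have eq: "ennreal m / ennreal x + ennreal m / ennreal y = ennreal (m * (1 / x + 1 / y))" if "x > 0" "y > 0" for x y :: real
    using that m by (simp add: divide_ennreal ennreal_plus[symmetric] distrib_left del: ennreal_plus)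
  have form: "(1 / x + 1 / y)\<^sup>2 = (x\<^sup>2 + y\<^sup>2) / (x * y)\<^sup>2 + 2 / (x * y)" if "x > 0" "y > 0" for x y :: real
    using that by (simp add: field_simps power2_eq_square)
  have top: "ennreal m / ennreal P + ennreal m / ennreal Q = top" if "P * Q = 0"
    using that m by auto
  show "ennreal m / ennreal P' + ennreal m / ennreal Q' \<le> ennreal m / ennreal P + ennreal m / ennreal Q" if le: "P * Q \<le> P' * Q'"
  proof (cases "P * Q = 0")
    case False
    with nn have pos: "P > 0" "Q > 0" "P * Q > 0" by (auto simp: order_less_le)
    then have "P' * Q' > 0" using le by linarith
    with nn have pos': "P' > 0" "Q' > 0" by (auto simp: zero_less_mult_iff)
    have "(1 / P' + 1 / Q')\<^sup>2 \<le> (1 / P + 1 / Q)\<^sup>2"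
      unfolding form[OF pos(1,2)] form[OF pos'] sq
      using pos le by (intro add_mono divide_left_mono power_mono mult_pos_pos zero_less_power) (auto simp: pos')
    then have "1 / P' + 1 / Q' \<le> 1 / P + 1 / Q"
      by (rule power2_le_imp_le) (use pos in simp)
    then show ?thesis unfolding eq[OF pos(1,2)] eq[OF pos'] using m by (intro ennreal_leI mult_left_mono) auto
  qed (simp add: top)
  show "ennreal m / ennreal P' + ennreal m / ennreal Q' < ennreal m / ennreal P + ennreal m / ennreal Q" if less: "P * Q < P' * Q'"
  proof -
    have "P' * Q' > 0" using less nn by (smt (verit) mult_nonneg_nonneg)
    with nn have pos': "P' > 0" "Q' > 0" by (auto simp: zero_less_mult_iff)
    show ?thesis
    proof (cases "P * Q = 0")
      case False
      with nn have pos: "P > 0" "Q > 0" "P * Q > 0" by (auto simp: order_less_le)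
      have "2 / (P' * Q') < 2 / (P * Q)"
        using pos pos' less by (intro divide_strict_left_mono mult_pos_pos) auto
      moreover have "(P'\<^sup>2 + Q'\<^sup>2) / (P' * Q')\<^sup>2 \<le> (P'\<^sup>2 + Q'\<^sup>2) / (P * Q)\<^sup>2"
        using pos pos' less by (intro divide_left_mono power_mono mult_pos_pos zero_less_power) auto
      ultimately have "(1 / P' + 1 / Q')\<^sup>2 < (1 / P + 1 / Q)\<^sup>2"
        unfolding form[OF pos(1,2)] form[OF pos'] sq by linarith
      then have "1 / P' + 1 / Q' < 1 / P + 1 / Q"
        by (rule power2_less_imp_less) (use pos in simp)
      then show ?thesis unfolding eq[OF pos(1,2)] eq[OF pos'] using m pos
        by (intro ennreal_lessI mult_strict_left_mono mult_pos_pos add_pos_pos) auto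
    qed (simp add: top eq[OF pos'])
  qed
qed

lemma cmod_fold_into_cone:
  "cmod (fst (fold_into_cone z)) = cmod (fst z)" "cmod (snd (fold_into_cone z)) = cmod (snd z)"
  by (simp_all add: fold_into_cone_def cmod_def)

lemma inner_fold_into_cone:
  "(fst (fold_into_cone z) \<bullet> snd (fold_into_cone z))\<^sup>2 =
    (fst z \<bullet> snd z)\<^sup>2 - 2 * (sign_product z + \<bar>sign_product z\<bar>)"
proof -
  define X Y where "X = Re (fst z) * Re (snd z)" and "Y = Im (fst z) * Im (snd z)"
  have eqs: "fst (fold_into_cone z) \<bullet> snd (fold_into_cone z) = \<bar>X\<bar> - \<bar>Y\<bar>" "fst z \<bullet> snd z = X + Y" "sign_product z = X * Y"
    by (simp_all add: fold_into_cone_def inner_complex_def X_def Y_def abs_mult sign_product_def)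
  show ?thesis unfolding eqs by (simp add: power2_eq_square abs_mult algebra_simps)
qed

lemma separation_mult_fold:
  "(cmod (separation 1 (fold_into_cone z)) * cmod (separation 2 (fold_into_cone z)))\<^sup>2 =
   (cmod (separation 1 z) * cmod (separation 2 z))\<^sup>2 + 2 * (sign_product z + \<bar>sign_product z\<bar>)"
  unfolding cmod_separation_mult_square cmod_fold_into_cone inner_fold_into_cone by simp

lemma separation_square_sum_fold:
  "(cmod (separation 1 z))\<^sup>2 + (cmod (separation 2 z))\<^sup>2 =
   (cmod (separation 1 (fold_into_cone z)))\<^sup>2 + (cmod (separation 2 (fold_into_cone z)))\<^sup>2"
  unfolding cmod_separations cmod_fold_into_cone ..

lemma potential_fold_le:
  assumes "m > 0"
  shows "potential m (fold_into_cone z) \<le> potential m z"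
proof -
  have "cmod (separation 1 z) * cmod (separation 2 z) \<le> cmod (separation 1 (fold_into_cone z)) * cmod (separation 2 (fold_into_cone z))"
    by (rule power2_le_imp_le) (use separation_mult_fold[of z] in auto)
  then show ?thesis
    unfolding potential_three_terms cmod_fold_into_cone
    by (intro add_left_mono inverse_sum_mono(1)[OF assms _ _ _ _ separation_square_sum_fold]) auto
qed

lemma potential_fold_less:
  assumes "m > 0" "sign_product z > 0"
  shows "potential m (fold_into_cone z) < potential m z"
proof -
  have "cmod (separation 1 z) * cmod (separation 2 z) < cmod (separation 1 (fold_into_cone z)) * cmod (separation 2 (fold_into_cone z))"
    by (rule power2_less_imp_less) (use separation_mult_fold[of z] assms(2) in auto)
  then have less: "ennreal m / ennreal (cmod (separation 1 (fold_into_cone z))) + ennreal m / ennreal (cmod (separation 2 (fold_into_cone z)))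
     < ennreal m / ennreal (cmod (separation 1 z)) + ennreal m / ennreal (cmod (separation 2 z))"
    by (intro inverse_sum_mono(2)[OF assms(1) _ _ _ _ separation_square_sum_fold]) auto
  have "fst z \<noteq> 0" using assms(2) by (auto simp: sign_product_def)
  then have "ennreal (m\<^sup>2) / ennreal (cmod (fst z)) \<noteq> top"
    by (simp add: divide_ennreal)
  then show ?thesis
    unfolding potential_three_terms cmod_fold_into_cone using less by (simp add: ennreal_add_left_cancel_less)
qed

text \<open>Under this sign condition folding does not change the product of the last two distances.
  This carries the absence of collisions from the folded path back to the original one.\<close>

lemma collision_free_fold:
  assumes "sign_product z \<le> 0"
  shows "collision_free (fold_into_cone z) \<longleftrightarrow> collision_free z"
proof -
  have *: "collision_free w \<longleftrightarrow> cmod (fst w) \<noteq> 0 \<and> (cmod (separation 1 w) * cmod (separation 2 w))\<^sup>2 \<noteq> 0" for w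
    by (auto simp: collision_free_iff all_less_3 separation_def)
  show ?thesis
    unfolding * separation_mult_fold cmod_fold_into_cone using assms by simp
qed

lemma fold_into_cone_in_cone: "fold_into_cone z \<in> sign_cone"
  by (simp add: fold_into_cone_def sign_cone_def)

text \<open>Only an inequality of kinetic energies is claimed: as \<open>sgn 0 = 0\<close>, the
  derivative \<open>h\<close> drops the velocity of a coordinate wherever that coordinate
  vanishes.\<close>

lemma has_L2_derivative_fold:
  assumes "has_L2_derivative Z g"
  obtains h where "has_L2_derivative (\<lambda>t. fold_into_cone (Z t)) h" "\<And>m t. m > 0 \<Longrightarrow> kinetic m (h t) \<le> kinetic m (g t)"
proof -
  define a b c d where "a t = Re (fst (Z t))" and "b t = Im (fst (Z t))" and "c t = Re (snd (Z t))" and "d t = Im (snd (Z t))" for t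
  define a' b' c' d' where "a' t = Re (fst (g t))" and "b' t = Im (fst (g t))" and "c' t = Re (snd (g t))" and "d' t = Im (snd (g t))" for t
  have bl: "bounded_linear (\<lambda>z::complex \<times> complex. Re (fst z))" "bounded_linear (\<lambda>z::complex \<times> complex. Im (fst z))"
        "bounded_linear (\<lambda>z::complex \<times> complex. Re (snd z))" "bounded_linear (\<lambda>z::complex \<times> complex. Im (snd z))"
    by (intro bounded_linear_compose[OF bounded_linear_Re] bounded_linear_compose[OF bounded_linear_Im]
            bounded_linear_fst bounded_linear_snd)+
  have D: "has_L2_derivative a a'" "has_L2_derivative b b'" "has_L2_derivative c c'" "has_L2_derivative d d'"
    unfolding a_def b_def c_def d_def a'_def b'_def c'_def d'_def
    using bl[THEN has_L2_derivative_linear[OF assms]] by blast+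
  define h where "h t = (sgn (a t) * a' t) *\<^sub>R (1, 0) + (sgn (b t) * b' t) *\<^sub>R (\<i>, 0)
      + (sgn (c t) * c' t) *\<^sub>R (0, 1) + (sgn (d t) * d' t) *\<^sub>R (0, - \<i>)" for t
  have "has_L2_derivative (\<lambda>t. \<bar>a t\<bar> *\<^sub>R (1, 0) + \<bar>b t\<bar> *\<^sub>R (\<i>, 0) + \<bar>c t\<bar> *\<^sub>R (0, 1) + \<bar>d t\<bar> *\<^sub>R (0, - \<i>)) h"
    unfolding h_def
    by (intro has_L2_derivative_add has_L2_derivative_linear[OF has_L2_derivative_abs] D bounded_linear_scaleR_left)
  also have "(\<lambda>t. \<bar>a t\<bar> *\<^sub>R (1, 0) + \<bar>b t\<bar> *\<^sub>R (\<i>, 0) + \<bar>c t\<bar> *\<^sub>R (0, 1) + \<bar>d t\<bar> *\<^sub>R (0, - \<i>)) = (\<lambda>t. fold_into_cone (Z t))"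
    by (auto simp: fun_eq_iff fold_into_cone_def prod_eq_iff complex_eq_iff a_def b_def c_def d_def)
  finally have "has_L2_derivative (\<lambda>t. fold_into_cone (Z t)) h" .
  moreover have "kinetic m (h t) \<le> kinetic m (g t)" if "m > 0" for m t
  proof -
    have s: "(sgn x * y)\<^sup>2 \<le> y\<^sup>2" for x y :: real by (cases "x = 0") (auto simp: sgn_if)
    have "(cmod (fst (h t)))\<^sup>2 \<le> (cmod (fst (g t)))\<^sup>2" "(cmod (snd (h t)))\<^sup>2 \<le> (cmod (snd (g t)))\<^sup>2"
      by (auto simp: h_def cmod_power2 a'_def b'_def c'_def d'_def intro!: add_mono s)
    then show ?thesis unfolding kinetic_def using that by (intro add_mono mult_left_mono) auto
  qed
  ultimately show ?thesis by (rule that)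
qed

section \<open>Closed quadrants as pairs of signs\<close>

lemma closure_sign_quadrant:
  assumes "a \<noteq> 0" "b \<noteq> 0"
  shows "closure {z. a * Re z > 0 \<and> b * Im z > 0} = {z. a * Re z \<ge> 0 \<and> b * Im z \<ge> 0}"
proof (rule antisym)
  show "closure {z. a * Re z > 0 \<and> b * Im z > 0} \<subseteq> {z. a * Re z \<ge> 0 \<and> b * Im z \<ge> 0}"
  proof (rule closure_minimal)
    show "closed {z. a * Re z \<ge> 0 \<and> b * Im z \<ge> 0}"
      by (intro closed_Collect_conj closed_Collect_le continuous_intros)
  qed auto
  show "{z. a * Re z \<ge> 0 \<and> b * Im z \<ge> 0} \<subseteq> closure {z. a * Re z > 0 \<and> b * Im z > 0}"
  proof
    fix z assume z: "z \<in> {z. a * Re z \<ge> 0 \<and> b * Im z \<ge> 0}"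
    have aa: "a * a > 0" "b * b > 0" using assms by (auto simp: zero_less_mult_iff linorder_neq_iff)
    \<comment> \<open>A small shift along the diagonal \<open>Complex a b\<close> moves any point of
      the closed quadrant into the open one.\<close>
    have "(\<lambda>n. z + inverse (real (Suc n)) *\<^sub>R Complex a b) \<longlonglongrightarrow> z + 0 *\<^sub>R Complex a b"
      by (intro tendsto_intros LIMSEQ_inverse_real_of_nat)
    moreover have "z + inverse (real (Suc n)) *\<^sub>R Complex a b \<in> {z. a * Re z > 0 \<and> b * Im z > 0}" for n
    proof -
      have "a * (inverse (real (Suc n)) * a) > 0" "b * (inverse (real (Suc n)) * b) > 0"
        using aa by (simp_all add: mult.left_commute[of _ "inverse _"])
      then show ?thesis using z by (simp add: distrib_left del: of_nat_Suc)
    qed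
    ultimately show "z \<in> closure {z. a * Re z > 0 \<and> b * Im z > 0}"
      unfolding closure_sequential by (intro exI[of _ "\<lambda>n. z + inverse (real (Suc n)) *\<^sub>R Complex a b"]) simp
  qed
qed

text \<open>Numbering quadrants by two signs turns adjacency into the equation that the product of
  the four signs is \<open>-1\<close>.\<close>

definition closed_sign_quadrant :: "real \<Rightarrow> real \<Rightarrow> complex set" where
  "closed_sign_quadrant a b = {z. a * Re z \<ge> 0 \<and> b * Im z \<ge> 0}"

lemma closure_quadrant:
  "closure (quadrant 1) = closed_sign_quadrant 1 1" "closure (quadrant 2) = closed_sign_quadrant (-1) 1"
  "closure (quadrant 3) = closed_sign_quadrant (-1) (-1)" "closure (quadrant 4) = closed_sign_quadrant 1 (-1)"
  unfolding closed_sign_quadrant_def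
  using closure_sign_quadrant[of 1 1] closure_sign_quadrant[of "-1" 1]
    closure_sign_quadrant[of "-1" "-1"] closure_sign_quadrant[of 1 "-1"]
  by (simp_all add: quadrant_def)

lemma quadrant_signs:
  assumes "i \<in> {1..4::nat}"
  obtains a b where "a \<in> {1, -1}" "b \<in> {1, -1}" "closure (quadrant i) = closed_sign_quadrant a b"
proof -
  have "i = 1 \<or> i = 2 \<or> i = 3 \<or> i = 4" using assms by auto
  then show ?thesis using closure_quadrant that by (elim disjE) blast+
qed

lemma sign_quadrant_exists:
  assumes "a \<in> {1, -1}" "b \<in> {1, -1}"
  obtains i where "i \<in> {1..4}" "closure (quadrant i) = closed_sign_quadrant a b"
proof -
  have "1 \<in> {1..4::nat}" "2 \<in> {1..4::nat}" "3 \<in> {1..4::nat}" "4 \<in> {1..4::nat}" by auto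
  with assms show ?thesis using closure_quadrant that by (elim insertE emptyE) blast+
qed

text \<open>A common half-axis excludes opposite quadrants and distinctness excludes equal ones, so
  exactly one of the two signs changes.\<close>

lemma adjacent_quadrants_signs:
  assumes "adjacent_quadrants i j"
  obtains a b c d where "a \<in> {1, -1}" "b \<in> {1, -1}" "c \<in> {1, -1}" "d \<in> {1, -1}" "a * b * c * d = -1"
    "closure (quadrant i) = closed_sign_quadrant a b" "closure (quadrant j) = closed_sign_quadrant c d"
proof -
  have ij: "i \<in> {1..4}" "j \<in> {1..4}" and ne: "closure (quadrant i) \<noteq> closure (quadrant j)"
    using assms by (auto simp: adjacent_quadrants_def)
  obtain a b where ab: "a \<in> {1, -1}" "b \<in> {1, -1}" "closure (quadrant i) = closed_sign_quadrant a b"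
    using quadrant_signs[OF ij(1)] by blast
  obtain c d where cd: "c \<in> {1, -1}" "d \<in> {1, -1}" "closure (quadrant j) = closed_sign_quadrant c d"
    using quadrant_signs[OF ij(2)] by blast
  obtain h where h: "h \<in> half_axes" "h \<subseteq> closed_sign_quadrant a b \<inter> closed_sign_quadrant c d"
    using assms ab(3) cd(3) by (auto simp: adjacent_quadrants_def)
  then obtain e where e: "e \<in> {1, \<i>, -1, -\<i>}" "h = {of_real r * e | r. r \<ge> 0}"
    unfolding half_axes_def by blast
  have "e = of_real 1 * e" by simp
  then have "e \<in> h" unfolding e(2) by (intro CollectI exI[of _ 1]) auto
  then have "a * Re e \<ge> 0" "b * Im e \<ge> 0" "c * Re e \<ge> 0" "d * Im e \<ge> 0"
    using h(2) by (auto simp: closed_sign_quadrant_def)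
  then have "\<not> (c = - a \<and> d = - b)"
    using e(1) ab(1,2) by auto
  moreover have "\<not> (c = a \<and> d = b)" using ne ab(3) cd(3) by auto
  ultimately have "a * b * c * d = -1" using ab(1,2) cd(1,2) by auto
  then show ?thesis using that ab cd by blast
qed

lemma signs_adjacent_quadrants:
  assumes "a \<in> {1, -1}" "b \<in> {1, -1}" "c \<in> {1, -1}" "d \<in> {1, -1}" "a * b * c * d = -1"
  obtains i j where "adjacent_quadrants i j"
    "closure (quadrant i) = closed_sign_quadrant a b" "closure (quadrant j) = closed_sign_quadrant c d"
proof -
  obtain i where i: "i \<in> {1..4}" "closure (quadrant i) = closed_sign_quadrant a b"
    using sign_quadrant_exists[OF assms(1,2)] by blast
  obtain j where j: "j \<in> {1..4}" "closure (quadrant j) = closed_sign_quadrant c d"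
    using sign_quadrant_exists[OF assms(3,4)] by blast
  have "Complex a b \<in> closed_sign_quadrant a b" "Complex a b \<notin> closed_sign_quadrant c d"
    using assms by (auto simp: closed_sign_quadrant_def)
  then have ne: "closed_sign_quadrant a b \<noteq> closed_sign_quadrant c d" by blast
  have "\<exists>e\<in>{1, \<i>, -1, -\<i>}. \<forall>r\<ge>0. of_real r * e \<in> closed_sign_quadrant a b \<inter> closed_sign_quadrant c d"
  proof (cases "a = c")
    case True
    then show ?thesis using assms(1)
      by (intro bexI[of _ "of_real a"]) (auto simp: closed_sign_quadrant_def)
  next
    case False
    then have "b = d" using assms by auto
    then show ?thesis using assms(2)
      by (intro bexI[of _ "of_real b * \<i>"]) (auto simp: closed_sign_quadrant_def)
  qed
  then obtain e where e: "e \<in> {1, \<i>, -1, -\<i>}" "{of_real r * e | r. r \<ge> 0} \<subseteq> closed_sign_quadrant a b \<inter> closed_sign_quadrant c d"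
    by blast
  then have "{of_real r * e | r. r \<ge> 0} \<in> half_axes" unfolding half_axes_def by blast
  then have "adjacent_quadrants i j"
    unfolding adjacent_quadrants_def i(2) j(2) using i(1) j(1) ne e(2) by blast
  then show ?thesis using that i(2) j(2) by blast
qed

lemma constant_sign:
  fixes u :: "real \<Rightarrow> real"
  assumes u: "continuous_on {0..1} u" and ne: "\<And>t. t \<in> {0<..<1} \<Longrightarrow> u t \<noteq> 0"
  obtains s where "s \<in> {1, -1}" "\<And>t. t \<in> {0<..<1} \<Longrightarrow> s * u t > 0"
proof -
  have half: "(1/2::real) \<in> {0<..<1}" by simp
  have "sgn (u t) = sgn (u (1/2))" if t: "t \<in> {0<..<1}" for t
  proof (rule ccontr)
    assume "sgn (u t) \<noteq> sgn (u (1/2))"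
    then have "0 \<in> {u t..u (1/2)} \<or> 0 \<in> {u (1/2)..u t}"
      using ne[OF t] ne[OF half] by (auto simp: sgn_if split: if_splits)
    moreover have "connected (u ` {0<..<1})"
      by (intro connected_continuous_image continuous_on_subset[OF u]) auto
    moreover have "u t \<in> u ` {0<..<1}" "u (1/2) \<in> u ` {0<..<1}" using t half by blast+
    ultimately have "0 \<in> u ` {0<..<1}"
      using connected_contains_Icc[of "u ` {0<..<1}" "u t" "u (1/2)"]
        connected_contains_Icc[of "u ` {0<..<1}" "u (1/2)" "u t"] by blast
    then show False using ne by auto
  qed
  then have "sgn (u (1/2)) * u t > 0" if "t \<in> {0<..<1}" for t
    using ne[OF that] that by (metis abs_sgn mult.commute zero_less_abs_iff)
  moreover have "sgn (u (1/2)) \<in> {1, -1}" using ne[OF half] by (auto simp: sgn_if)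
  ultimately show ?thesis using that by blast
qed

lemma closure_extension_nonneg:
  fixes u :: "real \<Rightarrow> real"
  assumes u: "continuous_on {0..1} u" and nn: "\<And>t. t \<in> {0<..<1} \<Longrightarrow> 0 \<le> u t" and t: "t \<in> {0..1}"
  shows "0 \<le> u t"
  by (rule continuous_ge_on_closure[of "{0<..<1}" u]) (use u nn t in auto)

lemma closure_extension_zero:
  fixes u :: "real \<Rightarrow> real"
  assumes u: "continuous_on {0..1} u" and z: "\<And>t. t \<in> {0<..<1} \<Longrightarrow> u t = 0" and t: "t \<in> {0..1}"
  shows "u t = 0"
proof -
  have "0 \<le> u t" by (rule closure_extension_nonneg[OF u _ t]) (use z in auto)
  moreover have "0 \<le> - u t"
    by (rule closure_extension_nonneg[of "\<lambda>t. - u t", OF _ _ t]) (use u z in \<open>auto intro: continuous_intros\<close>)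
  ultimately show ?thesis by simp
qed

section \<open>Minimizers between adjacent quadrants\<close>

lemma action_flip:
  assumes "p \<in> {1, -1}" "q \<in> {1, -1}" "r \<in> {1, -1}" "s \<in> {1, -1}" "p * q * r * s = 1" "W \<in> H1"
  shows "(\<lambda>t. flip p q r s (W t)) \<in> H1" "action m (\<lambda>t. flip p q r s (W t)) = action m W"
proof -
  obtain w where w: "has_L2_derivative W w" using assms(6) by (auto simp: H1_def)
  have fw: "has_L2_derivative (\<lambda>t. flip p q r s (W t)) (\<lambda>t. flip p q r s (w t))"
    by (rule has_L2_derivative_linear[OF w bounded_linear_flip])
  then show "(\<lambda>t. flip p q r s (W t)) \<in> H1" by (rule has_L2_derivative_H1)
  show "action m (\<lambda>t. flip p q r s (W t)) = action m W"
    unfolding action_eq[OF fw] action_eq[OF w] kinetic_flip[OF assms(1-4)] potential_flip[OF assms(1-5)] ..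
qed

text \<open>Undoes the folding where the signs are known; the last sign is \<open>- d\<close>
  because folding makes the second imaginary part nonpositive.\<close>

lemma flip_fold_into_cone:
  assumes "a \<in> {1, -1}" "b \<in> {1, -1}" "c \<in> {1, -1}" "d \<in> {1, -1}"
    "fst z \<in> closed_sign_quadrant a b" "snd z \<in> closed_sign_quadrant c d"
  shows "flip a b c (- d) (fold_into_cone z) = z"
proof -
  have *: "s * \<bar>x\<bar> = x" if "s \<in> {1, -1}" "s * x \<ge> 0" for s x :: real
    using that by auto
  show ?thesis
    using assms by (simp add: flip_def fold_into_cone_def closed_sign_quadrant_def * prod_eq_iff complex_eq_iff)
qed

lemma sign_product_continuous:
  assumes "continuous_on S Z"
  shows "continuous_on S (\<lambda>t. sign_product (Z t))"
  unfolding sign_product_def by (intro continuous_intros assms)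

text \<open>Both ends lie in the same pair of quadrants, so one reflection \<open>T\<close> unfolds
  both and turns every competitor of the folded path into one of \<open>Z\<close>. Hence the two
  actions agree, and the pointwise inequality between their integrands cannot be strict on a set of
  positive measure.\<close>

lemma minimizer_fold:
  assumes m: "m > 0" and min: "action_minimizer m Z"
    and signs: "a \<in> {1, -1}" "b \<in> {1, -1}" "c \<in> {1, -1}" "d \<in> {1, -1}" "a * b * c * d = -1"
    and ends: "fst (Z 0) \<in> closed_sign_quadrant a b" "snd (Z 0) \<in> closed_sign_quadrant c d"
      "fst (Z 1) \<in> closed_sign_quadrant a b" "snd (Z 1) \<in> closed_sign_quadrant c d"
  shows "action_minimizer m (\<lambda>t. fold_into_cone (Z t))" "action m Z \<noteq> top"
    "\<And>t. t \<in> {0<..<1} \<Longrightarrow> sign_product (Z t) \<le> 0"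
proof -
  define C where "C = (\<lambda>t. fold_into_cone (Z t))"
  define T where "T = flip a b c (- d)"
  \<comment> \<open>Adjacency enters here: it makes the product of the signs of \<open>T\<close>
    equal to 1, the condition under which a reflection preserves the potential.\<close>
  have signs': "- d \<in> {1, -1}" "a * b * c * - d = 1" using signs(4,5) by auto
  note T = action_flip[OF signs(1-3) signs', folded T_def]
  have TC: "T (C 0) = Z 0" "T (C 1) = Z 1"
    unfolding T_def C_def using flip_fold_into_cone[OF signs(1-4)] ends by blast+
  have Z: "Z \<in> H1" "\<And>W. W \<in> H1 \<Longrightarrow> W 0 = Z 0 \<Longrightarrow> W 1 = Z 1 \<Longrightarrow> action m Z \<le> action m W"
    using min by (auto simp: action_minimizer_def)
  obtain g where g: "has_L2_derivative Z g" using Z(1) by (auto simp: H1_def)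
  obtain h where h: "has_L2_derivative C h" "\<And>m t. m > 0 \<Longrightarrow> kinetic m (h t) \<le> kinetic m (g t)"
    by (rule has_L2_derivative_fold[OF g, folded C_def]) (rule that)
  define fC fZ where "fC t = ennreal (kinetic m (h t)) + potential m (C t)"
    and "fZ t = ennreal (kinetic m (g t)) + potential m (Z t)" for t
  have aC: "action m C = (\<integral>\<^sup>+ t. fC t \<partial>unit_lebesgue)" and aZ: "action m Z = (\<integral>\<^sup>+ t. fZ t \<partial>unit_lebesgue)"
    unfolding fC_def fZ_def by (rule action_eq[OF h(1)], rule action_eq[OF g])
  have le: "fC t \<le> fZ t" for t
    unfolding fC_def fZ_def C_def by (intro add_mono ennreal_leI h(2)[OF m] potential_fold_le[OF m])
  have CZ: "action m C \<le> action m Z"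
    unfolding aC aZ by (intro nn_integral_mono le)
  have CH: "C \<in> H1" by (rule has_L2_derivative_H1[OF h(1)])
  have ZC: "action m Z \<le> action m W" if W: "W \<in> H1" "W 0 = C 0" "W 1 = C 1" for W
  proof -
    have "action m Z \<le> action m (\<lambda>t. T (W t))"
      by (rule Z(2)[OF T(1)[OF W(1)]]) (simp_all add: W TC)
    then show ?thesis unfolding T(2)[OF W(1)] .
  qed
  show minC: "action_minimizer m (\<lambda>t. fold_into_cone (Z t))"
    unfolding C_def[symmetric] action_minimizer_def using CH CZ ZC order_trans by blast
  have finC: "action m C \<noteq> top"
    using minimizer_finite_action[OF m minC] fold_into_cone_in_cone unfolding C_def by blast
  have eq: "action m Z = action m C" using CZ ZC[OF CH] by simp
  show "action m Z \<noteq> top" using eq finC by simp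
  show "sign_product (Z t) \<le> 0" if t: "t \<in> {0<..<1}" for t
  proof (rule ccontr)
    assume "\<not> sign_product (Z t) \<le> 0"
    then have pos: "sign_product (Z t) > 0" by simp
    have cont: "continuous_on {0<..<1} (\<lambda>t. sign_product (Z t))"
      by (rule sign_product_continuous, rule continuous_on_subset[OF has_L2_derivative_continuous[OF g]]) auto
    \<comment> \<open>By continuity a single bad time produces an open set of them, which is not
      negligible.\<close>
    define Pos where "Pos = {0<..<1} \<inter> (\<lambda>t. sign_product (Z t)) -` {0<..}"
    have "open Pos" unfolding Pos_def
      by (rule continuous_open_preimage[OF cont]) auto
    have "t \<in> Pos" using t pos by (simp add: Pos_def)
    have less: "fC s < fZ s" if "s \<in> Pos" for s
    proof -
      have p: "potential m (C s) < potential m (Z s)"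
        unfolding C_def using that by (intro potential_fold_less[OF m]) (simp add: Pos_def)
      have "fC s \<le> ennreal (kinetic m (g s)) + potential m (C s)"
        unfolding fC_def by (intro add_right_mono ennreal_leI h(2)[OF m])
      also have "\<dots> < fZ s" unfolding fZ_def using p by (simp add: ennreal_add_left_cancel_less)
      finally show ?thesis .
    qed
    have "\<not> (AE s in unit_lebesgue. fZ s \<le> fC s)"
    proof
      assume "AE s in unit_lebesgue. fZ s \<le> fC s"
      then have "AE s in lborel. s \<notin> Pos"
        unfolding AE_unit_lebesgue
      proof eventually_elim
        case (elim s)
        then show ?case using less[of s] by (force simp: Pos_def)
      qed
      then have "Pos \<in> null_sets lborel"
        using \<open>open Pos\<close> by (subst AE_iff_null_sets) auto
      then have "negligible Pos" by (simp add: negligible_iff_null_sets null_sets_completionI)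
      then show False using open_not_negligible[OF \<open>open Pos\<close>] \<open>t \<in> Pos\<close> by blast
    qed
    moreover have "fC \<in> borel_measurable unit_lebesgue" "fZ \<in> borel_measurable unit_lebesgue"
      unfolding fC_def fZ_def
      by (intro borel_measurable_add potential_borel_measurable has_L2_derivative_continuous[OF g] has_L2_derivative_continuous[OF h(1)]
          measurable_compose[OF kinetic_borel_measurable measurable_ennreal] has_L2_derivativeD(1)[OF g] has_L2_derivativeD(1)[OF h(1)])+
    ultimately have "action m C < action m Z"
      unfolding aC aZ using finC le unfolding aC by (intro nn_integral_less) (auto simp: infinity_ennreal_def)
    then show False using eq by simp
  qed
qed

text \<open>The folded coordinates are the absolute values of those of \<open>Z\<close>, so zeros
  correspond. The flow speaks of the open interval only; continuity adds the ends.\<close>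

lemma minimizer_dichotomy:
  fixes u1 u2 u3 u4 :: "real \<Rightarrow> real"
  assumes m: "m > 0" and min: "action_minimizer m (\<lambda>t. fold_into_cone (Z t))" and Z: "Z \<in> H1"
    and u: "u1 = (\<lambda>t. Re (fst (Z t)))" "u2 = (\<lambda>t. Im (fst (Z t)))" "u3 = (\<lambda>t. Re (snd (Z t)))" "u4 = (\<lambda>t. Im (snd (Z t)))"
    and t: "t \<in> {0<..<1}"
  shows "u1 t = 0 \<Longrightarrow> (u2 t = 0 \<or> u3 t = 0 \<or> u4 t = 0) \<and> (\<forall>s\<in>{0..1}. u1 s = 0)"
    "u2 t = 0 \<Longrightarrow> (u1 t = 0 \<or> u3 t = 0 \<or> u4 t = 0) \<and> (\<forall>s\<in>{0..1}. u2 s = 0)"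
    "u3 t = 0 \<Longrightarrow> (u1 t = 0 \<or> u2 t = 0 \<or> u4 t = 0) \<and> (\<forall>s\<in>{0..1}. u3 s = 0)"
    "u4 t = 0 \<Longrightarrow> (u1 t = 0 \<or> u2 t = 0 \<or> u3 t = 0) \<and> (\<forall>s\<in>{0..1}. u4 s = 0)"
proof -
  obtain \<theta> \<kappa> \<mu> \<nu> where "coupled_flow (\<lambda>t. Re (fst (fold_into_cone (Z t)))) (\<lambda>t. Im (fst (fold_into_cone (Z t))))
     (\<lambda>t. Re (snd (fold_into_cone (Z t)))) (\<lambda>t. - Im (snd (fold_into_cone (Z t)))) \<theta> \<kappa> \<mu> \<nu>"
    by (rule minimizer_in_cone_coupled_flow[OF m min fold_into_cone_in_cone]) (rule that)
  then have flow: "coupled_flow (\<lambda>t. \<bar>u1 t\<bar>) (\<lambda>t. \<bar>u2 t\<bar>) (\<lambda>t. \<bar>u3 t\<bar>) (\<lambda>t. \<bar>u4 t\<bar>) \<theta> \<kappa> \<mu> \<nu>"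
    by (simp add: fold_into_cone_def u)
  note flow2 = coupled_flow_swap(1)[OF flow]
  note flow3 = coupled_flow_swap(2)[OF flow] and flow4 = coupled_flow_swap(2)[OF flow2]
  obtain g where "has_L2_derivative Z g" using Z by (auto simp: H1_def)
  then have cont: "continuous_on {0..1} Z" by (rule has_L2_derivative_continuous)
  have ext: "\<forall>s\<in>{0..1}. w s = 0" if "\<forall>s\<in>{0<..<1}. \<bar>w s\<bar> = 0" "continuous_on {0..1} w" for w :: "real \<Rightarrow> real"
    using closure_extension_zero[OF that(2)] that(1) by simp
  show "(u2 t = 0 \<or> u3 t = 0 \<or> u4 t = 0) \<and> (\<forall>s\<in>{0..1}. u1 s = 0)" if "u1 t = 0"
    using coupled_flow_vanishing[OF flow t] that by (intro conjI ext) (auto simp: u intro!: continuous_intros cont)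
  show "(u1 t = 0 \<or> u3 t = 0 \<or> u4 t = 0) \<and> (\<forall>s\<in>{0..1}. u2 s = 0)" if "u2 t = 0"
    using coupled_flow_vanishing[OF flow2 t] that by (intro conjI ext) (auto simp: u intro!: continuous_intros cont)
  show "(u1 t = 0 \<or> u2 t = 0 \<or> u4 t = 0) \<and> (\<forall>s\<in>{0..1}. u3 s = 0)" if "u3 t = 0"
    using coupled_flow_vanishing[OF flow3 t] that by (intro conjI ext) (auto simp: u intro!: continuous_intros cont)
  show "(u1 t = 0 \<or> u2 t = 0 \<or> u3 t = 0) \<and> (\<forall>s\<in>{0..1}. u4 s = 0)" if "u4 t = 0"
    using coupled_flow_vanishing[OF flow4 t] that by (intro conjI ext) (auto simp: u intro!: continuous_intros cont)
qed

text \<open>For a function vanishing identically the sign \<open>s\<close> carries no information;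
  the last clause records this, so that the sign may be reversed later.\<close>

lemma weak_sign:
  fixes u :: "real \<Rightarrow> real"
  assumes u: "continuous_on {0..1} u"
    and z: "\<And>t. t \<in> {0<..<1} \<Longrightarrow> u t = 0 \<Longrightarrow> \<forall>s\<in>{0..1}. u s = 0"
  obtains s where "s \<in> {1, -1}" "\<forall>t\<in>{0..1}. s * u t \<ge> 0" "(\<forall>t\<in>{0<..<1}. s * u t > 0) \<or> (\<forall>t\<in>{0..1}. u t = 0)"
proof (cases "\<exists>t\<in>{0<..<1}. u t = 0")
  case True
  then have "\<forall>s\<in>{0..1}. u s = 0" using z by blast
  then show ?thesis using that[of 1] by simp
next
  case False
  then obtain s where s: "s \<in> {1, -1}" "\<And>t. t \<in> {0<..<1} \<Longrightarrow> s * u t > 0"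
    using constant_sign[OF u] by blast
  have "s * u t \<ge> 0" if "t \<in> {0..1}" for t
    by (rule closure_extension_nonneg[OF _ _ that]) (use u s(2) in \<open>auto intro!: continuous_intros less_imp_le\<close>)
  with s show ?thesis using that by blast
qed

theorem theorem1p1:
  fixes m :: real and Z :: "real \<Rightarrow> complex \<times> complex" and i j :: nat
  assumes "m > 0"
    and "adjacent_quadrants i j"
    and "fst (Z 0) \<in> closure (quadrant i)" "fst (Z 1) \<in> closure (quadrant i)"
    and "snd (Z 0) \<in> closure (quadrant j)" "snd (Z 1) \<in> closure (quadrant j)"
    and "Z \<in> H1"
    and "action m Z = (INF W\<in>fixed_end_paths (Z 0) (Z 1). action m W)"
  shows "(\<exists>k l. adjacent_quadrants k l \<and>
            (\<forall>t\<in>{0..1}. fst (Z t) \<in> closure (quadrant k) \<and> snd (Z t) \<in> closure (quadrant l)))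
    \<and> ((\<forall>t\<in>{0<..<1}. fst (Z t) \<notin> coordinate_axes \<and> snd (Z t) \<notin> coordinate_axes)
      \<or> ((\<forall>t\<in>{0..1}. fst (Z t) \<in> coordinate_axes \<and> snd (Z t) \<in> coordinate_axes)
          \<and> (\<forall>t\<in>{0<..<1}. fst (Z t) \<noteq> 0 \<and> snd (Z t) \<noteq> 0))
      \<or> (part_of_euler_orbit m Z \<and> (\<forall>t\<in>{0..1}. snd (Z t) = 0)))"
proof -
  note m = assms(1) and ZH = assms(7)
  let ?I = "{0<..<1::real}"
  have min: "action_minimizer m Z"
    unfolding action_minimizer_def
  proof (intro conjI ballI impI ZH)
    fix W assume "W \<in> H1" "W 0 = Z 0" "W 1 = Z 1"
    then show "action m Z \<le> action m W"
      unfolding assms(8) by (intro INF_lower) (simp add: fixed_end_paths_def)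
  qed
  obtain a b c d where signs: "a \<in> {1, -1}" "b \<in> {1, -1}" "c \<in> {1, -1}" "d \<in> {1, -1}" "a * b * c * d = -1"
    and quadrants: "closure (quadrant i) = closed_sign_quadrant a b" "closure (quadrant j) = closed_sign_quadrant c d"
    using adjacent_quadrants_signs[OF assms(2)] by metis
  note fold = minimizer_fold[OF m min signs assms(3,5,4,6)[unfolded quadrants]]
  have cf: "collision_free (Z t)" if t: "t \<in> ?I" for t
    using minimizer_in_cone_collision_free[OF m fold(1) fold_into_cone_in_cone t] collision_free_fold[OF fold(3)[OF t]] by simp
  define u1 u2 u3 u4 where u: "u1 = (\<lambda>t. Re (fst (Z t)))" "u2 = (\<lambda>t. Im (fst (Z t)))"
    "u3 = (\<lambda>t. Re (snd (Z t)))" "u4 = (\<lambda>t. Im (snd (Z t)))"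
  note dich = minimizer_dichotomy[OF m fold(1) ZH u]
  obtain g where "has_L2_derivative Z g" using ZH by (auto simp: H1_def)
  then have cont: "continuous_on {0..1} Z" by (rule has_L2_derivative_continuous)
  have contu: "continuous_on {0..1} u1" "continuous_on {0..1} u2" "continuous_on {0..1} u3" "continuous_on {0..1} u4"
    unfolding u by (intro continuous_intros cont)+
  have ne: "\<not> (u1 t = 0 \<and> u2 t = 0)" if "t \<in> ?I" for t
    using cf[OF that] by (auto simp: collision_free_def u complex_eq_iff)
  obtain s1 where s1: "s1 \<in> {1, -1}" "\<forall>t\<in>{0..1}. s1 * u1 t \<ge> 0" "(\<forall>t\<in>?I. s1 * u1 t > 0) \<or> (\<forall>t\<in>{0..1}. u1 t = 0)"
    using weak_sign[OF contu(1)] dich(1) by metis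
  obtain s2 where s2: "s2 \<in> {1, -1}" "\<forall>t\<in>{0..1}. s2 * u2 t \<ge> 0" "(\<forall>t\<in>?I. s2 * u2 t > 0) \<or> (\<forall>t\<in>{0..1}. u2 t = 0)"
    using weak_sign[OF contu(2)] dich(2) by metis
  obtain s3 where s3: "s3 \<in> {1, -1}" "\<forall>t\<in>{0..1}. s3 * u3 t \<ge> 0" "(\<forall>t\<in>?I. s3 * u3 t > 0) \<or> (\<forall>t\<in>{0..1}. u3 t = 0)"
    using weak_sign[OF contu(3)] dich(3) by metis
  obtain s4 where s4: "s4 \<in> {1, -1}" "\<forall>t\<in>{0..1}. s4 * u4 t \<ge> 0" "(\<forall>t\<in>?I. s4 * u4 t > 0) \<or> (\<forall>t\<in>{0..1}. u4 t = 0)"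
    using weak_sign[OF contu(4)] dich(4) by metis
  have conclude: "\<exists>k l. adjacent_quadrants k l \<and>
            (\<forall>t\<in>{0..1}. fst (Z t) \<in> closure (quadrant k) \<and> snd (Z t) \<in> closure (quadrant l))"
    if r: "r1 \<in> {1, -1}" "r2 \<in> {1, -1}" "r3 \<in> {1, -1}" "r4 \<in> {1, -1}" "r1 * r2 * r3 * r4 = -1"
      and w: "\<forall>t\<in>{0..1}. r1 * u1 t \<ge> 0" "\<forall>t\<in>{0..1}. r2 * u2 t \<ge> 0" "\<forall>t\<in>{0..1}. r3 * u3 t \<ge> 0" "\<forall>t\<in>{0..1}. r4 * u4 t \<ge> 0"
    for r1 r2 r3 r4
  proof -
    obtain k l where kl: "adjacent_quadrants k l" "closure (quadrant k) = closed_sign_quadrant r1 r2"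
       "closure (quadrant l) = closed_sign_quadrant r3 r4"
      using signs_adjacent_quadrants[OF r] by metis
    then show ?thesis
      using w by (intro exI[of _ k] exI[of _ l]) (simp add: closed_sign_quadrant_def u)
  qed
  have half: "1/2 \<in> ?I" by simp
  show ?thesis
  proof (cases "\<exists>t\<in>?I. u1 t = 0 \<or> u2 t = 0 \<or> u3 t = 0 \<or> u4 t = 0")
    case False
    then have nz: "u1 t \<noteq> 0" "u2 t \<noteq> 0" "u3 t \<noteq> 0" "u4 t \<noteq> 0" if "t \<in> ?I" for t using that by blast+
    have nn: "s1 * u1 (1/2) \<ge> 0" "s2 * u2 (1/2) \<ge> 0" "s3 * u3 (1/2) \<ge> 0" "s4 * u4 (1/2) \<ge> 0"
      using s1(2) s2(2) s3(2) s4(2) by simp_all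
    have "(s1 * u1 (1/2)) * (s2 * u2 (1/2)) * ((s3 * u3 (1/2)) * (s4 * u4 (1/2))) \<ge> 0"
      by (rule mult_nonneg_nonneg[OF mult_nonneg_nonneg[OF nn(1,2)] mult_nonneg_nonneg[OF nn(3,4)]])
    \<comment> \<open>The product of the four signed coordinates is the product of the signs times
      \<open>sign_product\<close>. The latter is negative, so the former must be
      \<open>-1\<close>.\<close>
    then have "(s1 * s2 * s3 * s4) * sign_product (Z (1/2)) \<ge> 0"
      by (simp add: sign_product_def u mult_ac)
    moreover have "sign_product (Z (1/2)) < 0"
      using fold(3)[OF half] nz[OF half] by (simp add: sign_product_def u order_less_le)
    moreover have "s1 * s2 * s3 * s4 = 1 \<or> s1 * s2 * s3 * s4 = -1"
      using s1(1) s2(1) s3(1) s4(1) by auto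
    ultimately have "s1 * s2 * s3 * s4 = -1" by auto
    from conclude[OF s1(1) s2(1) s3(1) s4(1) this s1(2) s2(2) s3(2) s4(2)]
    show ?thesis using nz by (simp add: coordinate_axes_def u)
  next
    case True
    then obtain t0 where t0: "t0 \<in> ?I" "u1 t0 = 0 \<or> u2 t0 = 0 \<or> u3 t0 = 0 \<or> u4 t0 = 0" by blast
    note d0 = dich[OF t0(1)]
    have neg: "- s \<in> {1, -1}" if "s \<in> {1, -1}" for s :: real using that by auto
    have "s1 * s2 * s3 * s4 = 1 \<or> s1 * s2 * s3 * s4 = -1"
      using s1(1) s2(1) s3(1) s4(1) by auto
    then have quadrants: "\<exists>k l. adjacent_quadrants k l \<and>
            (\<forall>t\<in>{0..1}. fst (Z t) \<in> closure (quadrant k) \<and> snd (Z t) \<in> closure (quadrant l))"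
    proof
      \<comment> \<open>The coordinate vanishing at \<open>t0\<close> vanishes identically and
        carries either sign; reversing it corrects the product to \<open>-1\<close>.\<close>
      assume p: "s1 * s2 * s3 * s4 = 1"
      from t0(2) show ?thesis
      proof (elim disjE)
        assume "u1 t0 = 0"
        then have "\<forall>t\<in>{0..1}. - s1 * u1 t \<ge> 0" using d0(1) by simp
        from conclude[OF neg[OF s1(1)] s2(1) s3(1) s4(1) _ this s2(2) s3(2) s4(2)] p show ?thesis by simp
      next
        assume "u2 t0 = 0"
        then have "\<forall>t\<in>{0..1}. - s2 * u2 t \<ge> 0" using d0(2) by simp
        from conclude[OF s1(1) neg[OF s2(1)] s3(1) s4(1) _ s1(2) this s3(2) s4(2)] p show ?thesis by simp
      next
        assume "u3 t0 = 0"
        then have "\<forall>t\<in>{0..1}. - s3 * u3 t \<ge> 0" using d0(3) by simp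
        from conclude[OF s1(1) s2(1) neg[OF s3(1)] s4(1) _ s1(2) s2(2) this s4(2)] p show ?thesis by simp
      next
        assume "u4 t0 = 0"
        then have "\<forall>t\<in>{0..1}. - s4 * u4 t \<ge> 0" using d0(4) by simp
        from conclude[OF s1(1) s2(1) s3(1) neg[OF s4(1)] _ s1(2) s2(2) s3(2) this] p show ?thesis by simp
      qed
    next
      assume "s1 * s2 * s3 * s4 = -1"
      from conclude[OF s1(1) s2(1) s3(1) s4(1) this s1(2) s2(2) s3(2) s4(2)] show ?thesis .
    qed
    show ?thesis
    proof (cases "(\<forall>t\<in>{0..1}. u3 t = 0) \<and> (\<forall>t\<in>{0..1}. u4 t = 0)")
      case True
      then have snd0: "\<forall>t\<in>{0..1}. snd (Z t) = 0" by (simp add: u complex_eq_iff)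
      have "newton_solution m Z {t\<in>{0..1}. collision_free (Z t)}"
        by (rule minimizer_newton_solution_collision_free[OF m min fold(2) cf])
      then have "part_of_euler_orbit m Z"
        unfolding part_of_euler_orbit_def euler_orbit_def using cf snd0 by simp
      then show ?thesis using quadrants snd0 by blast
    next
      case False
      have ne2: "\<not> (u3 t = 0 \<and> u4 t = 0)" if "t \<in> ?I" for t
        using False dich(3,4)[OF that] by blast
      \<comment> \<open>The zero at \<open>t0\<close> forces a second coordinate to vanish there.
        Since neither vector is zero at \<open>t0\<close>, that coordinate belongs to the other
        vector, and both vanish identically.\<close>
      have "((\<forall>t\<in>{0..1}. u1 t = 0) \<or> (\<forall>t\<in>{0..1}. u2 t = 0)) \<and> ((\<forall>t\<in>{0..1}. u3 t = 0) \<or> (\<forall>t\<in>{0..1}. u4 t = 0))"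
        using t0(2) d0 ne[OF t0(1)] ne2[OF t0(1)] by blast
      then have "\<forall>t\<in>{0..1}. fst (Z t) \<in> coordinate_axes \<and> snd (Z t) \<in> coordinate_axes"
        by (auto simp: coordinate_axes_def u)
      moreover have "\<forall>t\<in>?I. fst (Z t) \<noteq> 0 \<and> snd (Z t) \<noteq> 0"
        using ne ne2 by (auto simp: u complex_eq_iff)
      ultimately show ?thesis using quadrants by blast
    qed
  qed
qed

end
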